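(* Let $N\ge 2$ be an integer, let $p>1$ be real with $1<p^{2}<N$, let $0<\mu\le N^{p-1}(N-p^{2})/p^{p}$, let $B$ be an open finite ball in $\mathbb{R}^{N}$ centered at the origin, let $p^{*}=Np/(N-p)$, and let $0<\lambda<\lambda_{1}(\mu)$, where $$\lambda_{1}(\mu)=\inf_{u\in W_{0}^{1,p}(B)\setminus\{0\}}\frac{\int_{B}\left(|\nabla u|^{p}-\mu|x|^{-p}|u|^{p}\right)dx}{\int_{B}|u|^{p}dx}.$$ Then the equation $$\begin{cases}-\Delta_{p}u-\dfrac{\mu}{|x|^{p}}|u|^{p-2}u=|u|^{p^{*}-2}u+\lambda|u|^{p-2}u & \text{in }B,\\ u=0 & \text{on }\partial B,\end{cases}$$ admits at most one positive radial (weak) solution in $B$.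
   Context: $\Delta_{p}u=\sum_{i=1}^{N}\partial_{x_{i}}(|\nabla u|^{p-2}\partial_{x_{i}}u)$ is the $p$-Laplacian. $W_{0}^{1,p}(B)$ is the completion of $C_{0}^{\infty}(B)$ in the norm $\|\nabla u\|_{L^{p}(B)}$. A (weak) solution is a function $u\in W_{0}^{1,p}(B)$ such that for all $\varphi\in C_{0}^{\infty}(B)$, $$\int_{B}\left(|\nabla u|^{p-2}\nabla u\cdot\nabla\varphi-\frac{\mu}{|x|^{p}}|u|^{p-2}u\varphi-\lambda|u|^{p-2}u\varphi\right)dx=\int_{B}|u|^{p^{*}-2}u\,\varphi\, dx.$$ A radial function in $W_{0}^{1,p}(B)$ is identified with its representative that is continuous on $B\setminus\{0\}$ and written $u(x)=u(r)$, $r=|x|$; "positive" means $u(r)>0$ for every $r>0$ less than the radius of $B$. *)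

theory Defs
  imports "HOL-Analysis.Analysis"
begin

primrec C_k :: "nat \<Rightarrow> ('a::euclidean_space \<Rightarrow> real) \<Rightarrow> bool" where
  "C_k 0 f \<longleftrightarrow> continuous_on UNIV f"
| "C_k (Suc k) f \<longleftrightarrow> (\<forall>x. f differentiable (at x)) \<and>
     (\<forall>i\<in>Basis. C_k k (\<lambda>x. frechet_derivative f (at x) i))"

(* Elements of C_0^oo(B), extended by zero to the whole space. *)
definition test_function :: "'a::euclidean_space set \<Rightarrow> ('a \<Rightarrow> real) \<Rightarrow> bool" where
  "test_function B \<phi> \<longleftrightarrow> (\<forall>k. C_k k \<phi>) \<and>
     compact (closure {x. \<phi> x \<noteq> 0}) \<and> closure {x. \<phi> x \<noteq> 0} \<subseteq> B"

definition grad :: "('a::euclidean_space \<Rightarrow> real) \<Rightarrow> 'a \<Rightarrow> 'a" where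
  "grad \<phi> x = (\<Sum>i\<in>Basis. frechet_derivative \<phi> (at x) i *\<^sub>R i)"

definition Lp_tendsto ::
  "real \<Rightarrow> 'a::euclidean_space set \<Rightarrow> (nat \<Rightarrow> 'a \<Rightarrow> 'b::euclidean_space) \<Rightarrow> ('a \<Rightarrow> 'b) \<Rightarrow> bool" where
  "Lp_tendsto p B f g \<longleftrightarrow>
     (\<lambda>n. \<integral>\<^sup>+ x. ennreal (norm (f n x - g x) powr p) \<partial>lebesgue_on B) \<longlonglongrightarrow> 0"

(* W0_gradient p B u g: u is an element of W_0^{1,p}(B), and g is its gradient.

   The space is the completion of C_0^oo(B) in the norm of grad in L^p(B).  A sequence of test
   functions that is Cauchy in this norm has L^p-convergent gradients and, for bounded B, is itself
   L^p-convergent by the Poincare inequality; the element of the completion that it represents is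
   the pair (u, g) of these limits.  Integration by parts shows that g is the weak gradient of u,
   so u and g determine each other up to null sets. *)
definition W0_gradient ::
  "real \<Rightarrow> 'a::euclidean_space set \<Rightarrow> ('a \<Rightarrow> real) \<Rightarrow> ('a \<Rightarrow> 'a) \<Rightarrow> bool" where
  "W0_gradient p B u g \<longleftrightarrow>
     u \<in> borel_measurable (lebesgue_on B) \<and> g \<in> borel_measurable (lebesgue_on B) \<and>
     (\<exists>\<phi>. (\<forall>n. test_function B (\<phi> n)) \<and>
          Lp_tendsto p B (\<lambda>n. grad (\<phi> n)) g \<and> Lp_tendsto p B \<phi> u)"

(* Elements of W_0^{1,p}(B) are classes modulo null sets, so u is nonzero in this space iff
   it does not vanish almost everywhere.  The infimum is taken in the extended reals, where it
   always exists. *)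
definition lambda1 :: "real \<Rightarrow> real \<Rightarrow> 'a::euclidean_space set \<Rightarrow> ereal" where
  "lambda1 p \<mu> B = Inf {ereal
       ((\<integral>x. (norm (g x) powr p - \<mu> * norm x powr (- p) * \<bar>u x\<bar> powr p) \<partial>lebesgue_on B) /
        (\<integral>x. \<bar>u x\<bar> powr p \<partial>lebesgue_on B)) | u g.
       W0_gradient p B u g \<and> \<not> (AE x in lebesgue_on B. u x = 0)}"

definition critical_exponent :: "nat \<Rightarrow> real \<Rightarrow> real" where
  "critical_exponent N p = real N * p / (real N - p)"

(* The products |t|^(q-2) t have the intended value 0 at t = 0 also for q < 2, since
   0 powr a = 0 for every a. *)
definition weak_solution ::
  "real \<Rightarrow> real \<Rightarrow> real \<Rightarrow> 'a::euclidean_space set \<Rightarrow> ('a \<Rightarrow> real) \<Rightarrow> bool" where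
  "weak_solution p \<mu> lam B u \<longleftrightarrow>
     (\<exists>g. W0_gradient p B u g \<and>
       (\<forall>\<phi>. test_function B \<phi> \<longrightarrow>
          (\<integral>x. (norm (g x) powr (p - 2) * (g x \<bullet> grad \<phi> x)
                 - \<mu> / norm x powr p * \<bar>u x\<bar> powr (p - 2) * u x * \<phi> x
                 - lam * \<bar>u x\<bar> powr (p - 2) * u x * \<phi> x) \<partial>lebesgue_on B)
          = (\<integral>x. \<bar>u x\<bar> powr (critical_exponent DIM('a) p - 2) * u x * \<phi> x \<partial>lebesgue_on B)))"

(* A radial function is represented by the member of its class that is continuous away from the
   origin; the value at the origin is left arbitrary. *)
definition radial_on :: "'a::euclidean_space set \<Rightarrow> ('a \<Rightarrow> real) \<Rightarrow> bool" where
  "radial_on B u \<longleftrightarrow> continuous_on (B - {0}) u \<and> (\<exists>w. \<forall>x\<in>B - {0}. u x = w (norm x))"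

definition positive_radial_solution ::
  "real \<Rightarrow> real \<Rightarrow> real \<Rightarrow> 'a::euclidean_space set \<Rightarrow> ('a \<Rightarrow> real) \<Rightarrow> bool" where
  "positive_radial_solution p \<mu> lam B u \<longleftrightarrow>
     weak_solution p \<mu> lam B u \<and> radial_on B u \<and> (\<forall>x\<in>B - {0}. 0 < u x)"

end

theory Submission
  imports Defs
begin

text \<open>
  A positive radial solution solves the radial equation
  \<open>- (r^{N-1} |u'|^{p-2} u')' = r^{N-1} (\<mu> r^{-p} u^{p-1} + \<lambda> u^{p-1} + u^{p^*-1})\<close> classically on
  \<open>(0, R)\<close>, is decreasing, tends to \<open>0\<close> at \<open>R\<close>, and its Pohozaev function \<open>J(u)\<close> satisfies
  \<open>J(u)' = \<lambda> r^{N-1} u^p\<close> and tends to \<open>0\<close> at the origin, so \<open>J(u) > 0\<close>.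

  For two solutions \<open>u\<close>, \<open>v\<close> put \<open>\<rho> = v / u\<close> and \<open>X = \<rho>^p J(u) - J(v)\<close>.  The terms without \<open>\<rho>'\<close>
  cancel, leaving \<open>X' = p \<rho>^{p-1} \<rho>' J(u)\<close>: \<open>X\<close> is monotone wherever \<open>\<rho>\<close> is.  Moreover \<open>X\<close> tends to
  \<open>0\<close> at \<open>R\<close>, and at a zero of \<open>\<rho>'\<close> the sign of \<open>X\<close> is that of \<open>1 - \<rho>\<close>, while \<open>\<rho>\<close> has a strict local
  maximum there if \<open>\<rho> > 1\<close> and a strict local minimum if \<open>\<rho> < 1\<close>.  Following \<open>\<rho>\<close> from a critical
  point to the next one, or to \<open>R\<close>, contradicts the monotonicity of \<open>X\<close>; so either \<open>u = v\<close>, or \<open>\<rho>\<close>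
  has no critical point.  In the latter case we may take \<open>\<rho>\<close> increasing, hence bounded near \<open>0\<close>,
  and \<open>X\<close> would increase strictly from \<open>0\<close> to \<open>0\<close>.
\<close>

section \<open>The radial equation as a first-order system\<close>

text \<open>The power \<open>\<rho>^p\<close> in \<open>X\<close> is dictated by scaling. The
  gradient, flux, Hardy and \<open>lam\<close> terms of \<open>J\<close>, and also
  \<open>J'\<close>, are homogeneous of degree p in (u, u'). Where u'/u = v'/v they all cancel in
  \<open>X\<close>, and only the critical term, of degree \<open>ps\<close> > p, decides the sign.
  Critical points of \<open>\<rho>\<close> are treated without second derivatives, through the
  Riccati variable q / w^(p-1) = r^(N-1) (-w'/w)^(p-1). The Riccati variables of u and v meet
  exactly where \<open>\<rho>'\<close> = 0, and w survives in their equation only as w^(ps-p), so a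
  crossing at which u and v differ is transversal. The obstacle is the origin, where the potential
  is singular and no initial value is available. All information there comes from the finite energy,
  the integral of r^(N-1) |w'|^p: it forces the flux to be positive and \<open>J\<close> to vanish
  at 0. A weak solution has only an L^p gradient. That this gradient is radial, that its flux is
  regular and that the profile vanishes at R must all be extracted from integral identities.\<close>

lemma gronwall_zero:
  fixes f g :: "real \<Rightarrow> real"
  assumes df: "\<And>t. t \<in> {c..d} \<Longrightarrow> (f has_real_derivative f' t) (at t)"
    and dg: "\<And>t. t \<in> {c..d} \<Longrightarrow> (g has_real_derivative g' t) (at t)"
    and bf: "\<And>t. t \<in> {c..d} \<Longrightarrow> \<bar>f' t\<bar> \<le> L * \<bar>g t\<bar>"
    and bg: "\<And>t. t \<in> {c..d} \<Longrightarrow> \<bar>g' t\<bar> \<le> L * \<bar>f t\<bar>"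
    and s: "s \<in> {c..d}" "f s = 0" "g s = 0" and t: "t \<in> {c..d}"
  shows "f t = 0"
proof -
  \<comment> \<open>The crossed bounds give |h'| <= 2 L h. Hence h exp(-2Lt) is nonincreasing and h
    exp(2Lt) nondecreasing, which carries h s = 0 to the right and to the left of s.\<close>
  define h where "h t = (f t)\<^sup>2 + (g t)\<^sup>2" for t
  define h' where "h' t = 2 * f t * f' t + 2 * g t * g' t" for t
  have dh: "(h has_real_derivative h' t) (at t)" if "t \<in> {c..d}" for t
    unfolding h_def[abs_def] h'_def using df[OF that] dg[OF that]
    by (auto intro!: derivative_eq_intros)
  have bh: "\<bar>h' t\<bar> \<le> 2 * L * h t" if t: "t \<in> {c..d}" for t
  proof -
    have "\<bar>2 * f t * f' t\<bar> \<le> 2 * \<bar>f t\<bar> * (L * \<bar>g t\<bar>)"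
      using mult_left_mono[OF bf[OF t], of "2 * \<bar>f t\<bar>"] by (simp add: abs_mult)
    moreover have "\<bar>2 * g t * g' t\<bar> \<le> 2 * \<bar>g t\<bar> * (L * \<bar>f t\<bar>)"
      using mult_left_mono[OF bg[OF t], of "2 * \<bar>g t\<bar>"] by (simp add: abs_mult)
    ultimately have "\<bar>h' t\<bar> \<le> 2 * (L * (2 * \<bar>f t\<bar> * \<bar>g t\<bar>))"
      using abs_triangle_ineq[of "2 * f t * f' t" "2 * g t * g' t"] unfolding h'_def
      by (simp add: mult_ac)
    moreover have "L * (2 * \<bar>f t\<bar> * \<bar>g t\<bar>) \<le> L * h t"
    \<comment> \<open>A negative L is compatible with the bounds only if f and g vanish at
      t.\<close>
    proof (cases "L \<ge> 0")
      case True
      have "2 * \<bar>f t\<bar> * \<bar>g t\<bar> \<le> h t"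
        using sum_squares_bound[of "\<bar>f t\<bar>" "\<bar>g t\<bar>"] by (simp add: h_def)
      then show ?thesis using True by (rule mult_left_mono)
    next
      case False
      then have "f t = 0" "g t = 0"
        using bf[OF t] bg[OF t] by (smt (verit) mult_neg_pos abs_ge_zero zero_less_abs_iff)+
      then show ?thesis by (simp add: h_def)
    qed
    ultimately show ?thesis by simp
  qed
  have nn: "h t \<ge> 0" for t by (simp add: h_def)
  have "h t \<le> 0"
  proof (cases "s \<le> t")
    case True
    have "h t * exp (- (2 * L) * t) \<le> h s * exp (- (2 * L) * s)"
    proof (rule DERIV_nonpos_imp_nonincreasing[OF True])
      fix x assume "s \<le> x" "x \<le> t"
      then have x: "x \<in> {c..d}" using s t by auto
      have "((\<lambda>t. h t * exp (- (2 * L) * t)) has_real_derivative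
          (h' x - 2 * L * h x) * exp (- (2 * L) * x)) (at x)"
        using dh[OF x] by (auto intro!: derivative_eq_intros simp: algebra_simps)
      moreover have "(h' x - 2 * L * h x) * exp (- (2 * L) * x) \<le> 0"
        using bh[OF x] by (intro mult_nonpos_nonneg) auto
      ultimately show "\<exists>y. ((\<lambda>t. h t * exp (- (2 * L) * t)) has_real_derivative y) (at x) \<and> y \<le> 0"
        by blast
    qed
    then show ?thesis using s by (simp add: h_def mult_le_0_iff)
  next
    case False
    then have ts: "t \<le> s" by simp
    have "h t * exp (2 * L * t) \<le> h s * exp (2 * L * s)"
    proof (rule DERIV_nonneg_imp_nondecreasing[OF ts])
      fix x assume "t \<le> x" "x \<le> s"
      then have x: "x \<in> {c..d}" using s t by auto
      have "((\<lambda>t. h t * exp (2 * L * t)) has_real_derivative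
          (h' x + 2 * L * h x) * exp (2 * L * x)) (at x)"
        using dh[OF x] by (auto intro!: derivative_eq_intros simp: algebra_simps)
      moreover have "(h' x + 2 * L * h x) * exp (2 * L * x) \<ge> 0"
        using bh[OF x] by (intro mult_nonneg_nonneg) auto
      ultimately show "\<exists>y. ((\<lambda>t. h t * exp (2 * L * t)) has_real_derivative y) (at x) \<and> 0 \<le> y"
        by blast
    qed
    then show ?thesis using s by (simp add: h_def mult_le_0_iff)
  qed
  then show ?thesis
    using nn[of t] by (simp add: h_def sum_power2_le_zero_iff)
qed

text \<open>Compactness of the rectangle bounds the derivative in the second variable uniformly in
  t, and the mean value inequality turns the bound into a Lipschitz constant.\<close>

lemma lipschitz_on_second:
  fixes f f' :: "real \<Rightarrow> real \<Rightarrow> real"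
  assumes d: "\<And>t y. t \<in> {c..d} \<Longrightarrow> y \<in> {m..M} \<Longrightarrow> (f t has_real_derivative f' t y) (at y)"
    and cont: "continuous_on ({c..d} \<times> {m..M}) (\<lambda>(t, y). f' t y)"
  obtains L where "0 \<le> L"
    "\<And>t y z. t \<in> {c..d} \<Longrightarrow> y \<in> {m..M} \<Longrightarrow> z \<in> {m..M} \<Longrightarrow> \<bar>f t y - f t z\<bar> \<le> L * \<bar>y - z\<bar>"
proof -
  have "compact ((\<lambda>(t, y). f' t y) ` ({c..d} \<times> {m..M}))"
    by (intro compact_continuous_image cont compact_Times) auto
  then have "bounded ((\<lambda>(t, y). f' t y) ` ({c..d} \<times> {m..M}))" by (rule compact_imp_bounded)
  then obtain L where L: "0 < L" "\<And>t y. t \<in> {c..d} \<Longrightarrow> y \<in> {m..M} \<Longrightarrow> \<bar>f' t y\<bar> \<le> L"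
    unfolding bounded_pos by force
  show thesis
  proof
    fix t y z assume t: "t \<in> {c..d}" and y: "y \<in> {m..M}" and z: "z \<in> {m..M}"
    show "\<bar>f t y - f t z\<bar> \<le> L * \<bar>y - z\<bar>"
      using field_differentiable_bound[of "{m..M}" "f t" "f' t" L y z,
          OF _ has_field_derivative_at_within[OF d[OF t]]] L(2)[OF t] y z
      by (simp add: abs_minus_commute)
  qed (use L in simp)
qed

text \<open>Dominated convergence along the radii R/(n+1); monotonicity in r passes from this
  sequence to the full one-sided limit. It serves to make the energy near the origin small.\<close>

lemma nn_integral_near_0_tendsto_0:
  fixes f :: "real \<Rightarrow> real"
  assumes f: "f \<in> borel_measurable borel" and R: "0 < R"
    and fin: "(\<integral>\<^sup>+x\<in>{0<..<R}. ennreal (f x) \<partial>lborel) < \<infinity>"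
  shows "((\<lambda>r. \<integral>\<^sup>+x\<in>{0<..<r}. ennreal (f x) \<partial>lborel) \<longlongrightarrow> 0) (at_right 0)"
proof -
  have "(\<lambda>n. \<integral>\<^sup>+x\<in>{0<..<R / real (Suc n)}. ennreal (f x) \<partial>lborel) \<longlonglongrightarrow> (\<integral>\<^sup>+x. 0 \<partial>(lborel :: real measure))"
  proof (rule nn_integral_dominated_convergence[where w = "\<lambda>x. ennreal (f x) * indicator {0<..<R} x"])
    have "R / real (Suc n) \<le> R" for n using R by (simp add: field_simps)
    then show "AE x in lborel. ennreal (f x) * indicator {0<..<R / real (Suc n)} x
        \<le> ennreal (f x) * indicator {0<..<R} x" for n
      by (intro AE_I2 mult_left_mono) (auto simp: indicator_def intro: less_le_trans)
    show "AE x in lborel. (\<lambda>n. ennreal (f x) * indicator {0<..<R / real (Suc n)} x) \<longlonglongrightarrow> 0"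
    proof (rule AE_I2)
      fix x :: real
      have "\<forall>\<^sub>F n in sequentially. ennreal (f x) * indicator {0<..<R / real (Suc n)} x = 0"
      proof (cases "0 < x")
        case True
        have "(\<lambda>n. R / real (Suc n)) \<longlonglongrightarrow> 0"
          by (rule filterlim_compose[OF LIMSEQ_Suc[OF lim_const_over_n] filterlim_ident])
        then have "\<forall>\<^sub>F n in sequentially. R / real (Suc n) < x"
          using True by (rule order_tendstoD)
        then show ?thesis by eventually_elim auto
      qed auto
      then show "(\<lambda>n. ennreal (f x) * indicator {0<..<R / real (Suc n)} x) \<longlonglongrightarrow> 0"
        by (rule tendsto_eventually)
    qed
  qed (use f fin in \<open>auto simp: mult.commute\<close>)
  then have lim: "(\<lambda>n. \<integral>\<^sup>+x\<in>{0<..<R / real (Suc n)}. ennreal (f x) \<partial>lborel) \<longlonglongrightarrow> 0" by simp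
  show ?thesis
  proof (rule order_tendstoI)
    fix e :: ennreal assume "0 < e"
    then obtain n where n: "(\<integral>\<^sup>+x\<in>{0<..<R / real (Suc n)}. ennreal (f x) \<partial>lborel) < e"
      using order_tendstoD(2)[OF lim] by (meson eventually_sequentially order_refl)
    have "0 < R / real (Suc n)" using R by simp
    from eventually_at_right_real[OF this]
    show "\<forall>\<^sub>F r in at_right 0. (\<integral>\<^sup>+x\<in>{0<..<r}. ennreal (f x) \<partial>lborel) < e"
    proof eventually_elim
      fix r assume "r \<in> {0<..<R / real (Suc n)}"
      then have "(\<integral>\<^sup>+x\<in>{0<..<r}. ennreal (f x) \<partial>lborel)
        \<le> (\<integral>\<^sup>+x\<in>{0<..<R / real (Suc n)}. ennreal (f x) \<partial>lborel)"
        by (intro nn_integral_mono mult_left_mono) (auto simp: indicator_def)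
      then show "(\<integral>\<^sup>+x\<in>{0<..<r}. ennreal (f x) \<partial>lborel) < e" using n by (rule le_less_trans)
    qed
  qed simp
qed

section \<open>Flux formulation of the radial equation and the Pohozaev identity\<close>

locale radial_ode =
  fixes p N \<mu> lam R ps :: real
  assumes p1: "1 < p" and pN: "p < N" and mu0: "0 < \<mu>" and lam0: "0 < lam" and R0: "0 < R"
    and ps_def: "ps = N * p / (N - p)"
begin

definition force :: "real \<Rightarrow> real \<Rightarrow> real" where
  "force r x = (\<mu> * r powr (- p) + lam) * x powr (p - 1) + x powr (ps - 1)"

text \<open>Inverts y = r^(N-1) s^(p-1) in s: applied to the flux q = r^(N-1) |w'|^(p-1) it returns
  |w'|.\<close>

definition slope :: "real \<Rightarrow> real \<Rightarrow> real" where
  "slope r y = (y / r powr (N - 1)) powr (1 / (p - 1))"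

text \<open>The function \<open>J\<close> of the overview, with |w'| expressed through the flux so
  that no second derivative of w is needed to differentiate it.\<close>

definition pohozaev :: "(real \<Rightarrow> real) \<Rightarrow> (real \<Rightarrow> real) \<Rightarrow> real \<Rightarrow> real" where
  "pohozaev w q r = r powr N * ((p - 1) / p * slope r (q r) powr p
     + (\<mu> * r powr (- p) + lam) * w r powr p / p + w r powr ps / ps) - (N - p) / p * q r * w r"

text \<open>Taking the flux as second unknown turns the equation into a system that is smooth as
  long as w and q stay positive. The limit of the Pohozaev function is the only information about
  the origin that the comparison uses.\<close>

definition flux_solution :: "(real \<Rightarrow> real) \<Rightarrow> (real \<Rightarrow> real) \<Rightarrow> bool" where
  "flux_solution w q \<longleftrightarrow> (\<forall>r\<in>{0<..<R}. 0 < w r \<and> 0 < q r \<and>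
      (w has_real_derivative - slope r (q r)) (at r) \<and>
      (q has_real_derivative r powr (N - 1) * force r (w r)) (at r)) \<and>
    (w \<longlongrightarrow> 0) (at_left R) \<and> (pohozaev w q \<longlongrightarrow> 0) (at_right 0)"

lemma ps_gt: "p < ps" and ps_pos: "0 < ps"
proof -
  have "ps - p = p * p / (N - p)" using pN by (simp add: ps_def field_simps)
  moreover have "p * p / (N - p) > 0" using p1 pN by simp
  ultimately show "p < ps" by linarith
  then show "0 < ps" using p1 by linarith
qed

lemma slope_pos: "0 < r \<Longrightarrow> 0 < y \<Longrightarrow> 0 < slope r y"
  by (simp add: slope_def)

lemma slope_powr: "0 < r \<Longrightarrow> 0 < y \<Longrightarrow> r powr (N - 1) * slope r y powr (p - 1) = y"
  using p1 by (simp add: slope_def powr_powr)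

lemma force_pos: "0 < r \<Longrightarrow> 0 < x \<Longrightarrow> 0 < force r x"
  using mu0 lam0 by (simp add: force_def add_pos_pos)

lemma flux_solutionD:
  assumes "flux_solution w q" "0 < r" "r < R"
  shows "0 < w r" "0 < q r" "(w has_real_derivative - slope r (q r)) (at r)"
    "(q has_real_derivative r powr (N - 1) * force r (w r)) (at r)"
  using assms by (auto simp: flux_solution_def)

text \<open>\<open>slope\<close> is a product of real powers, so it is written as the exponential of
  a combination of logarithms; this is legitimate near r because q stays positive there.\<close>

lemma has_derivative_slope:
  assumes r: "0 < r" and q: "0 < q r" and dq: "(q has_real_derivative d) (at r)"
  shows "((\<lambda>r. slope r (q r)) has_real_derivative
    slope r (q r) * (d / q r - (N - 1) / r) / (p - 1)) (at r)"
proof -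
  have "((\<lambda>r. exp ((ln (q r) - (N - 1) * ln r) / (p - 1))) has_real_derivative
     exp ((ln (q r) - (N - 1) * ln r) / (p - 1)) * ((d / q r - (N - 1) / r) / (p - 1))) (at r)"
    by (rule DERIV_fun_exp, rule DERIV_cdivide, rule DERIV_cong,
        (rule DERIV_diff DERIV_cmult DERIV_ln_divide[OF r] DERIV_chain2[OF DERIV_ln_divide[OF q] dq])+)
      (use r in simp)
  moreover have "\<forall>\<^sub>F s in nhds r. exp ((ln (q s) - (N - 1) * ln s) / (p - 1)) = slope s (q s)"
  proof -
    have "isCont q r" using dq by (rule DERIV_isCont)
    then have "\<forall>\<^sub>F s in nhds r. 0 < q s"
      using q unfolding isCont_def tendsto_at_iff_tendsto_nhds
      by (auto simp: order_tendstoD)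
    moreover have "\<forall>\<^sub>F s in nhds r. 0 < s" using r
      using eventually_nhds_in_open[of "{0<..}" r] by simp
    ultimately show ?thesis
      by eventually_elim (auto simp: slope_def powr_def ln_div ln_powr)
  qed
  moreover have "exp ((ln (q r) - (N - 1) * ln r) / (p - 1)) = slope r (q r)"
    using r q by (auto simp: slope_def powr_def ln_div ln_powr)
  ultimately show ?thesis
    by (subst (asm) DERIV_cong_ev[OF refl _ refl]) auto
qed

text \<open>The coefficient (N-p)/p makes every scale invariant term cancel: the gradient term, the
  Hardy term (since r^(-p) scales like the p-Laplacian) and the critical term (since N/ps =
  (N-p)/p). For the \<open>lam\<close> term the coefficients N/p and (N-p)/p differ by 1, and this
  is what remains.\<close>

lemma has_derivative_pohozaev:
  assumes s: "flux_solution w q" and r: "0 < r" "r < R"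
  shows "(pohozaev w q has_real_derivative lam * r powr (N - 1) * w r powr p) (at r)"
proof -
  note D = flux_solutionD[OF s r]
  note dA = has_derivative_slope[of r q, OF r(1) D(2) D(4)]
  have A: "0 < slope r (q r)" using D r by (simp add: slope_pos)
  define a where "a = slope r (q r)"
  define rn where "rn = r powr (N - 1)"
  define h where "h = r powr (- p)"
  define wp where "wp = w r powr (p - 1)"
  define ws where "ws = w r powr (ps - 1)"
  define ap where "ap = a powr (p - 1)"
  have q: "q r = rn * ap" using slope_powr[of r "q r"] D r by (simp add: rn_def ap_def a_def)
  have pos: "0 < rn" "0 < ap" "0 < a" using r A by (auto simp: rn_def ap_def a_def)
  have rN: "r powr N = r * rn" "r powr (- p - 1) = h / r"
    using r powr_add[of r 1 "N - 1"] powr_diff[of r "- p" 1] by (auto simp: rn_def h_def)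
  have wpp: "w r powr p = w r * wp" "w r powr ps = w r * ws" "a powr p = a * ap"
    using D A powr_add[of "w r" 1 "p - 1"] powr_add[of "w r" 1 "ps - 1"] powr_add[of a 1 "p - 1"]
    by (auto simp: wp_def ws_def ap_def a_def)
  have F: "force r (w r) = (\<mu> * h + lam) * wp + ws"
    by (simp add: force_def h_def wp_def ws_def)
  \<comment> \<open>Criticality of the exponent, in the form in which it removes the term with
    w^ps.\<close>
  have Nps: "N = (N - p) / p * ps" using pN p1 by (simp add: ps_def)
  define d where "d = rn * force r (w r)"
  have dA': "((\<lambda>r. slope r (q r)) has_real_derivative
     a * (d / q r - (N - 1) / r) / (p - 1)) (at r)"
    using dA by (simp add: a_def d_def rn_def)
  have d1: "((\<lambda>r. slope r (q r) powr p) has_real_derivative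
     p * ap * (a * (d / q r - (N - 1) / r) / (p - 1))) (at r)"
    using DERIV_fun_powr[OF dA' A, of p] by (simp add: a_def ap_def)
  have d2: "((\<lambda>r. w r powr p) has_real_derivative p * wp * (- a)) (at r)"
    using DERIV_fun_powr[OF D(3,1), of p] by (simp add: a_def wp_def)
  have d3: "((\<lambda>r. w r powr ps) has_real_derivative ps * ws * (- a)) (at r)"
    using DERIV_fun_powr[OF D(3,1), of ps] by (simp add: a_def ws_def)
  have d4: "((\<lambda>r. r powr N) has_real_derivative N * rn) (at r)"
    using DERIV_fun_powr[OF DERIV_ident r(1), of N] by (simp add: rn_def)
  have d5: "((\<lambda>r. r powr (- p)) has_real_derivative - p * h / r) (at r)"
    using DERIV_fun_powr[OF DERIV_ident r(1), of "- p"] rN by simp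
  have dq: "(q has_real_derivative d) (at r)" using D(4) by (simp add: d_def rn_def)
  have dw: "(w has_real_derivative - a) (at r)" using D(3) by (simp add: a_def)
  have "(pohozaev w q has_real_derivative
     N * rn * ((p - 1) / p * (a * ap) + (\<mu> * h + lam) * (w r * wp) / p + w r * ws / ps)
     + r * rn * ((p - 1) / p * (p * ap * (a * (d / q r - (N - 1) / r) / (p - 1)))
        + (\<mu> * (- p * h / r) * (w r * wp) + (\<mu> * h + lam) * (p * wp * (- a))) / p
        + ps * ws * (- a) / ps)
     - (N - p) / p * (d * w r + q r * (- a))) (at r)"
    unfolding pohozaev_def [abs_def]
    apply (rule DERIV_cong)
     apply (rule d1 d2 d3 d4 d5 dq dw DERIV_const DERIV_diff DERIV_add DERIV_cdivide DERIV_cmult DERIV_mult)+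
    by (simp add: rN wpp a_def[symmetric] h_def[symmetric])
      (simp add: algebra_simps add_divide_distrib diff_divide_distrib)
  moreover have "N * rn * ((p - 1) / p * (a * ap) + (\<mu> * h + lam) * (w r * wp) / p + w r * ws / ps)
     + r * rn * ((p - 1) / p * (p * ap * (a * (d / q r - (N - 1) / r) / (p - 1)))
        + (\<mu> * (- p * h / r) * (w r * wp) + (\<mu> * h + lam) * (p * wp * (- a))) / p
        + ps * ws * (- a) / ps)
     - (N - p) / p * (d * w r + q r * (- a)) = lam * rn * (w r * wp)"
  proof -
    \<comment> \<open>With m = N/p all coefficients become polynomial in p and m, for instance
      (N-p)/p = m - 1.\<close>
    define m where "m = N / p"
    have Nm: "N = p * m" using p1 by (simp add: m_def)
    have c: "(p - 1) / p * (p * y * (a * z / (p - 1))) = y * a * z" for y z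
      using p1 by simp
    have "ap * a * (d / q r) = a * force r (w r)"
      unfolding q d_def using pos by simp
    then have 1: "(p - 1) / p * (p * ap * (a * (d / q r - (N - 1) / r) / (p - 1)))
        = a * force r (w r) - ap * a * ((p * m - 1) / r)"
      by (simp only: c) (simp only: right_diff_distrib Nm)
    have 2: "N * (w r * ws / ps) = (m - 1) * (w r * ws)"
      using ps_pos p1 by (subst Nps) (simp add: m_def field_simps)
    have 3: "N * rn * ((p - 1) / p * (a * ap) + (\<mu> * h + lam) * (w r * wp) / p + w r * ws / ps)
      = rn * ((p - 1) * m * (a * ap) + m * (\<mu> * h + lam) * (w r * wp) + N * (w r * ws / ps))"
      using p1 by (simp add: Nm field_simps)
    have 4: "ps * ws * (- a) / ps = - ws * a" using ps_pos by simp
    have 5: "(\<mu> * (- p * h / r) * (w r * wp) + (\<mu> * h + lam) * (p * wp * (- a))) / p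
      = - (\<mu> * h * w r * wp) / r - (\<mu> * h + lam) * wp * a"
      using p1 by (simp add: field_simps)
    have 6: "(N - p) / p = m - 1" using p1 by (simp add: m_def field_simps)
    have 7: "r * rn * (x - ap * a * (y / r) + (- z / r - u) + v)
        = rn * (r * x - ap * a * y - z - r * u + r * v)" for x y z u v
      using r by (simp add: field_simps)
    show ?thesis
      unfolding 1 3 4 5 6 7 2 unfolding q d_def F by (simp add: algebra_simps)
  qed
  ultimately show ?thesis
    by (simp add: rn_def wpp)
qed

text \<open>The limit 0 at the origin gives only nonnegativity, here at r/2; the strict increase
  from r/2 to r makes it positive.\<close>

lemma pohozaev_pos:
  assumes s: "flux_solution w q" and r: "0 < r" "r < R"
  shows "0 < pohozaev w q r"
proof -
  have lt: "pohozaev w q x < pohozaev w q y" if "0 < x" "x < y" "y < R" for x y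
  proof (rule DERIV_pos_imp_increasing[OF that(2)])
    fix t assume t: "x \<le> t" "t \<le> y"
    then have "0 < w t" using that by (intro flux_solutionD(1)[OF s]) auto
    then have "0 < lam * t powr (N - 1) * w t powr p" using lam0 t that by simp
    moreover have "(pohozaev w q has_real_derivative lam * t powr (N - 1) * w t powr p) (at t)"
      using t that by (intro has_derivative_pohozaev[OF s]) auto
    ultimately show "\<exists>d. (pohozaev w q has_real_derivative d) (at t) \<and> 0 < d" by blast
  qed
  have "0 \<le> pohozaev w q (r/2)"
  proof (rule tendsto_upperbound)
    show "(pohozaev w q \<longlongrightarrow> 0) (at_right 0)" using s by (simp add: flux_solution_def)
    show "\<forall>\<^sub>F x in at_right 0. pohozaev w q x \<le> pohozaev w q (r/2)"
      using eventually_at_right_less[of 0] eventually_at_right_real[of 0 "r/2"] r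
      by (auto elim!: eventually_mono intro!: less_imp_le lt)
  qed simp
  also have "\<dots> < pohozaev w q r" using lt[of "r/2" r] r by simp
  finally show ?thesis .
qed

section \<open>Uniqueness of the initial value problem away from the origin\<close>

lemma slope_DERIV:
  "0 < r \<Longrightarrow> 0 < y \<Longrightarrow> (slope r has_real_derivative slope r y / ((p - 1) * y)) (at y)"
proof -
  assume r: "0 < r" and y: "0 < y"
  define c k where "c = r powr (N - 1)" and "k = 1 / (p - 1)"
  have c: "0 < c" using r by (simp add: c_def)
  have "((\<lambda>y. (y / c) powr k) has_real_derivative k * (y / c) powr (k - 1) * (1 / c)) (at y)"
    using y c DERIV_fun_powr[OF DERIV_cdivide[OF DERIV_ident], of y c k] by simp
  moreover have "k * (y / c) powr (k - 1) * (1 / c) = (y / c) powr k / ((p - 1) * y)"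
    using y c by (simp add: powr_diff k_def)
  ultimately show ?thesis by (simp add: slope_def[abs_def] c_def k_def)
qed

lemma force_DERIV:
  "0 < x \<Longrightarrow> (force r has_real_derivative
    ((\<mu> * r powr (- p) + lam) * (p - 1) * x powr (p - 2) + (ps - 1) * x powr (ps - 2))) (at x)"
  unfolding force_def[abs_def]
  by (auto intro!: derivative_eq_intros simp: field_simps)

lemma slope_strict_mono: "0 < r \<Longrightarrow> 0 < y \<Longrightarrow> y < z \<Longrightarrow> slope r y < slope r z"
  unfolding slope_def using p1 by (intro powr_less_mono2 divide_strict_right_mono) auto

text \<open>Homogeneity of degree 1/(p-1): dividing the flux by w^(p-1) divides the slope by w, so
  the Riccati variable corresponds to |w'|/w.\<close>

lemma slope_divide:
  "0 < r \<Longrightarrow> 0 < y \<Longrightarrow> 0 < x \<Longrightarrow> slope r (y / x powr (p - 1)) = slope r y / x"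
  unfolding slope_def using p1 by (simp add: powr_divide powr_powr powr_mult)

text \<open>On a compact subinterval of (0, R) both solutions and both fluxes take values in some
  [m, M] with m > 0. There \<open>slope\<close> and the weighted \<open>force\<close> are Lipschitz
  in the second variable, even when the powers are singular at 0, and \<open>gronwall_zero\<close>
  applies to the differences.\<close>

lemma flux_solution_unique_local:
  assumes u: "flux_solution u a" and v: "flux_solution v b"
    and s: "0 < s" "s < R" "u s = v s" "a s = b s" and r: "0 < r" "r < R"
  shows "u r = v r"
proof -
  define c where "c = min r s"
  define d where "d = max r s"
  have cd: "0 < c" "d < R" "c \<le> d" using s r by (auto simp: c_def d_def)
  have inR: "0 < t" "t < R" if "t \<in> {c..d}" for t using that cd by auto
  define K where "K = u ` {c..d} \<union> v ` {c..d} \<union> a ` {c..d} \<union> b ` {c..d}"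
  have cont: "continuous_on {c..d} u" "continuous_on {c..d} v" "continuous_on {c..d} a"
    "continuous_on {c..d} b"
    by (rule continuous_at_imp_continuous_on, rule ballI, rule DERIV_isCont,
        rule flux_solutionD[OF u inR] flux_solutionD[OF v inR], assumption, assumption)+
  then have K: "compact K" unfolding K_def by (intro compact_Un compact_continuous_image) auto
  have "K \<noteq> {}" using cd by (auto simp: K_def)
  obtain m where m: "m \<in> K" "\<And>x. x \<in> K \<Longrightarrow> m \<le> x"
    using compact_attains_inf[OF K \<open>K \<noteq> {}\<close>] by auto
  obtain M where M: "\<And>x. x \<in> K \<Longrightarrow> x \<le> M"
    using compact_attains_sup[OF K \<open>K \<noteq> {}\<close>] by auto
  have m0: "0 < m"
    using m(1) flux_solutionD(1,2)[OF u inR] flux_solutionD(1,2)[OF v inR]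
    by (auto simp: K_def)
  have mem: "u t \<in> {m..M}" "v t \<in> {m..M}" "a t \<in> {m..M}" "b t \<in> {m..M}" if "t \<in> {c..d}" for t
    using m(2) M that by (auto simp: K_def)
  have cs: "continuous_on ({c..d} \<times> {m..M}) (\<lambda>(t, y). slope t y / ((p - 1) * y))"
    unfolding slope_def case_prod_unfold using cd m0 p1
    by (intro continuous_intros) auto
  obtain L1 where L1: "0 \<le> L1" "\<And>t y z. t \<in> {c..d} \<Longrightarrow> y \<in> {m..M} \<Longrightarrow> z \<in> {m..M} \<Longrightarrow>
      \<bar>slope t y - slope t z\<bar> \<le> L1 * \<bar>y - z\<bar>"
    by (rule lipschitz_on_second[OF slope_DERIV cs]) (use inR m0 in auto)
  have cf: "continuous_on ({c..d} \<times> {m..M}) (\<lambda>(t, y). t powr (N - 1) *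
      ((\<mu> * t powr (- p) + lam) * (p - 1) * y powr (p - 2) + (ps - 1) * y powr (ps - 2)))"
    unfolding case_prod_unfold using cd m0
    by (intro continuous_intros) auto
  have dF: "((\<lambda>y. t powr (N - 1) * force t y) has_real_derivative t powr (N - 1) *
      ((\<mu> * t powr (- p) + lam) * (p - 1) * y powr (p - 2) + (ps - 1) * y powr (ps - 2))) (at y)"
    if "y \<in> {m..M}" for t y
    using that m0 by (intro DERIV_cmult force_DERIV) auto
  obtain L2 where L2: "0 \<le> L2" "\<And>t y z. t \<in> {c..d} \<Longrightarrow> y \<in> {m..M} \<Longrightarrow> z \<in> {m..M} \<Longrightarrow>
      \<bar>t powr (N - 1) * force t y - t powr (N - 1) * force t z\<bar> \<le> L2 * \<bar>y - z\<bar>"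
    by (rule lipschitz_on_second[OF dF cf]) auto
  define L where "L = max L1 L2"
  have LL: "L1 * \<bar>x\<bar> \<le> L * \<bar>x\<bar>" "L2 * \<bar>x\<bar> \<le> L * \<bar>x\<bar>" for x
    by (auto simp: L_def intro!: mult_right_mono)
  have "u r - v r = 0"
  proof (rule gronwall_zero[where c=c and d=d and s=s and L=L
        and f = "\<lambda>t. u t - v t" and g = "\<lambda>t. a t - b t"])
    fix t assume t: "t \<in> {c..d}"
    show "((\<lambda>t. u t - v t) has_real_derivative - slope t (a t) - - slope t (b t)) (at t)"
      by (intro DERIV_diff flux_solutionD(3)[OF u inR] flux_solutionD(3)[OF v inR] t)
    show "((\<lambda>t. a t - b t) has_real_derivative
      t powr (N - 1) * force t (u t) - t powr (N - 1) * force t (v t)) (at t)"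
      by (intro DERIV_diff flux_solutionD(4)[OF u inR] flux_solutionD(4)[OF v inR] t)
    show "\<bar>- slope t (a t) - - slope t (b t)\<bar> \<le> L * \<bar>a t - b t\<bar>"
      using L1(2)[OF t mem(3,4)[OF t]] LL(1)[of "a t - b t"] by linarith
    show "\<bar>t powr (N - 1) * force t (u t) - t powr (N - 1) * force t (v t)\<bar> \<le> L * \<bar>u t - v t\<bar>"
      using L2(2)[OF t mem(1,2)[OF t]] LL(2)[of "u t - v t"] by linarith
  qed (use s r cd in \<open>auto simp: c_def d_def\<close>)
  then show ?thesis by simp
qed

section \<open>Comparison of two solutions of the radial equation\<close>

text \<open>Equals r^(N-1) (-w'/w)^(p-1). Comparing it for two solutions decides the sign of the
  derivative of their ratio.\<close>

definition riccati :: "(real \<Rightarrow> real) \<Rightarrow> (real \<Rightarrow> real) \<Rightarrow> real \<Rightarrow> real" where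
  "riccati w q r = q r / w r powr (p - 1)"

definition pohozaev_gap ::
  "(real \<Rightarrow> real) \<Rightarrow> (real \<Rightarrow> real) \<Rightarrow> (real \<Rightarrow> real) \<Rightarrow> (real \<Rightarrow> real) \<Rightarrow> real \<Rightarrow> real" where
  "pohozaev_gap u a v b r = (v r / u r) powr p * pohozaev u a r - pohozaev v b r"

lemma riccati_pos: "flux_solution w q \<Longrightarrow> 0 < r \<Longrightarrow> r < R \<Longrightarrow> 0 < riccati w q r"
  using flux_solutionD[of w q r] by (simp add: riccati_def)

lemma slope_riccati:
  "flux_solution w q \<Longrightarrow> 0 < r \<Longrightarrow> r < R \<Longrightarrow> slope r (riccati w q r) = slope r (q r) / w r"
  using flux_solutionD[of w q r] by (simp add: riccati_def slope_divide)

text \<open>Division by w^(p-1) removes w from every term of degree p-1 in w; only the critical term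
  still depends on w, as w^(ps-p). Two solutions with equal Riccati variable at r therefore differ
  there only through this term.\<close>

lemma has_derivative_riccati:
  assumes w: "flux_solution w q" and r: "0 < r" "r < R"
  shows "(riccati w q has_real_derivative
    r powr (N - 1) * (\<mu> * r powr (- p) + lam + w r powr (ps - p))
      + (p - 1) * riccati w q r * slope r (riccati w q r)) (at r)"
proof -
  note D = flux_solutionD[OF w r]
  define x where "x = w r powr (p - 1)"
  have x: "0 < x" using D by (simp add: x_def)
  have "(riccati w q has_real_derivative
    ((r powr (N - 1) * force r (w r)) * x - q r * ((p - 1) * w r powr (p - 1 - 1) * (- slope r (q r)))) / (x * x)) (at r)"
    unfolding riccati_def[abs_def] x_def using D DERIV_fun_powr[OF D(3,1), of "p - 1"]
    by (intro DERIV_divide) auto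
  moreover have "w r powr (p - 1 - 1) = x / w r"
    using D powr_diff[of "w r" "p - 1" 1] by (simp add: x_def)
  moreover have "force r (w r) = x * (\<mu> * r powr (- p) + lam + w r powr (ps - p))"
    using powr_add[of "w r" "p - 1" "ps - p"] by (simp add: force_def x_def algebra_simps)
  ultimately show ?thesis
    using x D(1) slope_riccati[OF w r] by (simp add: riccati_def x_def[symmetric] add_divide_distrib mult_ac)
qed

lemma has_derivative_ratio:
  assumes u: "flux_solution u a" and v: "flux_solution v b" and r: "0 < r" "r < R"
  shows "((\<lambda>r. v r / u r) has_real_derivative
    (v r / u r) * (slope r (riccati u a r) - slope r (riccati v b r))) (at r)"
proof -
  note D = flux_solutionD[OF u r] and E = flux_solutionD[OF v r]
  have "((\<lambda>r. v r / u r) has_real_derivative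
    ((- slope r (b r)) * u r - v r * (- slope r (a r))) / (u r * u r)) (at r)"
    using D E by (intro DERIV_divide) auto
  moreover have "((- slope r (b r)) * u r - v r * (- slope r (a r))) / (u r * u r)
    = (v r / u r) * (slope r (riccati u a r) - slope r (riccati v b r))"
    unfolding slope_riccati[OF u r] slope_riccati[OF v r] using D(1) E(1)
    by (simp add: field_simps)
  ultimately show ?thesis by simp
qed

text \<open>\<open>J'\<close> is a multiple of w^p, so \<rho>^p J(u)' equals J(v)', and the
  derivative falls on the factor \<rho>^p alone.\<close>

lemma has_derivative_pohozaev_gap:
  assumes u: "flux_solution u a" and v: "flux_solution v b" and r: "0 < r" "r < R"
  shows "(pohozaev_gap u a v b has_real_derivative
    p * (v r / u r) powr p * pohozaev u a r * (slope r (riccati u a r) - slope r (riccati v b r))) (at r)"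
proof -
  note D = flux_solutionD[OF u r] and E = flux_solutionD[OF v r]
  define z where "z = v r / u r"
  define s where "s = slope r (riccati u a r) - slope r (riccati v b r)"
  have z: "0 < z" using D E by (simp add: z_def)
  have zp: "z powr p * u r powr p = v r powr p" "z powr p = z * z powr (p - 1)"
    using D(1) E(1) powr_mult[of z "u r" p] z powr_add[of z 1 "p - 1"]
    by (auto simp: z_def)
  have "((\<lambda>r. (v r / u r) powr p) has_real_derivative p * z powr (p - 1) * (z * s)) (at r)"
    using DERIV_fun_powr[OF has_derivative_ratio[OF u v r], of p] z unfolding z_def s_def by simp
  from DERIV_diff[OF DERIV_mult[OF this has_derivative_pohozaev[OF u r]] has_derivative_pohozaev[OF v r]]
  have "(pohozaev_gap u a v b has_real_derivative
    p * z powr (p - 1) * (z * s) * pohozaev u a r + lam * r powr (N - 1) * u r powr p * z powr p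
     - lam * r powr (N - 1) * v r powr p) (at r)"
    by (simp add: pohozaev_gap_def[abs_def] z_def)
  then show ?thesis
    unfolding zp(1)[symmetric] z_def[symmetric] s_def[symmetric] by (simp add: zp(2) algebra_simps)
qed

text \<open>With z = v/u, equality of the Riccati variables means that the slope and the flux of v
  are z and z^(p-1) times those of u. All terms of degree p then cancel and the critical ones
  remain.\<close>

lemma pohozaev_gap_crossing:
  assumes u: "flux_solution u a" and v: "flux_solution v b" and r: "0 < r" "r < R"
    and eq: "riccati u a r = riccati v b r"
  shows "pohozaev_gap u a v b r = r powr N / ps * ((v r / u r) powr p * u r powr ps - v r powr ps)"
proof -
  note D = flux_solutionD[OF u r] and E = flux_solutionD[OF v r]
  define z where "z = v r / u r"
  have z: "0 < z" and vz: "v r = z * u r" using D E by (simp_all add: z_def)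
  have "a r / u r powr (p - 1) = b r / v r powr (p - 1)" using eq by (simp add: riccati_def)
  then have b: "b r = z powr (p - 1) * a r"
    using D E z by (simp add: vz powr_mult field_simps)
  have "slope r (a r) / u r = slope r (b r) / v r"
    using slope_riccati[OF u r] slope_riccati[OF v r] eq by simp
  then have s: "slope r (b r) = z * slope r (a r)"
    using D z by (simp add: vz field_simps)
  have zp: "z powr p = z * z powr (p - 1)" using z powr_add[of z 1 "p - 1"] by simp
  have "z powr p * pohozaev u a r - pohozaev v b r =
     r powr N * (z powr p * u r powr ps / ps - v r powr ps / ps)"
    unfolding pohozaev_def unfolding s unfolding b using D E z slope_pos[OF r(1) D(2)]
    by (simp add: vz powr_mult zp algebra_simps)
  then show ?thesis
    by (simp add: pohozaev_gap_def z_def[symmetric] diff_divide_distrib[symmetric])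
qed

text \<open>The critical remainder is a positive multiple of z^p - z^ps with z = v/u, whose sign is
  known because p < ps.\<close>

lemma pohozaev_gap_crossing_sign:
  assumes u: "flux_solution u a" and v: "flux_solution v b" and r: "0 < r" "r < R"
    and eq: "riccati u a r = riccati v b r"
  shows "u r < v r \<Longrightarrow> pohozaev_gap u a v b r < 0" and "v r < u r \<Longrightarrow> 0 < pohozaev_gap u a v b r"
proof -
  note D = flux_solutionD[OF u r] and E = flux_solutionD[OF v r]
  define z where "z = v r / u r"
  have z: "0 < z" and vz: "v r = z * u r" using D E by (simp_all add: z_def)
  have c: "pohozaev_gap u a v b r = r powr N / ps * u r powr ps * (z powr p - z powr ps)"
    unfolding pohozaev_gap_crossing[OF assms] z_def[symmetric] using D z
    by (simp add: vz powr_mult algebra_simps flip: diff_divide_distrib)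
  have pos: "0 < r powr N / ps * u r powr ps" using r D ps_pos by simp
  { assume "u r < v r"
    then have "1 < z" using D by (simp add: z_def)
    then have "z powr p - z powr ps < 0" using ps_gt by simp
    then show "pohozaev_gap u a v b r < 0" unfolding c using pos by (rule mult_pos_neg[rotated]) }
  { assume "v r < u r"
    then have "z < 1" using D by (simp add: z_def)
    then have "0 < z powr p - z powr ps" using ps_gt z by (simp add: powr_less_mono')
    then show "0 < pohozaev_gap u a v b r" unfolding c using pos by (rule mult_pos_pos[rotated]) }
qed

text \<open>A substitute for the Hopf boundary lemma: the flux is positive, increasing and bounded
  near R, so it has a positive limit, and the slope does not vanish at R. In the Pohozaev function
  only the gradient term survives, because w tends to 0.\<close>

lemma flux_tendsto_boundary:
  assumes w: "flux_solution w q"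
  obtains Q where "0 < Q" "((\<lambda>r. slope r (q r)) \<longlongrightarrow> slope R Q) (at_left R)"
    "(pohozaev w q \<longlongrightarrow> R powr N * ((p - 1) / p) * slope R Q powr p) (at_left R)"
proof -
  note D = flux_solutionD[OF w]
  have incr: "q x < q y" if "0 < x" "x < y" "y < R" for x y
  proof (rule DERIV_pos_imp_increasing[OF that(2)])
    fix t assume "x \<le> t" "t \<le> y"
    with that have t: "0 < t" "t < R" by auto
    then show "\<exists>d. (q has_real_derivative d) (at t) \<and> 0 < d"
      using D(4)[OF t] force_pos[OF t(1) D(1)[OF t]] t by (auto intro!: exI)
  qed
  have decr: "w y \<le> w x" if "0 < x" "x \<le> y" "y < R" for x y
  proof (rule DERIV_nonpos_imp_nonincreasing[OF that(2)])
    fix t assume "x \<le> t" "t \<le> y"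
    with that have t: "0 < t" "t < R" by auto
    then show "\<exists>d. (w has_real_derivative d) (at t) \<and> d \<le> 0"
      using D(3)[OF t] slope_pos[OF t(1) D(2)[OF t]] by (auto intro!: exI)
  qed
  define r0 where "r0 = R / 2"
  have r0: "0 < r0" "r0 < R" using R0 by (auto simp: r0_def)
  \<comment> \<open>Bounds q' on (R/2, R): there s^(N-1) <= R^(N-1), s^(-p) <= r0^(-p), and w <= w
    r0 since w decreases.\<close>
  define M where "M = R powr (N - 1) * ((\<mu> * r0 powr (- p) + lam) * w r0 powr (p - 1) + w r0 powr (ps - 1))"
  have bound: "q r \<le> q r0 + M * (R - r0)" if r: "r0 < r" "r < R" for r
  proof -
    have "\<exists>z>r0. z < r \<and> q r - q r0 = (r - r0) * (z powr (N - 1) * force z (w z))"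
      using r r0 by (intro MVT2 D(4)) auto
    then obtain z where z: "r0 < z" "z < r" "q r - q r0 = (r - r0) * (z powr (N - 1) * force z (w z))"
      by auto
    define l where "l = z powr (N - 1) * force z (w z)"
    have z': "0 < z" "z < R" using z r r0 by auto
    have "force z (w z) \<le> (\<mu> * r0 powr (- p) + lam) * w r0 powr (p - 1) + w r0 powr (ps - 1)"
      unfolding force_def using z z' r0 mu0 lam0 p1 ps_gt decr[of r0 z] D(1)[OF z'] D(1)[OF r0]
      by (intro add_mono mult_mono mult_left_mono powr_mono2 powr_mono2') (auto intro: add_nonneg_nonneg)
    then have "l \<le> M" unfolding l_def M_def using z' pN p1 force_pos[OF z'(1) D(1)[OF z']]
      by (intro mult_mono powr_mono2) auto
    moreover have "0 \<le> M" unfolding M_def using mu0 lam0 by auto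
    ultimately have "(r - r0) * l \<le> (R - r0) * M"
      using r by (intro order_trans[OF mult_left_mono mult_right_mono]) auto
    then show ?thesis using z(3) by (simp add: mult.commute l_def)
  qed
  define Q where "Q = (SUP r\<in>{r0<..<R}. q r)"
  have bdd: "bdd_above (q ` {r0<..<R})" using bound by (auto intro!: bdd_aboveI2)
  have ne: "{r0<..<R} \<noteq> {}" using r0 by simp
  have ev: "\<forall>\<^sub>F r in at_left R. r \<in> {x<..<R}" if "x < R" for x
    using eventually_at_left_real[OF that] .
  have lim: "(q \<longlongrightarrow> Q) (at_left R)"
  proof (rule increasing_tendsto)
    show "\<forall>\<^sub>F r in at_left R. q r \<le> Q"
      using ev[OF r0(2)] by eventually_elim (auto simp: Q_def intro!: cSUP_upper bdd)
    fix x assume "x < Q"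
    then obtain y where y: "y \<in> {r0<..<R}" "x < q y"
      unfolding Q_def using less_cSUP_iff[OF ne bdd] by auto
    show "\<forall>\<^sub>F r in at_left R. x < q r"
      using ev[of y] y incr[of y] r0 by (auto elim!: eventually_mono intro: less_trans)
  qed
  have "q ((r0 + R) / 2) \<le> Q" unfolding Q_def using r0 by (intro cSUP_upper bdd) auto
  moreover have "0 < q ((r0 + R) / 2)" using r0 by (intro D(2)) auto
  ultimately have Q: "0 < Q" by linarith
  have w0: "(w \<longlongrightarrow> 0) (at_left R)" using w by (simp add: flux_solution_def)
  have id: "((\<lambda>r. r) \<longlongrightarrow> R) (at_left R)" by (rule tendsto_ident_at)
  have sl: "((\<lambda>r. slope r (q r)) \<longlongrightarrow> slope R Q) (at_left R)"
    unfolding slope_def using R0 Q by (intro tendsto_intros lim id) auto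
  have wp: "((\<lambda>r. w r powr x) \<longlongrightarrow> 0) (at_left R)" if "0 < x" for x
  proof -
    have "((\<lambda>r. w r powr x) \<longlongrightarrow> 0 powr x) (at_left R)"
      using that ev[OF R0] D(1)
      by (intro tendsto_powr2 w0 tendsto_const) (auto elim!: eventually_mono intro: less_imp_le)
    then show ?thesis by simp
  qed
  have sR: "0 < slope R Q" using R0 Q by (rule slope_pos)
  have "(pohozaev w q \<longlongrightarrow> R powr N * ((p - 1) / p * slope R Q powr p
     + (\<mu> * R powr (- p) + lam) * 0 / p + 0 / ps) - (N - p) / p * Q * 0) (at_left R)"
    unfolding pohozaev_def[abs_def] using R0 p1 ps_pos sR
    by (intro tendsto_intros sl lim id wp w0) auto
  then show ?thesis by (intro that[OF Q sl]) (simp add: mult.assoc)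
qed

text \<open>Both solutions vanish at R with nonzero slope, so by l'Hospital the ratio v/u tends to
  the quotient of the boundary slopes. Its p-th power turns the limit of J(u) into that of
  J(v).\<close>

lemma pohozaev_gap_tendsto_boundary:
  assumes u: "flux_solution u a" and v: "flux_solution v b"
  shows "(pohozaev_gap u a v b \<longlongrightarrow> 0) (at_left R)"
proof -
  obtain P where P: "0 < P" "((\<lambda>r. slope r (a r)) \<longlongrightarrow> slope R P) (at_left R)"
    "(pohozaev u a \<longlongrightarrow> R powr N * ((p - 1) / p) * slope R P powr p) (at_left R)"
    using flux_tendsto_boundary[OF u] .
  obtain Q where Q: "0 < Q" "((\<lambda>r. slope r (b r)) \<longlongrightarrow> slope R Q) (at_left R)"
    "(pohozaev v b \<longlongrightarrow> R powr N * ((p - 1) / p) * slope R Q powr p) (at_left R)"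
    using flux_tendsto_boundary[OF v] .
  have sP: "0 < slope R P" and sQ: "0 < slope R Q" using R0 P(1) Q(1) by (auto intro: slope_pos)
  have ev: "\<forall>\<^sub>F r in at_left R. r \<in> {0<..<R}" using eventually_at_left_real[OF R0] .
  have "((\<lambda>r. v r / u r) \<longlongrightarrow> slope R Q / slope R P) (at_left R)"
  proof (rule lhopital_left)
    show "(v \<longlongrightarrow> 0) (at_left R)" "(u \<longlongrightarrow> 0) (at_left R)"
      using u v by (auto simp: flux_solution_def)
    show "\<forall>\<^sub>F r in at_left R. u r \<noteq> 0"
      using ev by eventually_elim (use flux_solutionD(1)[OF u] in force)
    show "\<forall>\<^sub>F r in at_left R. - slope r (a r) \<noteq> 0"
      using ev by eventually_elim (use slope_pos flux_solutionD(2)[OF u] in force)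
    show "\<forall>\<^sub>F r in at_left R. (u has_real_derivative - slope r (a r)) (at r)"
      using ev by eventually_elim (use flux_solutionD(3)[OF u] in force)
    show "\<forall>\<^sub>F r in at_left R. (v has_real_derivative - slope r (b r)) (at r)"
      using ev by eventually_elim (use flux_solutionD(3)[OF v] in force)
    show "((\<lambda>r. - slope r (b r) / - slope r (a r)) \<longlongrightarrow> slope R Q / slope R P) (at_left R)"
      unfolding minus_divide_divide using sP by (intro tendsto_divide P Q) auto
  qed
  note L = tendsto_powr[OF this tendsto_const, of p]
  have "(pohozaev_gap u a v b \<longlongrightarrow> (slope R Q / slope R P) powr p
      * (R powr N * ((p - 1) / p) * slope R P powr p)
      - R powr N * ((p - 1) / p) * slope R Q powr p) (at_left R)"
    unfolding pohozaev_gap_def[abs_def] using sP sQ by (intro tendsto_diff tendsto_mult L P Q) auto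
  moreover have "(slope R Q / slope R P) powr p * slope R P powr p = slope R Q powr p"
    using sP sQ powr_mult[of "slope R Q / slope R P" "slope R P" p] by simp
  ultimately show ?thesis by (simp add: mult_ac)
qed

text \<open>Both Pohozaev functions vanish at the origin, so a bound on the ratio suffices; such a
  bound is available when the ratio is increasing.\<close>

lemma pohozaev_gap_tendsto_origin:
  assumes u: "flux_solution u a" and v: "flux_solution v b"
    and bound: "\<And>r. 0 < r \<Longrightarrow> r < d \<Longrightarrow> v r / u r \<le> K" and d: "0 < d" "d \<le> R"
  shows "(pohozaev_gap u a v b \<longlongrightarrow> 0) (at_right 0)"
proof -
  have J: "(pohozaev u a \<longlongrightarrow> 0) (at_right 0)" "(pohozaev v b \<longlongrightarrow> 0) (at_right 0)"
    using u v by (auto simp: flux_solution_def)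
  have "((\<lambda>r. (v r / u r) powr p * pohozaev u a r) \<longlongrightarrow> 0) (at_right 0)"
  proof (rule tendsto_sandwich[OF _ _ tendsto_const])
    have ev: "\<forall>\<^sub>F r in at_right 0. r \<in> {0<..<d}" using eventually_at_right_real[OF d(1)] .
    show "\<forall>\<^sub>F r in at_right 0. 0 \<le> (v r / u r) powr p * pohozaev u a r"
      using ev by eventually_elim (use pohozaev_pos[OF u] d in \<open>force intro!: mult_nonneg_nonneg\<close>)
    show "\<forall>\<^sub>F r in at_right 0. (v r / u r) powr p * pohozaev u a r \<le> K powr p * pohozaev u a r"
      using ev
    proof eventually_elim
      fix r assume r: "r \<in> {0<..<d}"
      then have "0 < v r / u r" using flux_solutionD(1)[OF u] flux_solutionD(1)[OF v] d by simp
      then show "(v r / u r) powr p * pohozaev u a r \<le> K powr p * pohozaev u a r"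
        using r d p1 pohozaev_pos[OF u, of r] bound[of r]
        by (intro mult_right_mono powr_mono2) auto
    qed
    show "((\<lambda>r. K powr p * pohozaev u a r) \<longlongrightarrow> 0) (at_right 0)"
      using tendsto_mult_right_zero[OF J(1)] .
  qed
  then show ?thesis
    unfolding pohozaev_gap_def[abs_def] using J(2) tendsto_diff by fastforce
qed

section \<open>Excluding crossings of the Riccati variables\<close>

lemma pohozaev_gap_antimono:
  assumes u: "flux_solution u a" and v: "flux_solution v b"
    and xy: "0 < x" "x \<le> y" "y < R"
    and le: "\<And>t. x \<le> t \<Longrightarrow> t \<le> y \<Longrightarrow> riccati u a t \<le> riccati v b t"
  shows "pohozaev_gap u a v b y \<le> pohozaev_gap u a v b x"
proof (rule DERIV_nonpos_imp_nonincreasing[OF xy(2)])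
  fix t assume t: "x \<le> t" "t \<le> y"
  then have t': "0 < t" "t < R" using xy by auto
  have "slope t (riccati u a t) - slope t (riccati v b t) \<le> 0"
    using le[OF t] slope_strict_mono[OF t'(1) riccati_pos[OF u t'], of "riccati v b t"]
    by (cases "riccati u a t = riccati v b t") auto
  moreover have "0 \<le> p * (v t / u t) powr p * pohozaev u a t"
    using pohozaev_pos[OF u t'] p1 by simp
  ultimately show "\<exists>d. (pohozaev_gap u a v b has_real_derivative d) (at t) \<and> d \<le> 0"
    using has_derivative_pohozaev_gap[OF u v t'] by (blast intro: mult_nonneg_nonpos)
qed

lemma riccati_crossing_imp_eq:
  assumes u: "flux_solution u a" and v: "flux_solution v b" and s: "0 < s" "s < R"
    and eq: "riccati u a s = riccati v b s" and eq': "u s = v s" and r: "0 < r" "r < R"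
  shows "u r = v r"
proof -
  have "a s = b s"
    using eq eq' flux_solutionD(1)[OF u s] by (auto simp: riccati_def)
  then show ?thesis using flux_solution_unique_local[OF u v s eq' _ r] by simp
qed

text \<open>At s the gap is negative, and e, the difference of the Riccati variables, turns positive
  to the right of s; as long as e stays nonnegative the gap cannot increase. If e stays positive up
  to R, the gap cannot tend to 0. Otherwise the first zero of e after s is contradictory, whatever
  the order of u and v there. The opposite order at s follows by exchanging the solutions.\<close>

lemma no_crossing_below:
  assumes u: "flux_solution u a" and v: "flux_solution v b" and s: "0 < s" "s < R"
    and eq: "riccati u a s = riccati v b s" and lt: "u s < v s"
  shows False
proof -
  define e where "e r = riccati v b r - riccati u a r" for r
  have de: "\<exists>D. (e has_real_derivative D) (at r)" if "0 < r" "r < R" for r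
    unfolding e_def[abs_def]
    using has_derivative_riccati[OF u that] has_derivative_riccati[OF v that] DERIV_diff by blast
  \<comment> \<open>At a zero of e the two Riccati equations differ only in the term w^(ps-p), so
    the derivative of e has the sign of v - u.\<close>
  have de0: "\<exists>D>0. (e has_real_derivative D) (at r)"
    if r: "0 < r" "r < R" and e: "e r = 0" and lt: "u r < v r" for r
  proof -
    have "(e has_real_derivative r powr (N - 1) * (v r powr (ps - p) - u r powr (ps - p))) (at r)"
      unfolding e_def[abs_def]
      using DERIV_diff[OF has_derivative_riccati[OF v r] has_derivative_riccati[OF u r]] e
      by (simp add: e_def algebra_simps)
    moreover have "0 < r powr (N - 1) * (v r powr (ps - p) - u r powr (ps - p))"
      using r lt ps_gt flux_solutionD(1)[OF u r] by (simp add: powr_less_mono2)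
    ultimately show ?thesis by blast
  qed
  have gs: "pohozaev_gap u a v b s < 0" using pohozaev_gap_crossing_sign(1)[OF u v s eq lt] .
  have gap: "pohozaev_gap u a v b x < 0" if "s \<le> x" "x < R" "\<And>t. s \<le> t \<Longrightarrow> t \<le> x \<Longrightarrow> 0 \<le> e t" for x
    using pohozaev_gap_antimono[OF u v s(1) that(1,2)] that(3) gs by (force simp: e_def)
  obtain D where "0 < D" "(e has_real_derivative D) (at s)"
    using de0[OF s] eq lt by (auto simp: e_def)
  then obtain d where d: "0 < d" "\<And>h. 0 < h \<Longrightarrow> h < d \<Longrightarrow> e s < e (s + h)"
    using DERIV_pos_inc_right by blast
  have es: "e s = 0" using eq by (simp add: e_def)
  have near: "0 < e t" if "s < t" "t < s + d" for t
    using d(2)[of "t - s"] that es by simp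
  show False
  proof (cases "\<exists>t. s < t \<and> t < R \<and> e t \<le> 0")
    case True
    then obtain t1 where t1: "s < t1" "t1 < R" "e t1 \<le> 0" by blast
    \<comment> \<open>A point to the right of s at which e is already positive: starting the compact
      set S there keeps the zero at s out of it.\<close>
    define c where "c = s + d / 2"
    have c: "s < c" "c < s + d" using d(1) by (auto simp: c_def)
    have ct: "c < t1" using near[of t1] t1 c by force
    have cont: "continuous_on {c..t1} e"
    proof (intro continuous_at_imp_continuous_on ballI)
      fix x assume "x \<in> {c..t1}"
      then show "isCont e x" using de[of x] c t1 s by (auto intro: DERIV_isCont)
    qed
    \<comment> \<open>The minimum t2 of S is the first zero of e after s; e is positive strictly
      between s and t2.\<close>
    define S where "S = {c..t1} \<inter> e -` {..0}"
    have "closed S"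
      unfolding S_def by (rule continuous_closed_preimage[OF cont closed_atLeastAtMost closed_atMost])
    then have "compact S"
      using bounded_subset[of "{c..t1}" S] by (auto simp: compact_eq_bounded_closed S_def)
    moreover have "t1 \<in> S" using t1 ct by (simp add: S_def)
    ultimately obtain t2 where t2: "t2 \<in> S" and min: "\<And>t. t \<in> S \<Longrightarrow> t2 \<le> t"
      using compact_attains_inf[of S] by blast
    note t2 = t2[unfolded S_def] and min = min[unfolded S_def]
    have t2c: "c < t2" using near[OF c] t2 by (cases "c = t2") auto
    have pos: "0 < e t" if "s < t" "t < t2" for t
      using min[of t] near[of t] that t2 c by force
    have e2: "e t2 = 0"
    proof (rule ccontr)
      assume "e t2 \<noteq> 0"
      then have "e t2 < 0" using t2 by auto
      moreover have "continuous_on {c..t2} e" using cont by (rule continuous_on_subset) (use t2 in auto)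
      ultimately obtain x where x: "c \<le> x" "x \<le> t2" "e x = 0"
        using IVT2'[of e t2 0 c] near[OF c] t2c by auto
      then have "x \<noteq> t2" using \<open>e t2 < 0\<close> by auto
      then show False using pos[of x] x c by auto
    qed
    have t2': "0 < t2" "t2 < R" using t2 t1 c s by auto
    have eq2: "riccati u a t2 = riccati v b t2" using e2 by (simp add: e_def)
    \<comment> \<open>If u < v, then e increases through t2, against its positivity on the left. If
      u = v, uniqueness gives u = v at s. If v < u, the gap is positive at t2, against its being
      negative there by monotonicity.\<close>
    consider "u t2 < v t2" | "u t2 = v t2" | "v t2 < u t2" by linarith
    then show False
    proof cases
      case 1
      obtain D where "0 < D" "(e has_real_derivative D) (at t2)" using de0[OF t2' e2 1] by auto
      then obtain h where h: "0 < h" "\<And>k. 0 < k \<Longrightarrow> k < h \<Longrightarrow> e (t2 - k) < e t2"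
        using DERIV_pos_inc_left by blast
      define k where "k = min (h / 2) ((t2 - s) / 2)"
      have "0 < k" "k < h" "k < t2 - s" using h(1) t2c c by (auto simp: k_def min_def)
      then show False using h(2)[of k] pos[of "t2 - k"] e2 by simp
    next
      case 2
      then show False using riccati_crossing_imp_eq[OF u v t2' eq2 2 s] lt by simp
    next
      case 3
      have "0 \<le> e t" if "s \<le> t" "t \<le> t2" for t
        using pos[of t] es e2 that by (cases "t = s"; cases "t = t2") auto
      then have "pohozaev_gap u a v b t2 < 0" using t2' t2c c by (intro gap) auto
      then show False using pohozaev_gap_crossing_sign(2)[OF u v t2' eq2 3] by simp
    qed
  next
    case False
    then have pos: "0 < e t" if "s < t" "t < R" for t using that by (meson not_le)
    have "0 \<le> pohozaev_gap u a v b s"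
    proof (rule tendsto_upperbound[OF pohozaev_gap_tendsto_boundary[OF u v]])
      show "\<forall>\<^sub>F x in at_left R. pohozaev_gap u a v b x \<le> pohozaev_gap u a v b s"
        using eventually_at_left_real[OF s(2)]
      proof eventually_elim
        fix x assume x: "x \<in> {s<..<R}"
        show "pohozaev_gap u a v b x \<le> pohozaev_gap u a v b s"
        proof (rule pohozaev_gap_antimono[OF u v s(1)])
          fix t assume "s \<le> t" "t \<le> x"
          then show "riccati u a t \<le> riccati v b t"
            using pos[of t] x eq by (cases "t = s") (auto simp: e_def)
        qed (use x in auto)
      qed
    qed simp
    then show False using gs by simp
  qed
qed

lemma no_ordered_riccati:
  assumes u: "flux_solution u a" and v: "flux_solution v b"
    and lt: "\<And>r. 0 < r \<Longrightarrow> r < R \<Longrightarrow> riccati v b r < riccati u a r"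
  shows False
proof -
  have pos: "0 < slope r (riccati u a r) - slope r (riccati v b r)" if "0 < r" "r < R" for r
    using slope_strict_mono[OF that(1) riccati_pos[OF v that] lt[OF that]] by simp
  have ratio: "v x / u x \<le> v y / u y" if "0 < x" "x \<le> y" "y < R" for x y
  proof (rule DERIV_nonneg_imp_nondecreasing[OF that(2)])
    fix t assume "x \<le> t" "t \<le> y"
    then have t: "0 < t" "t < R" using that by auto
    have "0 \<le> v t / u t * (slope t (riccati u a t) - slope t (riccati v b t))"
      using pos[OF t] flux_solutionD(1)[OF u t] flux_solutionD(1)[OF v t] by simp
    then show "\<exists>D. ((\<lambda>r. v r / u r) has_real_derivative D) (at t) \<and> 0 \<le> D"
      using has_derivative_ratio[OF u v t] by blast
  qed
  have gap: "pohozaev_gap u a v b x < pohozaev_gap u a v b y" if "0 < x" "x < y" "y < R" for x y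
  proof (rule DERIV_pos_imp_increasing[OF that(2)])
    fix t assume "x \<le> t" "t \<le> y"
    then have t: "0 < t" "t < R" using that by auto
    have "0 < p * (v t / u t) powr p * pohozaev u a t
        * (slope t (riccati u a t) - slope t (riccati v b t))"
      using pos[OF t] flux_solutionD(1)[OF u t] flux_solutionD(1)[OF v t] pohozaev_pos[OF u t] p1
      by (intro mult_pos_pos) auto
    then show "\<exists>D. (pohozaev_gap u a v b has_real_derivative D) (at t) \<and> 0 < D"
      using has_derivative_pohozaev_gap[OF u v t] by blast
  qed
  \<comment> \<open>Two interior points separate the limits: the strict inequality between x and y
    survives when the weak inequalities are obtained by letting the outer points tend to 0 and to
    R.\<close>
  define x y where "x = R / 3" and "y = R / 2"
  have xy: "0 < x" "x < y" "y < R" using R0 by (auto simp: x_def y_def)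
  have "(pohozaev_gap u a v b \<longlongrightarrow> 0) (at_right 0)"
  proof (rule pohozaev_gap_tendsto_origin[OF u v _ xy(1)])
    fix r assume "0 < r" "r < x"
    then show "v r / u r \<le> v x / u x" using xy by (intro ratio) auto
  qed (use xy in simp)
  then have "0 \<le> pohozaev_gap u a v b x"
  proof (rule tendsto_upperbound)
    show "\<forall>\<^sub>F t in at_right 0. pohozaev_gap u a v b t \<le> pohozaev_gap u a v b x"
      using eventually_at_right_real[OF xy(1)] by eventually_elim (use gap xy in \<open>force intro: less_imp_le\<close>)
  qed simp
  moreover have "pohozaev_gap u a v b y \<le> 0"
    using pohozaev_gap_tendsto_boundary[OF u v]
  proof (rule tendsto_lowerbound)
    show "\<forall>\<^sub>F t in at_left R. pohozaev_gap u a v b y \<le> pohozaev_gap u a v b t"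
      using eventually_at_left_real[OF xy(3)] by eventually_elim (use gap xy in \<open>force intro: less_imp_le\<close>)
  qed simp
  ultimately show False using gap[OF xy] by simp
qed

text \<open>At a crossing, \<open>no_crossing_below\<close> in both orders forces equal values, and
  uniqueness spreads the equality. Without a crossing the difference of the Riccati variables has
  constant sign by the intermediate value theorem, and \<open>no_ordered_riccati\<close> applies in
  one of the two orders.\<close>

theorem flux_solution_unique:
  assumes u: "flux_solution u a" and v: "flux_solution v b" and r: "0 < r" "r < R"
  shows "u r = v r"
proof (cases "\<exists>s. 0 < s \<and> s < R \<and> riccati u a s = riccati v b s")
  case True
  then obtain s where s: "0 < s" "s < R" "riccati u a s = riccati v b s" by blast
  have "u s = v s"
    using no_crossing_below[OF u v s] no_crossing_below[OF v u s(1,2) s(3)[symmetric]] by fastforce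
  then show ?thesis using riccati_crossing_imp_eq[OF u v s _ r] by simp
next
  case False
  define e where "e r = riccati v b r - riccati u a r" for r
  have ne: "e t \<noteq> 0" if "0 < t" "t < R" for t using False that by (auto simp: e_def)
  have ct: "continuous_on {x..y} e" if "0 < x" "y < R" for x y
  proof (intro continuous_at_imp_continuous_on ballI)
    fix t assume "t \<in> {x..y}"
    then have t: "0 < t" "t < R" using that by auto
    show "isCont e t"
      unfolding e_def[abs_def] using has_derivative_riccati[OF u t] has_derivative_riccati[OF v t]
      by (intro continuous_diff) (auto intro: DERIV_isCont)
  qed
  have same: "0 < e x \<longleftrightarrow> 0 < e y" if xy: "0 < x" "x \<le> y" "y < R" for x y
  proof (rule ccontr)
    assume "\<not> (0 < e x \<longleftrightarrow> 0 < e y)"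
    then have "e x \<le> 0 \<and> 0 \<le> e y \<or> e y \<le> 0 \<and> 0 \<le> e x" by linarith
    then obtain z where "x \<le> z" "z \<le> y" "e z = 0"
      using IVT'[of e x 0 y, OF _ _ xy(2) ct[OF xy(1,3)]]
        IVT2'[of e y 0 x, OF _ _ xy(2) ct[OF xy(1,3)]] by metis
    then show False using ne[of z] xy by simp
  qed
  have "0 < e t \<longleftrightarrow> 0 < e r" if "0 < t" "t < R" for t
    using same[of t r] same[of r t] that r by (meson linear)
  then have "(\<forall>t. 0 < t \<and> t < R \<longrightarrow> 0 < e t) \<or> (\<forall>t. 0 < t \<and> t < R \<longrightarrow> e t < 0)"
    using ne by (meson linorder_neqE_linordered_idom)
  then show ?thesis
    using no_ordered_riccati[OF u v] no_ordered_riccati[OF v u] by (force simp: e_def)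
qed

section \<open>Behaviour at the origin\<close>

text \<open>
  Used with a fixed \<open>c\<close> to exclude a negative flux near the origin, and with \<open>c\<close> the flux at \<open>r\<close>, where
  the left side becomes a multiple of \<open>r^N |w'|^p\<close>, to show that this quantity tends to \<open>0\<close>.
\<close>

lemma energy_lower_bound:
  assumes f: "f \<in> borel_measurable borel" and r: "0 < r" and c: "0 < c"
    and q: "\<And>s. r \<le> s \<Longrightarrow> s < 2 * r \<Longrightarrow> c \<le> s powr (N - 1) * \<bar>k s\<bar> powr (p - 1)
        \<and> f s = s powr (N - 1) * \<bar>k s\<bar> powr p"
  shows "ennreal (2 powr (- ((N - 1) / (p - 1))) * (c powr (p / (p - 1)) * r powr (- ((N - p) / (p - 1)))))
    \<le> (\<integral>\<^sup>+s\<in>{0<..<2 * r}. ennreal (f s) \<partial>lborel)"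
proof -
  \<comment> \<open>The flux bound gives f s >= c^(p/(p-1)) s^(-(N-1)/(p-1)). This decreases in s,
    so the value at 2r bounds it on [r, 2r); multiplying by the length r produces the exponent 1 -
    (N-1)/(p-1) = -(N-p)/(p-1).\<close>
  define L where "L = c powr (p / (p - 1)) * (2 * r) powr (- ((N - 1) / (p - 1)))"
  have bound: "L \<le> f s" if s: "r \<le> s" "s < 2 * r" for s
  proof -
    have s0: "0 < s" using s r by simp
    have "c / s powr (N - 1) \<le> \<bar>k s\<bar> powr (p - 1)"
      using q[OF s] s0 by (simp add: field_simps)
    then have "(c / s powr (N - 1)) powr (p / (p - 1)) \<le> (\<bar>k s\<bar> powr (p - 1)) powr (p / (p - 1))"
      using c p1 by (intro powr_mono2) auto
    then have "c powr (p / (p - 1)) / s powr ((N - 1) * (p / (p - 1))) \<le> \<bar>k s\<bar> powr p"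
      using p1 c by (simp add: powr_powr powr_divide)
    note mult_left_mono[OF this, of "s powr (N - 1)"]
    then have "s powr (N - 1) * (c powr (p / (p - 1)) / s powr ((N - 1) * (p / (p - 1)))) \<le> f s"
      using q[OF s] by simp
    moreover have "s powr (N - 1) / s powr ((N - 1) * (p / (p - 1))) = s powr (- ((N - 1) / (p - 1)))"
    proof -
      have "N - 1 - (N - 1) * (p / (p - 1)) = - ((N - 1) / (p - 1))" using p1 by (simp add: field_simps)
      then show ?thesis by (simp only: powr_diff[symmetric])
    qed
    ultimately have "c powr (p / (p - 1)) * s powr (- ((N - 1) / (p - 1))) \<le> f s"
      by (metis (no_types, lifting) mult.commute times_divide_eq_right)
    moreover have "(2 * r) powr (- ((N - 1) / (p - 1))) \<le> s powr (- ((N - 1) / (p - 1)))"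
      using s s0 p1 pN by (intro powr_mono2') auto
    ultimately show ?thesis unfolding L_def
      by (meson mult_left_mono order_trans powr_ge_zero)
  qed
  have "ennreal (L * r) = (\<integral>\<^sup>+s. ennreal L * indicator {r..<2 * r} s \<partial>lborel)"
    using r by (subst nn_integral_cmult_indicator) (auto simp: L_def ennreal_mult)
  also have "\<dots> \<le> (\<integral>\<^sup>+s\<in>{0<..<2 * r}. ennreal (f s) \<partial>lborel)"
    using bound r by (intro nn_integral_mono) (auto simp: indicator_def intro!: ennreal_leI)
  also have "L * r = 2 powr (- ((N - 1) / (p - 1))) * (c powr (p / (p - 1)) * r powr (- ((N - p) / (p - 1))))"
  proof -
    have "- ((N - p) / (p - 1)) = - ((N - 1) / (p - 1)) + 1" using p1 by (simp add: field_simps)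
    then have "r powr (- ((N - p) / (p - 1))) = r powr (- ((N - 1) / (p - 1))) * r"
      using r by (simp only: powr_add powr_one)
    then show ?thesis using r by (simp add: L_def powr_mult)
  qed
  finally show ?thesis .
qed

text \<open>Finite energy is the only assumption at the origin. The flux increases, so a nonpositive
  value of it would keep |q| away from 0 near the origin and the energy on (s, 2s) away from 0. Once
  q > 0, the scale invariant quantities r^N |w'|^p and r^((N-p)/p) w tend to 0, and the Pohozaev
  function is a combination of their powers.\<close>

lemma flux_solutionI:
  assumes w: "\<And>r. 0 < r \<Longrightarrow> r < R \<Longrightarrow> 0 < w r"
    and dw: "\<And>r. 0 < r \<Longrightarrow> r < R \<Longrightarrow> (w has_real_derivative k r) (at r)"
    and dq: "\<And>r. 0 < r \<Longrightarrow> r < R \<Longrightarrow> (q has_real_derivative r powr (N - 1) * force r (w r)) (at r)"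
    and qk: "\<And>r. 0 < r \<Longrightarrow> r < R \<Longrightarrow> q r = - (r powr (N - 1) * (sgn (k r) * \<bar>k r\<bar> powr (p - 1)))"
    and bdry: "(w \<longlongrightarrow> 0) (at_left R)"
    and k: "k \<in> borel_measurable borel"
    and fin: "(\<integral>\<^sup>+r\<in>{0<..<R}. ennreal (r powr (N - 1) * \<bar>k r\<bar> powr p) \<partial>lborel) < \<infinity>"
  shows "flux_solution w q"
proof -
  define T where "T r = (\<integral>\<^sup>+s\<in>{0<..<r}. ennreal (s powr (N - 1) * \<bar>k s\<bar> powr p) \<partial>lborel)" for r
  have fm: "(\<lambda>s. s powr (N - 1) * \<bar>k s\<bar> powr p) \<in> borel_measurable borel" using k by measurable
  have T0: "(T \<longlongrightarrow> 0) (at_right 0)"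
    unfolding T_def[abs_def] by (rule nn_integral_near_0_tendsto_0[OF fm R0 fin])
  have "filterlim (\<lambda>r::real. 2 * r) (at_right 0) (at_right 0)"
    by (rule filterlim_times_pos[OF filterlim_ident]) auto
  then have T2: "((\<lambda>r. T (2 * r)) \<longlongrightarrow> 0) (at_right 0)"
    by (rule filterlim_compose[OF T0])
  have absq: "\<bar>q r\<bar> = r powr (N - 1) * \<bar>k r\<bar> powr (p - 1)" if "0 < r" "r < R" for r
    using that by (cases "k r = 0") (auto simp: qk abs_mult abs_sgn_eq)
  have est: "ennreal (2 powr (- ((N - 1) / (p - 1))) * (c powr (p / (p - 1)) * r powr (- ((N - p) / (p - 1)))))
    \<le> T (2 * r)" if "0 < r" "2 * r \<le> R" "0 < c" "\<And>s. r \<le> s \<Longrightarrow> s < 2 * r \<Longrightarrow> c \<le> \<bar>q s\<bar>" for r c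
    unfolding T_def using that absq by (intro energy_lower_bound[OF fm, of r c k]) auto
  define C where "C = (2::real) powr (- ((N - 1) / (p - 1)))"
  have C: "0 < C" by (simp add: C_def)
  have incr: "q x < q y" if "0 < x" "x < y" "y < R" for x y
  proof (rule DERIV_pos_imp_increasing[OF that(2)])
    fix t assume "x \<le> t" "t \<le> y"
    with that have t: "0 < t" "t < R" by auto
    then show "\<exists>d. (q has_real_derivative d) (at t) \<and> 0 < d"
      using dq[OF t] force_pos[OF t(1) w[OF t]] by (auto intro!: exI)
  qed
  have q0: "0 < q r" if r: "0 < r" "r < R" for r
  proof (rule ccontr)
    assume "\<not> 0 < q r"
    then have neg: "q (r / 2) < 0" using incr[of "r / 2" r] r by simp
    define c where "c = - q (r / 2)"
    \<comment> \<open>m <= 1 makes the negative power of s at least 1, and 2m <= r/2 keeps the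
      interval (s, 2s) to the left of r/2, where q <= -c.\<close>
    define m where "m = min 1 (r / 4)"
    have m: "0 < m" "m \<le> 1" "2 * m \<le> r / 2" using r by (auto simp: m_def)
    have "ennreal (C * c powr (p / (p - 1))) \<le> 0"
    proof (rule tendsto_lowerbound[OF T2])
      show "\<forall>\<^sub>F s in at_right 0. ennreal (C * c powr (p / (p - 1))) \<le> T (2 * s)"
        using eventually_at_right_real[OF m(1)]
      proof eventually_elim
        fix s assume s: "s \<in> {0<..<m}"
        have "c \<le> \<bar>q t\<bar>" if "s \<le> t" "t < 2 * s" for t
          using incr[of t "r / 2"] that s m r neg by (auto simp: c_def)
        then have "ennreal (C * (c powr (p / (p - 1)) * s powr (- ((N - p) / (p - 1))))) \<le> T (2 * s)"
          unfolding C_def using s m r neg by (intro est) (auto simp: c_def)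
        moreover have "1 \<le> s powr (- ((N - p) / (p - 1)))"
          using s m p1 pN powr_mono2'[of "- ((N - p) / (p - 1))" s 1] by simp
        then have "C * c powr (p / (p - 1)) \<le> C * (c powr (p / (p - 1)) * s powr (- ((N - p) / (p - 1))))"
          using C by (simp add: mult_le_cancel_left1)
        ultimately show "ennreal (C * c powr (p / (p - 1))) \<le> T (2 * s)"
          by (meson ennreal_leI order_trans)
      qed
    qed simp
    moreover have "0 < C * c powr (p / (p - 1))" using C neg by (auto simp: c_def)
    ultimately show False by (auto simp: ennreal_eq_0_iff)
  qed
  have slope: "slope r (q r) = - k r" if r: "0 < r" "r < R" for r
  proof -
    have "k r < 0" using q0[OF r] r unfolding qk[OF r]
      by (cases "k r" "0::real" rule: linorder_cases) (auto simp: mult_less_0_iff)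
    then show ?thesis using r p1 unfolding qk[OF r] slope_def by (simp add: powr_powr)
  qed
  \<comment> \<open>This is r^N |w'|^p, written through the flux in the form that \<open>est\<close>
    bounds when c = q r.\<close>
  define g where "g r = q r powr (p / (p - 1)) * r powr (- ((N - p) / (p - 1)))" for r
  have ev: "\<forall>\<^sub>F r in at_right 0. r \<in> {0<..<R / 2}" using R0 by (intro eventually_at_right_real) simp
  have g0: "(g \<longlongrightarrow> 0) (at_right 0)"
  proof -
    have "((\<lambda>r. ennreal (C * g r)) \<longlongrightarrow> ennreal 0) (at_right 0)"
    proof (rule tendsto_sandwich[OF _ _ tendsto_const])
      show "\<forall>\<^sub>F r in at_right 0. ennreal (C * g r) \<le> T (2 * r)"
        using ev
      proof eventually_elim
        fix r assume r: "r \<in> {0<..<R / 2}"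
        have "q r \<le> \<bar>q s\<bar>" if "r \<le> s" "s < 2 * r" for s
          using incr[of r s] that r by (cases "r = s") auto
        then show "ennreal (C * g r) \<le> T (2 * r)"
          unfolding C_def g_def using r q0 by (intro est) auto
      qed
    qed (use T2 in auto)
    then have "((\<lambda>r. C * g r) \<longlongrightarrow> 0) (at_right 0)"
      using C by (subst (asm) tendsto_ennreal_iff) (auto simp: g_def)
    then have "((\<lambda>r. C * g r / C) \<longlongrightarrow> 0 / C) (at_right 0)"
      using C by (intro tendsto_divide) auto
    then show ?thesis using C by simp
  qed
  have g: "g r = r powr N * slope r (q r) powr p" if "0 < r" "r < R" for r
  proof -
    have "slope r (q r) powr p = q r powr (p / (p - 1)) * r powr (- ((N - 1) * p / (p - 1)))"
      using that q0[OF that] by (simp add: slope_def powr_powr powr_divide powr_minus_divide)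
    moreover have "N + (- ((N - 1) * p / (p - 1))) = - ((N - p) / (p - 1))"
      using p1 by (simp add: field_simps)
    ultimately show ?thesis
      by (simp add: g_def powr_add[symmetric] mult.left_commute)
  qed
  \<comment> \<open>The scaling exponent: r^m w is invariant under the dilations that preserve the
    energy.\<close>
  define m where "m = (N - p) / p"
  have m: "0 < m" using p1 pN by (simp add: m_def)
  define h where "h r = r powr m * w r" for r
  have gp: "((\<lambda>r. g r powr x) \<longlongrightarrow> 0) (at_right 0)" if "0 < x" for x
  proof -
    have "((\<lambda>r. g r powr x) \<longlongrightarrow> 0 powr x) (at_right 0)"
      using that by (intro tendsto_powr2 g0 tendsto_const) (auto simp: g_def)
    then show ?thesis by simp
  qed
  have h0: "(h \<longlongrightarrow> 0) (at_right 0)"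
  proof -
    \<comment> \<open>The form of l'Hospital's rule with a denominator tending to infinity is used,
      because nothing is known about the limit of w. The quotient of the derivatives is g^(1/p) /
      m.\<close>
    have "((\<lambda>r. w r / r powr (- m)) \<longlongrightarrow> 0) (at_right 0)"
    proof (rule lhopital_right_0_at_top)
      have "filterlim (\<lambda>r::real. r powr m) (at_right 0) (at_right 0)"
      proof -
        have "((\<lambda>r::real. r powr m) \<longlongrightarrow> 0 powr m) (at_right 0)"
          using m eventually_at_right_less[of "0::real"]
          by (intro tendsto_powr2 tendsto_ident_at tendsto_const) (auto elim: eventually_mono)
        then show ?thesis
          using eventually_at_right_less[of "0::real"]
          by (auto simp: filterlim_at elim: eventually_mono)
      qed
      then have "filterlim (\<lambda>r::real. inverse (r powr m)) at_top (at_right 0)"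
        by (rule filterlim_compose[OF filterlim_inverse_at_top_right])
      then show "filterlim (\<lambda>r::real. r powr (- m)) at_top (at_right 0)"
        by (simp add: powr_minus)
      show "\<forall>\<^sub>F r in at_right 0. - m * r powr (- m - 1) \<noteq> 0"
        using ev m by (auto elim: eventually_mono)
      show "\<forall>\<^sub>F r in at_right 0. (w has_real_derivative k r) (at r)"
        using ev by (auto elim!: eventually_mono intro!: dw)
      show "\<forall>\<^sub>F r in at_right 0. ((\<lambda>r. r powr (- m)) has_real_derivative - m * r powr (- m - 1)) (at r)"
        using ev DERIV_fun_powr[OF DERIV_ident, of _ "- m"] by (auto elim!: eventually_mono)
      have "((\<lambda>r. g r powr (1 / p) / m) \<longlongrightarrow> 0 / m) (at_right 0)"
        using m p1 by (intro tendsto_divide gp) auto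
      moreover have "\<forall>\<^sub>F r in at_right 0. g r powr (1 / p) / m = k r / (- m * r powr (- m - 1))"
        using ev
      proof eventually_elim
        fix r assume "r \<in> {0<..<R / 2}"
        then have r: "0 < r" "r < R" by auto
        have "g r powr (1 / p) = r powr (N / p) * slope r (q r)"
          unfolding g[OF r] using p1 slope_pos[OF r(1) q0[OF r]] r by (simp add: powr_mult powr_powr)
        also have "N / p = - (- m - 1)" using p1 by (simp add: m_def field_simps)
        finally show "g r powr (1 / p) / m = k r / (- m * r powr (- m - 1))"
          using slope[OF r] r m powr_minus_divide[of r "- m - 1"] by simp
      qed
      ultimately show "((\<lambda>r. k r / (- m * r powr (- m - 1))) \<longlongrightarrow> 0) (at_right 0)"
        by (simp add: tendsto_cong)
    qed
    then show ?thesis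
      by (simp add: h_def[abs_def] powr_minus_divide mult.commute)
  qed
  have hpos: "\<forall>\<^sub>F r in at_right 0. 0 \<le> h r"
    using ev by eventually_elim (use w in \<open>force simp: h_def intro: less_imp_le\<close>)
  have hp: "((\<lambda>r. h r powr x) \<longlongrightarrow> 0) (at_right 0)" if "0 < x" for x
  proof -
    have "((\<lambda>r. h r powr x) \<longlongrightarrow> 0 powr x) (at_right 0)"
      using that hpos by (intro tendsto_powr2 h0 tendsto_const) auto
    then show ?thesis by simp
  qed
  have rp: "((\<lambda>r::real. r powr p) \<longlongrightarrow> 0) (at_right 0)"
  proof -
    have "((\<lambda>r::real. r powr p) \<longlongrightarrow> 0 powr p) (at_right 0)"
      using p1 eventually_at_right_less[of "0::real"]
      by (intro tendsto_powr2 tendsto_ident_at tendsto_const) (auto elim: eventually_mono)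
    then show ?thesis by simp
  qed
  \<comment> \<open>The Pohozaev function expressed in g and h; every exponent is positive, so each
    summand tends to 0.\<close>
  have "((\<lambda>r. (p - 1) / p * g r + (\<mu> + lam * r powr p) * h r powr p / p + h r powr ps / ps
      - m * (g r powr ((p - 1) / p) * h r)) \<longlongrightarrow>
      (p - 1) / p * 0 + (\<mu> + lam * 0) * 0 / p + 0 / ps - m * (0 * 0)) (at_right 0)"
    using p1 ps_pos by (intro tendsto_intros g0 gp h0 hp rp) auto
  moreover have "\<forall>\<^sub>F r in at_right 0. (p - 1) / p * g r + (\<mu> + lam * r powr p) * h r powr p / p
      + h r powr ps / ps - m * (g r powr ((p - 1) / p) * h r) = pohozaev w q r"
    using ev
  proof eventually_elim
    fix r assume "r \<in> {0<..<R / 2}"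
    then have r: "0 < r" "r < R" by auto
    have hx: "h r powr x = r powr (m * x) * w r powr x" for x
      using r w[OF r] by (simp add: h_def powr_mult powr_powr)
    have e1: "m * p = N - p" "m * ps = N" using p1 pN by (auto simp: m_def ps_def field_simps)
    have e2: "r powr (N - p) = r powr N * r powr (- p)" "r powr p * r powr (- p) = 1"
      using r powr_add[of r N "- p"] powr_add[of r p "- p"] by auto
    have "g r powr ((p - 1) / p) * r powr m = q r"
    proof -
      have "g r powr ((p - 1) / p) = q r * r powr (- m)"
      proof -
        have "- ((N - p) / (p - 1)) * ((p - 1) / p) = - m" using p1 by (simp add: m_def field_simps)
        moreover have "p / (p - 1) * ((p - 1) / p) = 1" using p1 by simp
        ultimately show ?thesis
          using q0[OF r] r by (simp only: g_def powr_mult powr_ge_zero powr_powr powr_one less_imp_le)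
      qed
      then show ?thesis using r by (simp add: powr_minus)
    qed
    then have qw: "g r powr ((p - 1) / p) * h r = q r * w r"
      by (simp add: h_def mult.assoc[symmetric])
    have "(\<mu> + lam * r powr p) * (r powr N * r powr (- p)) = r powr N * (\<mu> * r powr (- p) + lam * (r powr p * r powr (- p)))"
      by (simp add: algebra_simps)
    then have e3: "(\<mu> + lam * r powr p) * h r powr p = r powr N * (\<mu> * r powr (- p) + lam) * w r powr p"
      unfolding hx e1 e2 by (simp add: mult.assoc[symmetric])
    show "(p - 1) / p * g r + (\<mu> + lam * r powr p) * h r powr p / p
      + h r powr ps / ps - m * (g r powr ((p - 1) / p) * h r) = pohozaev w q r"
      unfolding pohozaev_def qw e3 unfolding hx e1 unfolding g[OF r] m_def
      by (simp add: algebra_simps)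
  qed
  ultimately have "(pohozaev w q \<longlongrightarrow> 0) (at_right 0)"
    by (simp add: tendsto_cong)
  then show ?thesis
    unfolding flux_solution_def using w q0 dw dq slope bdry by auto
qed

end

section \<open>Smooth functions\<close>

lemma C_k_SucI:
  assumes "\<And>x. (f has_derivative f' x) (at x)" "\<And>i. i \<in> Basis \<Longrightarrow> C_k k (\<lambda>x. f' x i)"
  shows "C_k (Suc k) f"
proof -
  have "frechet_derivative f (at x) = f' x" for x
    using frechet_derivative_at[OF assms(1)] by simp
  then show ?thesis using assms by (auto simp: differentiable_def)
qed

lemma C_k_Suc_has_derivative:
  "C_k (Suc k) f \<Longrightarrow> (f has_derivative frechet_derivative f (at x)) (at x)"
  by (simp add: frechet_derivative_works)

lemma C_k_SucD: "C_k (Suc k) f \<Longrightarrow> C_k k f"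
proof (induction k arbitrary: f)
  case 0
  then show ?case by (auto intro!: continuous_at_imp_continuous_on differentiable_imp_continuous_within)
next
  case (Suc k)
  then show ?case by (metis C_k.simps(2))
qed

lemma C_k_const: "C_k k (\<lambda>x. c)"
proof (induction k arbitrary: c)
  case (Suc k)
  show ?case by (rule C_k_SucI[where f' = "\<lambda>x h. 0"]) (auto simp: Suc)
qed auto

lemma C_k_bounded_linear: "bounded_linear f \<Longrightarrow> C_k k f"
  by (cases k) (auto intro!: C_k_SucI[where f' = "\<lambda>x. f"] C_k_const bounded_linear_imp_has_derivative
      simp: linear_continuous_on simp del: C_k.simps(2))

lemma C_k_add: "C_k k f \<Longrightarrow> C_k k g \<Longrightarrow> C_k k (\<lambda>x. f x + g x)"
proof (induction k arbitrary: f g)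
  case (Suc k)
  show ?case
  proof (rule C_k_SucI)
    show "((\<lambda>x. f x + g x) has_derivative
        (\<lambda>h. frechet_derivative f (at x) h + frechet_derivative g (at x) h)) (at x)" for x
      by (intro has_derivative_add C_k_Suc_has_derivative[OF Suc.prems(1)]
          C_k_Suc_has_derivative[OF Suc.prems(2)])
  qed (use Suc in auto)
qed (auto intro: continuous_on_add)

lemma C_k_mult: "C_k k f \<Longrightarrow> C_k k g \<Longrightarrow> C_k k (\<lambda>x. f x * g x)"
proof (induction k arbitrary: f g)
  case (Suc k)
  show ?case
  proof (rule C_k_SucI)
    show "((\<lambda>x. f x * g x) has_derivative
        (\<lambda>h. f x * frechet_derivative g (at x) h + frechet_derivative f (at x) h * g x)) (at x)" for x
      by (intro has_derivative_mult C_k_Suc_has_derivative[OF Suc.prems(1)]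
          C_k_Suc_has_derivative[OF Suc.prems(2)])
  next
    fix i :: 'a assume "i \<in> Basis"
    then show "C_k k (\<lambda>x. f x * frechet_derivative g (at x) i + frechet_derivative f (at x) i * g x)"
      using Suc.prems Suc.prems[THEN C_k_SucD] by (intro C_k_add Suc.IH) auto
  qed
qed (auto intro: continuous_on_mult)

lemma has_derivative_imp_has_real_derivative:
  fixes f :: "real \<Rightarrow> real"
  assumes "(f has_derivative D) (at x)"
  shows "(f has_real_derivative D 1) (at x)"
proof -
  have "D h = D 1 * h" for h
    using linear_scale[OF has_derivative_linear[OF assms], of h 1] by simp
  then have "D = (*) (D 1)" by (rule ext)
  then show ?thesis using assms unfolding has_field_derivative_def by metis
qed

text \<open>The outer function is defined on the reals, so its derivative is again a single real
  function and the induction on k closes under the chain and product rules.\<close>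

lemma C_k_compose:
  fixes h :: "real \<Rightarrow> real"
  shows "C_k k h \<Longrightarrow> C_k k f \<Longrightarrow> C_k k (\<lambda>x. h (f x))"
proof (induction k arbitrary: h f)
  case (Suc k)
  show ?case
  proof (rule C_k_SucI)
    fix x
    have "(h has_real_derivative frechet_derivative h (at (f x)) 1) (at (f x))"
      using C_k_Suc_has_derivative[OF Suc.prems(1), of "f x"]
      by (rule has_derivative_imp_has_real_derivative)
    from has_derivative_compose[OF C_k_Suc_has_derivative[OF Suc.prems(2)]
        this[unfolded has_field_derivative_def]]
    show "((\<lambda>x. h (f x)) has_derivative
        (\<lambda>v. frechet_derivative h (at (f x)) 1 * frechet_derivative f (at x) v)) (at x)" .
  next
    fix i :: 'a assume "i \<in> Basis"
    moreover have "C_k k (\<lambda>x. frechet_derivative h (at (f x)) 1)"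
      using Suc.prems C_k_SucD[OF Suc.prems(2)]
      by (intro Suc.IH[of "\<lambda>y. frechet_derivative h (at y) 1"]) auto
    ultimately show "C_k k (\<lambda>x. frechet_derivative h (at (f x)) 1 * frechet_derivative f (at x) i)"
      using Suc.prems by (intro C_k_mult) auto
  qed
qed (auto intro: continuous_on_compose2)

lemma C_k_prod: "(\<And>i. i \<in> I \<Longrightarrow> C_k k (f i)) \<Longrightarrow> C_k k (\<lambda>x. \<Prod>i\<in>I. f i x)"
  by (induction I rule: infinite_finite_induct) (auto intro: C_k_const C_k_mult)

lemma C_k_real_SucI:
  fixes f :: "real \<Rightarrow> real"
  assumes "\<And>x. (f has_real_derivative f' x) (at x)" "C_k k f'"
  shows "C_k (Suc k) f"
  using assms by (intro C_k_SucI[where f' = "\<lambda>x h. f' x * h"]) (auto simp: has_field_derivative_def)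

lemma C_k_real_deriv:
  fixes f :: "real \<Rightarrow> real"
  assumes "C_k (Suc k) f"
  shows "(f has_real_derivative deriv f x) (at x)" "C_k k (deriv f)"
proof -
  have D: "(f has_real_derivative frechet_derivative f (at x) 1) (at x)" for x
    using C_k_Suc_has_derivative[OF assms, of x] by (rule has_derivative_imp_has_real_derivative)
  then have "deriv f = (\<lambda>x. frechet_derivative f (at x) 1)"
    by (auto simp: DERIV_imp_deriv)
  then show "(f has_real_derivative deriv f x) (at x)" "C_k k (deriv f)"
    using D assms by auto
qed

text \<open>The standard flat function exp(-1/t), together with its quotients by t^n: the family is
  closed under differentiation up to linear combinations, so smoothness follows by induction on k
  for all n at once.\<close>

definition flat_exp :: "nat \<Rightarrow> real \<Rightarrow> real" where
  "flat_exp n t = (if 0 < t then exp (- (1 / t)) / t ^ n else 0)"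

lemma flat_exp_tendsto_0: "(flat_exp n \<longlongrightarrow> 0) (at 0)"
proof -
  have "((\<lambda>s::real. s ^ n / exp s) \<longlongrightarrow> 0) at_top" by (rule tendsto_power_div_exp_0)
  then have "((\<lambda>t::real. inverse t ^ n / exp (inverse t)) \<longlongrightarrow> 0) (at_right 0)"
    by (rule filterlim_compose[OF _ filterlim_inverse_at_top_right])
  moreover have "\<forall>\<^sub>F t in at_right 0. inverse t ^ n / exp (inverse t) = flat_exp n t"
    using eventually_at_right_less[of 0]
    by eventually_elim (auto simp: flat_exp_def exp_minus field_simps)
  ultimately have "(flat_exp n \<longlongrightarrow> 0) (at_right 0)" by (simp add: tendsto_cong)
  moreover have "(flat_exp n \<longlongrightarrow> 0) (at_left 0)"
    by (rule tendsto_eventually) (auto simp: flat_exp_def eventually_at_filter)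
  ultimately show ?thesis by (rule filterlim_split_at[rotated])
qed

lemma flat_exp_has_derivative:
  "(flat_exp n has_real_derivative flat_exp (n + 2) t - real n * flat_exp (n + 1) t) (at t)"
proof -
  consider "0 < t" | "t < 0" | "t = 0" by linarith
  then show ?thesis
  proof cases
    case 1
    have "((\<lambda>t. exp (- (1 / t)) / t ^ n) has_real_derivative
      flat_exp (n + 2) t - real n * flat_exp (n + 1) t) (at t)"
    proof (rule DERIV_cong)
      have "((\<lambda>t. exp (- (1 / t))) has_real_derivative exp (- (1 / t)) / t\<^sup>2) (at t)"
        using 1 by (auto intro!: derivative_eq_intros simp: power2_eq_square)
      then show "((\<lambda>t. exp (- (1 / t)) / t ^ n) has_real_derivative (exp (- (1 / t)) / t\<^sup>2 * t ^ n
          - exp (- (1 / t)) * (real n * t ^ (n - Suc 0))) / (t ^ n * t ^ n)) (at t)"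
        using 1 by (intro DERIV_divide DERIV_pow) auto
      show "(exp (- (1 / t)) / t\<^sup>2 * t ^ n - exp (- (1 / t)) * (real n * t ^ (n - Suc 0))) / (t ^ n * t ^ n)
          = flat_exp (n + 2) t - real n * flat_exp (n + 1) t"
        using 1 by (cases n) (auto simp: flat_exp_def field_simps power2_eq_square)
    qed
    moreover have "\<forall>\<^sub>F s in nhds t. exp (- (1 / s)) / s ^ n = flat_exp n s"
      using eventually_nhds_in_open[of "{0<..}" t] 1 by (auto simp: flat_exp_def elim: eventually_mono)
    ultimately show ?thesis by (subst (asm) DERIV_cong_ev[OF refl _ refl]) auto
  next
    case 2
    have "((\<lambda>t. 0) has_real_derivative flat_exp (n + 2) t - real n * flat_exp (n + 1) t) (at t)"
      using 2 by (simp add: flat_exp_def)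
    moreover have "\<forall>\<^sub>F s in nhds t. 0 = flat_exp n s"
      using eventually_nhds_in_open[of "{..<0}" t] 2 by (auto simp: flat_exp_def elim: eventually_mono)
    ultimately show ?thesis by (subst (asm) DERIV_cong_ev[OF refl _ refl]) auto
  next
    case 3
    \<comment> \<open>The difference quotient at 0 is itself a member of the family, and
      \<open>flat_exp_tendsto_0\<close> gives its limit.\<close>
    have "(flat_exp n s - flat_exp n 0) / (s - 0) = flat_exp (Suc n) s" for s
      by (simp add: flat_exp_def)
    then show ?thesis
      using flat_exp_tendsto_0[of "Suc n"] 3
      by (simp add: has_field_derivative_iff flat_exp_def[of _ 0])
  qed
qed

lemma C_k_flat_exp: "C_k k (flat_exp n)"
proof (induction k arbitrary: n)
  case 0
  then show ?case
    using flat_exp_has_derivative by (auto intro!: continuous_at_imp_continuous_on DERIV_isCont)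
next
  case (Suc k)
  have "C_k k (\<lambda>t. flat_exp (n + 2) t + (- real n) * flat_exp (n + 1) t)"
    by (intro C_k_add C_k_mult C_k_const Suc)
  then show ?case
    by (intro C_k_real_SucI[OF flat_exp_has_derivative]) simp
qed

text \<open>A smooth bump on (c, d) that tends to the indicator function as n grows, with values in
  [0, 1]. Dominated convergence along such bumps takes the place of mollification
  throughout.\<close>

definition plateau :: "real \<Rightarrow> real \<Rightarrow> nat \<Rightarrow> real \<Rightarrow> real" where
  "plateau c d n t = flat_exp 0 (real n * (t - c)) * flat_exp 0 (real n * (d - t))"

lemma C_k_plateau: "C_k k (plateau c d n)"
proof -
  have "C_k k (\<lambda>t::real. real n * (t - c))"
    using C_k_add[OF C_k_bounded_linear[of "\<lambda>t. real n * t"] C_k_const[of k "- (real n * c)"]]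
    by (auto simp: right_diff_distrib bounded_linear_mult_right)
  moreover have "C_k k (\<lambda>t::real. real n * (d - t))"
    using C_k_add[OF C_k_bounded_linear[OF bounded_linear_minus[OF bounded_linear_mult_right[of "real n"]]] C_k_const[of k "real n * d"]]
    by (auto simp: right_diff_distrib bounded_linear_mult_right)
  ultimately show ?thesis
    unfolding plateau_def[abs_def] by (intro C_k_mult[OF C_k_compose[OF C_k_flat_exp] C_k_compose[OF C_k_flat_exp]])
qed

lemma plateau_bounds: "0 \<le> plateau c d n t" "plateau c d n t \<le> 1"
proof -
  have "0 \<le> flat_exp 0 s" "flat_exp 0 s \<le> 1" for s by (auto simp: flat_exp_def)
  then show "0 \<le> plateau c d n t" "plateau c d n t \<le> 1"
    by (auto simp: plateau_def intro!: mult_le_one)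
qed

lemma plateau_eq_0: "t \<notin> {c<..<d} \<Longrightarrow> plateau c d n t = 0"
  by (auto simp: plateau_def flat_exp_def mult_less_0_iff zero_less_mult_iff)

lemma plateau_pos: "t \<in> {c<..<d} \<Longrightarrow> 0 < n \<Longrightarrow> 0 < plateau c d n t"
  by (auto simp: plateau_def flat_exp_def)

lemma plateau_tendsto: "(\<lambda>n. plateau c d n t) \<longlonglongrightarrow> indicator {c<..<d} t"
proof (cases "t \<in> {c<..<d}")
  case True
  have *: "(\<lambda>n. flat_exp 0 (real n * s)) \<longlonglongrightarrow> 1" if "0 < s" for s
  proof -
    have "(\<lambda>n. exp (- (1 / s / real n))) \<longlonglongrightarrow> exp (- 0)"
      by (intro tendsto_intros lim_const_over_n)
    moreover have "\<forall>\<^sub>F n in sequentially. exp (- (1 / s / real n)) = flat_exp 0 (real n * s)"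
      using eventually_gt_at_top[of 0] by eventually_elim (use that in \<open>simp add: flat_exp_def mult.commute\<close>)
    ultimately show ?thesis by (simp add: tendsto_cong)
  qed
  show ?thesis
    using tendsto_mult[OF *[of "t - c"] *[of "d - t"]] True by (simp add: plateau_def)
qed (simp add: plateau_eq_0)

section \<open>Weak derivatives\<close>

text \<open>The positive and the negative part of f, which is what \<open>ennreal (f x)\<close> and
  \<open>ennreal (- f x)\<close> are, define measures that agree on boxes. Boxes form an
  intersection-stable generator, so the measures and hence their densities agree; equal positive and
  negative parts are both 0.\<close>

lemma AE_eq_0_of_integral_box:
  fixes f :: "'a::euclidean_space \<Rightarrow> real"
  assumes f: "integrable lborel f"
    and box: "\<And>c d. (\<integral>x. indicator (box c d) x * f x \<partial>lborel) = 0"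
  shows "AE x in lborel. f x = 0"
proof -
  have fb: "f \<in> borel_measurable borel" using f by auto
  have fin: "(\<integral>\<^sup>+x. ennreal (f x) \<partial>lborel) < \<infinity>" "(\<integral>\<^sup>+x. ennreal (- f x) \<partial>lborel) < \<infinity>"
    using f by (auto simp: real_integrable_def less_top)
  have eq: "(\<integral>\<^sup>+x. ennreal (f x) * indicator (box c d) x \<partial>lborel)
      = (\<integral>\<^sup>+x. ennreal (- f x) * indicator (box c d) x \<partial>lborel)" for c d
  proof -
    let ?h = "\<lambda>x. indicator (box c d) x * f x"
    have h: "integrable lborel ?h"
      using integrable_mult_indicator[OF _ f, of "box c d"] by simp
    have "enn2real (\<integral>\<^sup>+x. ennreal (?h x) \<partial>lborel) = enn2real (\<integral>\<^sup>+x. ennreal (- ?h x) \<partial>lborel)"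
      using box[of c d] real_lebesgue_integral_def[OF h] by simp
    then have "(\<integral>\<^sup>+x. ennreal (?h x) \<partial>lborel) = (\<integral>\<^sup>+x. ennreal (- ?h x) \<partial>lborel)"
      using ennreal_enn2real[of "\<integral>\<^sup>+x. ennreal (?h x) \<partial>lborel"]
        ennreal_enn2real[of "\<integral>\<^sup>+x. ennreal (- ?h x) \<partial>lborel"] h
      unfolding real_integrable_def by (simp add: less_top)
    moreover have "ennreal (?h x) = ennreal (f x) * indicator (box c d) x"
      "ennreal (- ?h x) = ennreal (- f x) * indicator (box c d) x" for x
      by (auto simp: indicator_def)
    ultimately show ?thesis by simp
  qed
  let ?E = "range (\<lambda>(a, b). box a b::'a set)"
  let ?A = "\<lambda>n::nat. box (- (real n *\<^sub>R One)) (real n *\<^sub>R One) :: 'a set"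
  have "density lborel (\<lambda>x. ennreal (f x)) = density lborel (\<lambda>x. ennreal (- f x))"
  proof (rule measure_eqI_generator_eq)
    show "Int_stable ?E" by (auto simp: Int_stable_def box_Int_box)
    show "?E \<subseteq> Pow UNIV" "sets (density lborel (\<lambda>x. ennreal (f x))) = sigma_sets UNIV ?E"
      "sets (density lborel (\<lambda>x. ennreal (- f x))) = sigma_sets UNIV ?E"
      by (simp_all add: borel_eq_box)
    show "range ?A \<subseteq> ?E" "(\<Union>i. ?A i) = UNIV" unfolding UN_box_eq_UNIV by auto
    show "emeasure (density lborel (\<lambda>x. ennreal (f x))) (?A i) \<noteq> \<infinity>" for i
    proof -
      have "(\<integral>\<^sup>+x. ennreal (f x) * indicator (?A i) x \<partial>lborel) \<le> (\<integral>\<^sup>+x. ennreal (f x) \<partial>lborel)"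
        by (intro nn_integral_mono) (auto simp: indicator_def)
      then show ?thesis using fb fin(1) by (simp add: emeasure_density less_top top_unique)
    qed
    show "emeasure (density lborel (\<lambda>x. ennreal (f x))) X
        = emeasure (density lborel (\<lambda>x. ennreal (- f x))) X" if "X \<in> ?E" for X
      using that fb eq by (auto simp: emeasure_density)
  qed
  then have "AE x in lborel. ennreal (f x) = ennreal (- f x)"
    using fb by (intro sigma_finite_measure.density_unique[OF sigma_finite_lborel]) auto
  then show ?thesis
  proof eventually_elim
    fix x assume *: "ennreal (f x) = ennreal (- f x)"
    show "f x = 0"
    proof (cases "0 \<le> f x")
      case True
      then have "ennreal (f x) = 0" using * by (simp add: ennreal_neg)
      then show ?thesis using True by (simp add: ennreal_eq_0_iff)
    next
      case False
      then have "ennreal (- f x) = 0" using * by (simp add: ennreal_neg)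
      then show ?thesis using False by (simp add: ennreal_eq_0_iff)
    qed
  qed
qed

text \<open>Difference quotients in the direction e integrate to 0 by translation invariance. They
  are uniformly bounded with common bounded support, so dominated convergence passes to the
  derivative.\<close>

lemma has_integral_deriv_zero:
  fixes f :: "'a::euclidean_space \<Rightarrow> real"
  assumes d: "\<And>x. (f has_derivative f' x) (at x)" and c: "continuous_on UNIV (\<lambda>x. f' x e)"
    and supp: "\<And>x. T \<le> norm x \<Longrightarrow> f x = 0"
  shows "(\<integral>x. f' x e \<partial>lborel) = 0"
proof -
  have cf: "continuous_on UNIV f"
    using d by (auto intro!: continuous_at_imp_continuous_on has_derivative_continuous)
  \<comment> \<open>The extra norm e in the radius covers the translates by steps of length at most
    1; the segment from a point of S to its translate stays in the ball with 2 * norm e, on which M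
    is taken.\<close>
  define S where "S = cball (0::'a) (\<bar>T\<bar> + norm e)"
  have "compact ((\<lambda>x. f' x e) ` cball 0 (\<bar>T\<bar> + 2 * norm e))"
    using continuous_on_subset[OF c] by (intro compact_continuous_image compact_cball) auto
  then have "bounded ((\<lambda>x. f' x e) ` cball 0 (\<bar>T\<bar> + 2 * norm e))" by (rule compact_imp_bounded)
  then obtain M where "0 < M" "\<forall>y\<in>(\<lambda>x. f' x e) ` cball 0 (\<bar>T\<bar> + 2 * norm e). norm y \<le> M"
    unfolding bounded_pos by blast
  then have M: "0 < M" "\<And>x. norm x \<le> \<bar>T\<bar> + 2 * norm e \<Longrightarrow> \<bar>f' x e\<bar> \<le> M"
    by auto
  have off: "f x = 0" if "x \<notin> S" for x
  proof (rule supp)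
    have "\<bar>T\<bar> + norm e < norm x" using that by (simp add: S_def)
    then show "T \<le> norm x" using norm_ge_zero[of e] by linarith
  qed
  have int: "integrable lborel f"
  proof -
    have "integrable lborel (\<lambda>x. indicator S x *\<^sub>R f x)"
      unfolding S_def by (intro borel_integrable_compact continuous_on_subset[OF cf]) auto
    moreover have "(\<lambda>x. indicator S x *\<^sub>R f x) = f"
      using off by (auto simp: indicator_def fun_eq_iff)
    ultimately show ?thesis by simp
  qed
  define t where "t n = 1 / real (Suc n)" for n
  have t: "0 < t n" "t n \<le> 1" for n by (auto simp: t_def field_simps)
  have t0: "t \<longlonglongrightarrow> 0"
    unfolding t_def by (rule LIMSEQ_Suc[OF lim_const_over_n])
  have line: "((\<lambda>s. f (x + s *\<^sub>R e)) has_real_derivative f' (x + s *\<^sub>R e) e) (at s)" for x s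
  proof -
    have "((\<lambda>s. x + s *\<^sub>R e) has_derivative (\<lambda>h. h *\<^sub>R e)) (at s)"
      by (auto intro!: derivative_eq_intros)
    from has_derivative_compose[OF this d]
    have "((\<lambda>s. f (x + s *\<^sub>R e)) has_derivative (\<lambda>h. f' (x + s *\<^sub>R e) (h *\<^sub>R e))) (at s)" .
    moreover have "(\<lambda>h. f' (x + s *\<^sub>R e) (h *\<^sub>R e)) = (*) (f' (x + s *\<^sub>R e) e)"
      by (rule ext) (simp add: linear_scale[OF has_derivative_linear[OF d]])
    ultimately show ?thesis by (simp add: has_field_derivative_def)
  qed
  define q where "q n x = (f (x + t n *\<^sub>R e) - f x) / t n" for n x
  have q_int: "integrable lborel (q n)" "(\<integral>x. q n x \<partial>lborel) = 0" for n
  proof -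
    have i: "integrable lborel (\<lambda>x. f (t n *\<^sub>R e + x))"
      using integrable_distr_eq[of "(+) (t n *\<^sub>R e)" lborel borel f] int cf
      by (simp add: lborel_distr_plus borel_measurable_continuous_onI)
    have j: "(\<integral>x. f (t n *\<^sub>R e + x) \<partial>lborel) = (\<integral>x. f x \<partial>lborel)"
      using integral_distr[of "(+) (t n *\<^sub>R e)" lborel borel f] cf
      by (simp add: lborel_distr_plus borel_measurable_continuous_onI)
    show "integrable lborel (q n)" "(\<integral>x. q n x \<partial>lborel) = 0"
      unfolding q_def using i j int by (auto simp: add.commute)
  qed
  have bound: "\<bar>q n x\<bar> \<le> indicator S x * M" for n x
  proof (cases "x \<in> S")
    case True
    have "\<exists>z>0. z < t n \<and> f (x + t n *\<^sub>R e) - f (x + 0 *\<^sub>R e) = (t n - 0) * f' (x + z *\<^sub>R e) e"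
      using line t by (intro MVT2) auto
    then obtain z where z: "0 < z" "z < t n" "f (x + t n *\<^sub>R e) - f x = t n * f' (x + z *\<^sub>R e) e"
      by auto
    have "norm (x + z *\<^sub>R e) \<le> norm x + \<bar>z\<bar> * norm e" by (metis norm_scaleR norm_triangle_ineq)
    also have "\<dots> \<le> (\<bar>T\<bar> + norm e) + 1 * norm e"
      using True z t[of n] by (intro add_mono mult_right_mono) (auto simp: S_def)
    finally have "\<bar>f' (x + z *\<^sub>R e) e\<bar> \<le> M" by (intro M) simp
    then show ?thesis using z t[of n] True by (simp add: q_def)
  next
    case False
    then have x: "\<bar>T\<bar> + norm e < norm x" by (simp add: S_def)
    have "norm x - norm (t n *\<^sub>R e) \<le> norm (x + t n *\<^sub>R e)" by (rule norm_diff_ineq)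
    moreover have "norm (t n *\<^sub>R e) \<le> norm e" using t[of n] by (simp add: mult_left_le_one_le)
    ultimately have "T \<le> norm (x + t n *\<^sub>R e)" using x by linarith
    moreover have "T \<le> norm x" using x norm_ge_zero[of e] by linarith
    ultimately show ?thesis using supp False by (simp add: q_def)
  qed
  have "(\<lambda>n. \<integral>x. q n x \<partial>lborel) \<longlonglongrightarrow> (\<integral>x. f' x e \<partial>lborel)"
  proof (rule integral_dominated_convergence[where w = "\<lambda>x. indicator S x * M"])
    show "(\<lambda>x. f' x e) \<in> borel_measurable lborel"
      using c by (simp add: borel_measurable_continuous_onI)
    show "integrable lborel (\<lambda>x. indicator S x * M)"
      unfolding S_def using emeasure_lborel_cball_finite[of "0::'a" "\<bar>T\<bar> + norm e"]
      by (intro integrable_mult_left integrable_real_indicator) auto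
    show "AE x in lborel. (\<lambda>n. q n x) \<longlonglongrightarrow> f' x e"
    proof (rule AE_I2)
      fix x
      have "((\<lambda>h. (f (x + h *\<^sub>R e) - f x) / h) \<longlongrightarrow> f' x e) (at 0)"
        using line[of x 0] by (simp add: has_field_derivative_iff)
      then show "(\<lambda>n. q n x) \<longlonglongrightarrow> f' x e"
        unfolding q_def
        by (rule filterlim_compose) (use t t0 in \<open>auto simp: filterlim_at less_imp_neq[symmetric]\<close>)
    qed
    show "AE x in lborel. norm (q n x) \<le> indicator S x * M" for n using bound by simp
    show "q n \<in> borel_measurable lborel" for n using q_int by auto
  qed
  then show ?thesis using q_int(2) LIMSEQ_unique[OF _ tendsto_const] by fastforce
qed

lemma plateau_integral_pos:
  assumes "a < b"
  shows "0 < (\<integral>t. plateau a b 1 t \<partial>lborel)" "integrable lborel (plateau a b n)"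
proof -
  have meas: "plateau a b n \<in> borel_measurable borel" for n
    using C_k_plateau[of 0] by (simp add: borel_measurable_continuous_onI)
  have int: "integrable lborel (plateau a b n)" for n
  proof (rule Bochner_Integration.integrable_bound)
    show "integrable lborel (indicator {a..b} :: real \<Rightarrow> real)" by (rule integrable_real_indicator) (auto simp: emeasure_lborel_Icc_eq)
    show "AE t in lborel. norm (plateau a b n t) \<le> norm (indicator {a..b} t :: real)"
      using plateau_bounds plateau_eq_0 by (intro AE_I2) (force simp: indicator_def)
  qed (use meas in simp)
  then show "integrable lborel (plateau a b n)" .
  have "\<not> (AE t in lborel. plateau a b 1 t = 0)"
  proof
    assume "AE t in lborel. plateau a b 1 t = 0"
    then have "AE t in lborel. t \<notin> {a<..<b}"
      by eventually_elim (use plateau_pos[of _ a b 1] in force)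
    then have "emeasure lborel {a<..<b} = 0"
      by (subst (asm) AE_iff_measurable[of "{a<..<b}"]) auto
    then show False using assms by simp
  qed
  then show "0 < (\<integral>t. plateau a b 1 t \<partial>lborel)"
    using integral_nonneg_eq_0_iff_AE[OF int[of 1]] plateau_bounds(1)
      Bochner_Integration.integral_nonneg[OF plateau_bounds(1)[of a b 1]] by (auto simp: less_le)
qed

text \<open>As n grows the bumps become indicators of intervals, which reduces the claim to
  integrals over boxes.\<close>

lemma AE_eq_0_of_plateau_integral:
  fixes f :: "real \<Rightarrow> real"
  assumes f: "set_integrable lborel {a..b} f"
    and zero: "\<And>c d n. a \<le> c \<Longrightarrow> d \<le> b \<Longrightarrow> c < d \<Longrightarrow> (LINT t:{a..b}|lborel. f t * plateau c d n t) = 0"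
  shows "AE t in lborel. t \<in> {a..b} \<longrightarrow> f t = 0"
proof -
  let ?g = "\<lambda>t. indicator {a..b} t * f t"
  have g: "integrable lborel ?g" using f by (simp add: set_integrable_def)
  have meas: "plateau c d n \<in> borel_measurable borel" for c d n
    using C_k_plateau[of 0] by (simp add: borel_measurable_continuous_onI)
  have 1: "(\<integral>t. indicator {c<..<d} t * ?g t \<partial>lborel) = 0" if cd: "a \<le> c" "d \<le> b" "c < d" for c d
  proof -
    have "(\<lambda>n. \<integral>t. ?g t * plateau c d n t \<partial>lborel) \<longlonglongrightarrow> (\<integral>t. ?g t * indicator {c<..<d} t \<partial>lborel)"
    proof (rule integral_dominated_convergence[where w = "\<lambda>t. norm (?g t)"])
      show "AE t in lborel. norm (?g t * plateau c d n t) \<le> norm (?g t)" for n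
        using plateau_bounds by (intro AE_I2) (simp add: abs_mult mult_left_le)
      show "AE t in lborel. (\<lambda>n. ?g t * plateau c d n t) \<longlonglongrightarrow> ?g t * indicator {c<..<d} t"
        by (intro AE_I2 tendsto_intros plateau_tendsto)
    qed (use g meas in auto)
    moreover have "(\<integral>t. ?g t * plateau c d n t \<partial>lborel) = 0" for n
      using zero[OF cd, of n] by (simp add: set_lebesgue_integral_def mult.assoc)
    ultimately show ?thesis using LIMSEQ_unique[OF _ tendsto_const] by (fastforce simp: mult.commute)
  qed
  have "AE t in lborel. ?g t = 0"
  proof (rule AE_eq_0_of_integral_box[OF g])
    fix c d :: real
    \<comment> \<open>An arbitrary interval is clipped to [a, b]; only the endpoints a and b, a null
      set, are treated differently.\<close>
    define c' d' where "c' = max a c" and "d' = min b d"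
    have "AE t in lborel. indicator (box c d) t * ?g t = indicator {c'<..<d'} t * ?g t"
      using AE_lborel_singleton[of a] AE_lborel_singleton[of b]
      by eventually_elim (auto simp: c'_def d'_def indicator_def)
    then have "(\<integral>t. indicator (box c d) t * ?g t \<partial>lborel) = (\<integral>t. indicator {c'<..<d'} t * ?g t \<partial>lborel)"
      using g by (intro integral_cong_AE) auto
    also have "\<dots> = 0"
      using 1[of c' d'] by (cases "c' < d'") (auto simp: c'_def d'_def)
    finally show "(\<integral>t. indicator (box c d) t * ?g t \<partial>lborel) = 0" .
  qed
  then show ?thesis by eventually_elim auto
qed

text \<open>A function with zero mean and support in [a, b] is the derivative of an admissible test
  function. Subtracting a multiple of a fixed bump gives any bump mean zero, so Q - C is orthogonal
  to all bumps, where C is the mean of Q weighted by the fixed bump.\<close>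

lemma du_Bois_Reymond:
  fixes Q :: "real \<Rightarrow> real"
  assumes ab: "a < b" and Q: "set_integrable lborel {a..b} Q"
    and weak: "\<And>\<eta>. (\<And>j. C_k j \<eta>) \<Longrightarrow> (\<And>t. t \<notin> {a..b} \<Longrightarrow> \<eta> t = 0) \<Longrightarrow>
       (LINT t:{a..b}|lborel. Q t * deriv \<eta> t) = 0"
  shows "\<exists>C. AE t in lborel. t \<in> {a..b} \<longrightarrow> Q t = C"
proof -
  define I where "I = (\<integral>t. plateau a b 1 t \<partial>lborel)"
  have I: "0 < I" unfolding I_def by (rule plateau_integral_pos(1)[OF ab])
  define C where "C = (LINT t:{a..b}|lborel. Q t * plateau a b 1 t) / I"
  have cont: "continuous_on S (plateau c d n)" for c d n S
    using continuous_on_subset[OF C_k_plateau[of 0 c d n, unfolded C_k.simps]] by simp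
  have meas: "plateau c d n \<in> borel_measurable borel" for c d n
    by (simp add: borel_measurable_continuous_onI cont)
  have Qp: "set_integrable lborel {a..b} (\<lambda>t. Q t * plateau c d n t)" for c d n
  proof -
    have "integrable lborel (\<lambda>t. (indicator {a..b} t * Q t) * plateau c d n t)"
    proof (rule Bochner_Integration.integrable_bound)
      show "integrable lborel (\<lambda>t. indicator {a..b} t * Q t)" using Q by (simp add: set_integrable_def)
      show "AE t in lborel. norm (indicator {a..b} t * Q t * plateau c d n t) \<le> norm (indicator {a..b} t * Q t)"
        using plateau_bounds by (intro AE_I2) (simp add: abs_mult mult_left_le)
    qed (use Q meas in \<open>auto simp: set_integrable_def intro!: borel_measurable_times\<close>)
    then show ?thesis by (simp add: set_integrable_def mult.assoc)
  qed
  have "AE t in lborel. t \<in> {a..b} \<longrightarrow> Q t - C = 0"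
  proof (rule AE_eq_0_of_plateau_integral)
    show "set_integrable lborel {a..b} (\<lambda>t. Q t - C)"
      by (intro set_integral_diff Q borel_integrable_atLeastAtMost') auto
    fix c d n assume cd: "a \<le> c" "d \<le> b" "c < (d::real)"
    define J where "J = (\<integral>t. plateau c d n t \<partial>lborel)"
    \<comment> \<open>The coefficient J / I makes the integral of \<theta> vanish, which is what
      lets its primitive return to 0 at b.\<close>
    define \<theta> where "\<theta> t = plateau c d n t + (- (J / I)) * plateau a b 1 t" for t
    have C\<theta>: "C_k j \<theta>" for j
      unfolding \<theta>_def by (intro C_k_add C_k_mult C_k_const C_k_plateau)
    have \<theta>0: "\<theta> t = 0" if "t \<notin> {a<..<b}" for t
      using that cd plateau_eq_0[of t c d n] plateau_eq_0[of t a b 1] by (auto simp: \<theta>_def)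
    have \<theta>c: "continuous_on S \<theta>" for S
      using continuous_on_subset[OF C\<theta>[of 0, unfolded C_k.simps]] by simp
    \<comment> \<open>Starting the primitive at a - 1 makes a an interior point, so that it is
      differentiable there.\<close>
    define \<eta> where "\<eta> t = integral {a - 1..t} \<theta>" for t
    have low: "\<eta> t = 0" if "t \<le> a" for t
      unfolding \<eta>_def using that \<theta>0
      by (subst Henstock_Kurzweil_Integration.integral_cong[where g = "\<lambda>_. 0"]) auto
    have d\<eta>: "(\<eta> has_real_derivative \<theta> t) (at t)" for t
    proof (cases "t < a")
      case True
      have "((\<lambda>t. 0) has_real_derivative \<theta> t) (at t)" using True \<theta>0 by simp
      moreover have "\<forall>\<^sub>F s in nhds t. 0 = \<eta> s"
        using eventually_nhds_in_open[of "{..<a}" t] True low by (auto elim: eventually_mono)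
      ultimately show ?thesis by (subst (asm) DERIV_cong_ev[OF refl _ refl]) auto
    next
      case False
      then show ?thesis
        unfolding \<eta>_def[abs_def]
        using integral_has_real_derivative[OF \<theta>c, of t "a - 1" "t + 1"]
        by (simp add: at_within_Icc_at)
    qed
    have C\<eta>: "C_k j \<eta>" for j
      using C_k_SucD[OF C_k_real_SucI[OF d\<eta> C\<theta>]] .
    have int\<theta>: "(\<integral>t. \<theta> t \<partial>lborel) = 0"
      unfolding \<theta>_def using plateau_integral_pos(2)[OF cd(3)] plateau_integral_pos(2)[OF ab] I
      by (simp add: J_def[symmetric] I_def[symmetric] del: One_nat_def)
    have high: "\<eta> t = 0" if "b \<le> t" for t
    proof -
      have "(LINT s:{a - 1..t}|lborel. \<theta> s) = (\<integral>s. \<theta> s \<partial>lborel)"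
      proof -
        have "indicator {a - 1..t} s *\<^sub>R \<theta> s = \<theta> s" for s
          using \<theta>0[of s] that ab by (cases "s \<in> {a<..<b}") (auto simp: indicator_def)
        then have "(\<lambda>s. indicator {a - 1..t} s *\<^sub>R \<theta> s) = \<theta>" by (rule ext)
        then show ?thesis unfolding set_lebesgue_integral_def by (simp only:)
      qed
      then show ?thesis
        unfolding \<eta>_def using set_borel_integral_eq_integral(2)[OF borel_integrable_atLeastAtMost'[OF \<theta>c]] int\<theta>
        by metis
    qed
    have "(LINT t:{a..b}|lborel. Q t * deriv \<eta> t) = 0"
      using C\<eta> low high by (intro weak) auto
    then have "(LINT t:{a..b}|lborel. Q t * \<theta> t) = 0"
      using DERIV_imp_deriv[OF d\<eta>] by simp
    moreover have "Q t * \<theta> t = Q t * plateau c d n t - (J / I) * (Q t * plateau a b 1 t)" for t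
      by (simp add: \<theta>_def algebra_simps)
    ultimately have "(LINT t:{a..b}|lborel. Q t * plateau c d n t)
        - (J / I) * (LINT t:{a..b}|lborel. Q t * plateau a b 1 t) = 0"
      using Qp by (simp add: set_integral_diff)
    moreover have "(LINT t:{a..b}|lborel. C * plateau c d n t) = C * J"
    proof -
      have "indicator {a..b} t *\<^sub>R (C * plateau c d n t) = C * plateau c d n t" for t
        using plateau_eq_0[of t c d n] cd by (cases "t \<in> {c<..<d}") auto
      then have "(\<lambda>t. indicator {a..b} t *\<^sub>R (C * plateau c d n t)) = (\<lambda>t. C * plateau c d n t)"
        by (rule ext)
      then show ?thesis unfolding set_lebesgue_integral_def by (simp only: J_def integral_mult_right_zero)
    qed
    moreover have "(LINT t:{a..b}|lborel. (Q t - C) * plateau c d n t) =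
        (LINT t:{a..b}|lborel. Q t * plateau c d n t) - (LINT t:{a..b}|lborel. C * plateau c d n t)"
      unfolding left_diff_distrib
      by (intro set_integral_diff Qp set_integrable_mult_right borel_integrable_atLeastAtMost' cont)
    ultimately show "(LINT t:{a..b}|lborel. (Q t - C) * plateau c d n t) = 0"
      using I by (auto simp: C_def)
  qed
  then show ?thesis by auto
qed

text \<open>Fubini on the triangle s <= t. The inner integral of \<eta>' over [s, b] is -\<eta> s
  because \<eta> b = 0, and the primitive vanishes at a, so no boundary term appears.\<close>

lemma set_integral_primitive_by_parts:
  fixes k :: "real \<Rightarrow> real"
  assumes ab: "a \<le> b" and k: "set_integrable lborel {a..b} k"
    and \<eta>: "\<And>t. (\<eta> has_real_derivative \<eta>' t) (at t)" "continuous_on UNIV \<eta>'" "\<eta> b = 0"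
  shows "(LINT t:{a..b}|lborel. (LINT s:{a..t}|lborel. k s) * \<eta>' t) = - (LINT s:{a..b}|lborel. k s * \<eta> s)"
proof -
  have \<eta>'i: "integrable lborel (\<lambda>t. indicator {a..b} t * \<eta>' t)"
    using borel_integrable_atLeastAtMost'[OF continuous_on_subset[OF \<eta>(2)]]
    by (simp add: set_integrable_def)
  have ki: "integrable lborel (\<lambda>s. indicator {a..b} s * k s)" using k by (simp add: set_integrable_def)
  define F where "F = (\<lambda>(s, t). if s \<le> t then (indicator {a..b} s * k s) * (indicator {a..b} t * \<eta>' t) else (0::real))"
  have F: "integrable (lborel \<Otimes>\<^sub>M lborel) F"
  proof (rule Bochner_Integration.integrable_bound)
    show "integrable (lborel \<Otimes>\<^sub>M lborel) (\<lambda>(s, t). (indicator {a..b} s * k s) * (indicator {a..b} t * \<eta>' t))"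
    proof (rule lborel_pair.Fubini_integrable)
      have "(\<lambda>s. indicator {a..b} s * k s) \<in> borel_measurable borel"
        "(\<lambda>t. indicator {a..b} t * \<eta>' t) \<in> borel_measurable borel" using ki \<eta>'i by auto
      then show "(\<lambda>(s, t). (indicator {a..b} s * k s) * (indicator {a..b} t * \<eta>' t))
          \<in> borel_measurable (lborel \<Otimes>\<^sub>M lborel)" by measurable
      show "integrable lborel (\<lambda>x. \<integral>y. norm (case (x, y) of (s, t) \<Rightarrow>
          (indicator {a..b} s * k s) * (indicator {a..b} t * \<eta>' t)) \<partial>lborel)"
        using integrable_norm[OF ki] by (simp only: prod.case norm_mult integral_mult_right_zero integrable_mult_left)
    qed (use \<eta>'i in auto)
    have [measurable]: "(\<lambda>s. indicator {a..b} s * k s) \<in> borel_measurable borel"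
      "(\<lambda>t. indicator {a..b} t * \<eta>' t) \<in> borel_measurable borel" using ki \<eta>'i by auto
    show "F \<in> borel_measurable (lborel \<Otimes>\<^sub>M lborel)"
      unfolding F_def by measurable
    show "AE x in lborel \<Otimes>\<^sub>M lborel. norm (F x) \<le> norm (case x of (s, t) \<Rightarrow> (indicator {a..b} s * k s) * (indicator {a..b} t * \<eta>' t))"
      by (auto simp: F_def)
  qed
  have "(\<integral>t. (\<integral>s. F (s, t) \<partial>lborel) \<partial>lborel) = (\<integral>s. (\<integral>t. F (s, t) \<partial>lborel) \<partial>lborel)"
    using lborel_pair.Fubini_integral[of "\<lambda>s t. F (s, t)"] F by simp
  moreover have "(\<integral>s. F (s, t) \<partial>lborel) = indicator {a..b} t *\<^sub>R ((LINT s:{a..t}|lborel. k s) * \<eta>' t)" for t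
  proof -
    have "(\<lambda>s. F (s, t)) = (\<lambda>s. (indicator {a..t} s *\<^sub>R k s) * (indicator {a..b} t * \<eta>' t))"
      by (auto simp: F_def indicator_def fun_eq_iff)
    then show ?thesis by (simp add: set_lebesgue_integral_def)
  qed
  moreover have "(\<integral>t. F (s, t) \<partial>lborel) = indicator {a..b} s *\<^sub>R (- (k s * \<eta> s))" for s
  proof (cases "s \<in> {a..b}")
    case True
    have "(\<lambda>t. F (s, t)) = (\<lambda>t. k s * (indicator {s..b} t *\<^sub>R \<eta>' t))"
      using True by (auto simp: F_def indicator_def fun_eq_iff)
    moreover have "(\<integral>t. indicator {s..b} t *\<^sub>R \<eta>' t \<partial>lborel) = \<eta> b - \<eta> s"
      using True \<eta>(1) by (intro integral_FTC_atLeastAtMost continuous_on_subset[OF \<eta>(2)])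
        (auto intro: has_field_derivative_imp_has_derivative simp: has_real_derivative_iff_has_vector_derivative[symmetric] has_field_derivative_at_within)
    ultimately show ?thesis using True \<eta>(3) by simp
  next
    case False
    then have "F (s, t) = 0" for t by (auto simp: F_def indicator_def)
    then show ?thesis using False by simp
  qed
  ultimately show ?thesis by (simp add: set_lebesgue_integral_def)
qed

lemma continuous_on_indefinite_set_integral:
  fixes k :: "real \<Rightarrow> real"
  assumes k: "set_integrable lborel {a..b} k"
  shows "continuous_on {a..b} (\<lambda>t. LINT s:{a..t}|lborel. k s)"
proof -
  have "k absolutely_integrable_on {a..b}"
    using k by (simp add: set_integrable_def integrable_completion)
  from indefinite_integral_continuous_1[OF set_lebesgue_integral_eq_integral(1)[OF this]]
  show ?thesis
    by (rule continuous_on_eq)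
      (auto intro!: set_borel_integral_eq_integral(2)[symmetric] set_integrable_subset[OF k])
qed

text \<open>P minus the primitive of its weak derivative k has weak derivative 0, and
  \<open>du_Bois_Reymond\<close> makes it constant.\<close>

lemma weak_derivative_imp_primitive:
  fixes P k :: "real \<Rightarrow> real"
  assumes ab: "a < b" and P: "set_integrable lborel {a..b} P" and k: "set_integrable lborel {a..b} k"
    and weak: "\<And>\<eta>. (\<And>j. C_k j \<eta>) \<Longrightarrow> (\<And>t. t \<notin> {a..b} \<Longrightarrow> \<eta> t = 0) \<Longrightarrow>
       (LINT t:{a..b}|lborel. P t * deriv \<eta> t) = - (LINT t:{a..b}|lborel. k t * \<eta> t)"
  shows "\<exists>C. AE t in lborel. t \<in> {a..b} \<longrightarrow> P t = C + (LINT s:{a..t}|lborel. k s)"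
proof -
  let ?K = "\<lambda>t. LINT s:{a..t}|lborel. k s"
  have Kc: "continuous_on {a..b} ?K" by (rule continuous_on_indefinite_set_integral[OF k])
  have Ki: "set_integrable lborel {a..b} ?K" by (rule borel_integrable_atLeastAtMost'[OF Kc])
  have "\<exists>C. AE t in lborel. t \<in> {a..b} \<longrightarrow> P t - ?K t = C"
  proof (rule du_Bois_Reymond[OF ab])
    show "set_integrable lborel {a..b} (\<lambda>t. P t - ?K t)" by (intro set_integral_diff P Ki)
    fix \<eta> :: "real \<Rightarrow> real" assume C: "\<And>j. C_k j \<eta>" and supp: "\<And>t. t \<notin> {a..b} \<Longrightarrow> \<eta> t = 0"
    have d: "(\<eta> has_real_derivative deriv \<eta> t) (at t)" for t by (rule C_k_real_deriv(1)[OF C])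
    have dc: "continuous_on UNIV (deriv \<eta>)" using C_k_real_deriv(2)[OF C[of "Suc 0"]] by simp
    \<comment> \<open>Vanishing is assumed only outside the closed interval; continuity extends it
      to the endpoint.\<close>
    have eb: "\<eta> b = 0"
    proof -
      have "isCont \<eta> b" using d by (rule DERIV_isCont)
      then have "(\<eta> \<longlongrightarrow> \<eta> b) (at_right b)" by (simp add: isCont_def filterlim_at_split)
      moreover have "(\<eta> \<longlongrightarrow> 0) (at_right b)"
        using eventually_at_right_less[of b] by (intro tendsto_eventually) (auto elim!: eventually_mono intro: supp)
      ultimately show ?thesis by (rule tendsto_unique[rotated]) simp
    qed
    have mi: "set_integrable lborel {a..b} (\<lambda>t. f t * deriv \<eta> t)"
      if f: "set_integrable lborel {a..b} f" for f
    proof -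
      have "bounded (deriv \<eta> ` {a..b})"
        by (intro compact_imp_bounded compact_continuous_image continuous_on_subset[OF dc]) auto
      then obtain M where M: "\<And>t. t \<in> {a..b} \<Longrightarrow> \<bar>deriv \<eta> t\<bar> \<le> M"
        unfolding bounded_iff real_norm_def by blast
      have "integrable lborel (\<lambda>t. (indicator {a..b} t * f t) * deriv \<eta> t)"
      proof (rule Bochner_Integration.integrable_bound)
        show "integrable lborel (\<lambda>t. M * (indicator {a..b} t * f t))"
          using f by (simp add: set_integrable_def)
        show "AE t in lborel. norm (indicator {a..b} t * f t * deriv \<eta> t) \<le> norm (M * (indicator {a..b} t * f t))"
        proof (rule AE_I2)
          fix t show "norm (indicator {a..b} t * f t * deriv \<eta> t) \<le> norm (M * (indicator {a..b} t * f t))"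
          proof (cases "t \<in> {a..b}")
            case True
            then have "\<bar>deriv \<eta> t\<bar> \<le> \<bar>M\<bar>" using M[OF True] by linarith
            then have "\<bar>f t\<bar> * \<bar>deriv \<eta> t\<bar> \<le> \<bar>f t\<bar> * \<bar>M\<bar>" by (rule mult_left_mono) simp
            then show ?thesis using True by (simp add: abs_mult mult.commute)
          qed simp
        qed
        show "(\<lambda>t. (indicator {a..b} t * f t) * deriv \<eta> t) \<in> borel_measurable lborel"
        proof (rule borel_measurable_times)
          show "(\<lambda>t. indicator {a..b} t * f t) \<in> borel_measurable lborel"
            using f by (auto simp: set_integrable_def)
          show "deriv \<eta> \<in> borel_measurable lborel"
            using dc by (simp add: borel_measurable_continuous_onI)
        qed
      qed
      then show ?thesis by (simp add: set_integrable_def mult.assoc)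
    qed
    have "(LINT t:{a..b}|lborel. (P t - ?K t) * deriv \<eta> t)
      = (LINT t:{a..b}|lborel. P t * deriv \<eta> t) - (LINT t:{a..b}|lborel. ?K t * deriv \<eta> t)"
      unfolding left_diff_distrib by (intro set_integral_diff mi P Ki)
    then show "(LINT t:{a..b}|lborel. (P t - ?K t) * deriv \<eta> t) = 0"
      using weak[OF C supp] set_integral_primitive_by_parts[OF less_imp_le[OF ab] k d dc eb] by simp
  qed
  then obtain C where "AE t in lborel. t \<in> {a..b} \<longrightarrow> P t - ?K t = C" by auto
  then show ?thesis by (intro exI[of _ C]) (auto elim!: eventually_mono)
qed

section \<open>Integration of radial functions\<close>

text \<open>Half-lines determine the distribution of the norm, and their measures are differences of
  ball volumes V R^n - V x^n. Differentiating in x gives the density, without a measure on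
  spheres.\<close>

lemma distr_norm_ball:
  assumes R: "0 < R"
  shows "distr (lebesgue_on (ball (0::'a::euclidean_space) R)) borel norm =
    density lborel (\<lambda>r. ennreal (DIM('a) * unit_ball_vol DIM('a) * r powr (real DIM('a) - 1)) * indicator {0<..<R} r)"
    (is "?D = density lborel ?f")
proof (rule measure_eqI_lessThan)
  define V where "V = unit_ball_vol (real DIM('a))"
  define n where "n = DIM('a)"
  have n: "0 < n" and V: "0 < V" by (auto simp: n_def V_def)
  have norm_meas: "norm \<in> measurable (lebesgue_on (ball (0::'a) R)) borel"
    by (intro measurable_restrict_space1 borel_measurable_continuous_onI continuous_intros measurable_completion)
      (simp add: borel_measurable_continuous_onI)
  \<comment> \<open>Clamping to [0, R] lets one formula cover the half-lines that start below 0 or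
    beyond R.\<close>
  define m where "m x = min R (max 0 x)" for x :: real
  have m: "0 \<le> m x" "m x \<le> R" for x using R by (auto simp: m_def)
  have D: "emeasure ?D {x<..} = ennreal (V * R ^ n - V * m x ^ n)" for x
  proof -
    have "emeasure ?D {x<..} = emeasure (lebesgue_on (ball (0::'a) R)) {y \<in> ball 0 R. x < norm y}"
      using norm_meas by (subst emeasure_distr) (auto intro!: arg_cong[where f = "emeasure _"])
    also have "{y \<in> ball (0::'a) R. x < norm y} = ball 0 R - (if 0 \<le> x then cball 0 (m x) else {})"
      using R by (auto simp: m_def intro: less_le_trans[OF _ norm_ge_zero])
    also have "emeasure (lebesgue_on (ball (0::'a) R)) \<dots> = emeasure lborel (ball (0::'a) R - (if 0 \<le> x then cball 0 (m x) else {}))"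
      by (subst emeasure_restrict_space) auto
    also have "\<dots> = ennreal (V * R ^ n - V * m x ^ n)"
    proof (cases "0 \<le> x \<and> x < R")
      case True
      then have "m x = x" "cball (0::'a) x \<subseteq> ball 0 R" by (auto simp: m_def)
      then show ?thesis
        using True V R by (simp add: emeasure_Diff emeasure_ball emeasure_cball V_def n_def
            ennreal_minus emeasure_lborel_cball_finite)
    next
      case False
      then consider "x < 0" | "R \<le> x" by linarith
      then show ?thesis
      proof cases
        case 1
        then have "m x = 0" using R by (simp add: m_def)
        then show ?thesis using 1 R n by (simp add: emeasure_ball V_def n_def)
      next
        case 2
        then have "m x = R" using R by (auto simp: m_def)
        moreover have "ball (0::'a) R - cball 0 R = {}" by auto
        then have "emeasure lborel (ball (0::'a) R - cball 0 R) = 0" by (simp only: emeasure_empty)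
        ultimately show ?thesis using 2 R by simp
      qed
    qed
    finally show ?thesis .
  qed
  show "emeasure ?D {x<..} < \<infinity>" for x by (simp add: D)
  show "emeasure ?D {x<..} = emeasure (density lborel ?f) {x<..}" for x
  proof -
    have "emeasure (density lborel ?f) {x<..} = (\<integral>\<^sup>+r. ?f r * indicator {x<..} r \<partial>lborel)"
      by (subst emeasure_density) auto
    also have "\<dots> = (\<integral>\<^sup>+r. ennreal (n * V * r ^ (n - 1)) * indicator {m x..R} r \<partial>lborel)"
    proof (rule nn_integral_cong_AE)
      show "AE r in lborel. ?f r * indicator {x<..} r = ennreal (n * V * r ^ (n - 1)) * indicator {m x..R} r"
        using AE_lborel_singleton[of 0] AE_lborel_singleton[of R] AE_lborel_singleton[of x]
      proof eventually_elim
        fix r assume r: "r \<noteq> 0" "r \<noteq> R" "r \<noteq> x"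
        have "r powr (real n - 1) = r ^ (n - 1)" if "0 < r"
          using that n by (simp add: powr_realpow[symmetric] of_nat_diff)
        then show "?f r * indicator {x<..} r = ennreal (n * V * r ^ (n - 1)) * indicator {m x..R} r"
          using r R by (auto simp: m_def indicator_def n_def V_def)
      qed
    qed
    also have "\<dots> = ennreal (V * R ^ n - V * m x ^ n)"
      using m[of x] V n
      by (intro nn_integral_FTC_Icc) (auto intro!: derivative_eq_intros)
    finally show ?thesis by (simp add: D)
  qed
qed auto

text \<open>
  A substitute for averaging over spheres: with \<open>T\<close> the norm, \<open>k\<close> plays the role of the spherical
  means of \<open>h\<close>, obtained as a Radon--Nikodym derivative without any measure on spheres.
\<close>

lemma nonneg_conditional_factor:
  fixes h :: "'a \<Rightarrow> real"
  assumes M: "finite_measure M" and T[measurable]: "T \<in> borel_measurable M"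
    and h: "integrable M h" "\<And>x. 0 \<le> h x"
  obtains k :: "real \<Rightarrow> real" where "k \<in> borel_measurable borel" "integrable M (\<lambda>x. k (T x))"
    "\<And>\<zeta> :: real \<Rightarrow> real. \<zeta> \<in> borel_measurable borel \<Longrightarrow>
      (\<integral>x. h x * \<zeta> (T x) \<partial>M) = (\<integral>x. k (T x) * \<zeta> (T x) \<partial>M)"
proof -
  interpret M: finite_measure M by fact
  have hm[measurable]: "h \<in> borel_measurable M" using h by auto
  define \<nu> where "\<nu> = distr M borel T"
  define \<mu> where "\<mu> = distr (density M (\<lambda>x. ennreal (h x))) borel T"
  have [simp]: "sets \<nu> = sets borel" "sets \<mu> = sets borel" "space \<nu> = UNIV"
    by (simp_all add: \<nu>_def \<mu>_def)
  have Td[measurable]: "T \<in> borel_measurable (density M (\<lambda>x. ennreal (h x)))" by simp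
  interpret \<nu>: finite_measure \<nu> unfolding \<nu>_def by (rule M.finite_measure_distr[OF T])
  have "absolutely_continuous \<nu> \<mu>"
    unfolding absolutely_continuous_def
  proof
    fix A assume "A \<in> null_sets \<nu>"
    then have A: "A \<in> sets borel" "emeasure M (T -` A \<inter> space M) = 0"
      by (auto simp: null_sets_def \<nu>_def emeasure_distr)
    then have "T -` A \<inter> space M \<in> null_sets M" by (auto intro!: null_setsI)
    then have "AE x in M. x \<notin> T -` A \<inter> space M" by (rule AE_not_in)
    then have "emeasure \<mu> A = 0"
      using A(1) by (simp add: \<mu>_def emeasure_distr emeasure_density nn_integral_0_iff_AE)
        (auto elim!: eventually_mono simp: indicator_def)
    then show "A \<in> null_sets \<mu>" using A by (auto simp: null_sets_def)
  qed
  from \<nu>.Radon_Nikodym[OF this] obtain f where f: "f \<in> borel_measurable \<nu>" "density \<nu> f = \<mu>" by auto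
  have fb[measurable]: "f \<in> borel_measurable borel" using f(1) by (simp cong: measurable_cong_sets)
  have "(\<integral>\<^sup>+t. f t \<partial>\<nu>) = emeasure \<mu> UNIV"
    using emeasure_density[OF f(1), of UNIV] f(2) by simp
  also have "\<dots> = (\<integral>\<^sup>+x. ennreal (h x) \<partial>M)"
    by (simp add: \<mu>_def emeasure_distr emeasure_density)
  also have "\<dots> < \<infinity>" using h by (simp add: integrable_iff_bounded)
  finally have fin: "(\<integral>\<^sup>+t. f t \<partial>\<nu>) < \<infinity>" .
  define k where "k t = enn2real (f t)" for t
  have km[measurable]: "k \<in> borel_measurable borel" unfolding k_def[abs_def] by measurable
  have "AE t in \<nu>. f t \<noteq> \<infinity>" using f(1) fin by (intro nn_integral_PInf_AE) auto
  then have kf: "AE t in \<nu>. f t = ennreal (k t)"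
    by eventually_elim (simp add: k_def ennreal_enn2real less_top)
  have "density \<nu> f = density \<nu> (\<lambda>t. ennreal (k t))"
    using kf f(1) by (intro density_cong) (auto simp: \<nu>_def)
  then have dk: "\<mu> = density \<nu> (\<lambda>t. ennreal (k t))" using f(2) by simp
  show thesis
  proof
    show "k \<in> borel_measurable borel" by (rule km)
    have "integrable \<nu> k"
    proof (rule integrableI_nonneg)
      have "(\<integral>\<^sup>+t. ennreal (k t) \<partial>\<nu>) = (\<integral>\<^sup>+t. f t \<partial>\<nu>)"
        using kf by (intro nn_integral_cong_AE) auto
      then show "(\<integral>\<^sup>+t. ennreal (k t) \<partial>\<nu>) < \<infinity>" using fin by simp
    qed (auto simp: k_def[abs_def] \<nu>_def)
    then show "integrable M (\<lambda>x. k (T x))"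
      unfolding \<nu>_def by (subst (asm) integrable_distr_eq) auto
    fix \<zeta> :: "real \<Rightarrow> real" assume [measurable]: "\<zeta> \<in> borel_measurable borel"
    have "(\<integral>x. h x * \<zeta> (T x) \<partial>M) = (\<integral>x. \<zeta> (T x) \<partial>density M (\<lambda>x. ennreal (h x)))"
      using h by (subst integral_density) auto
    also have "\<dots> = (\<integral>t. \<zeta> t \<partial>\<mu>)" unfolding \<mu>_def by (subst integral_distr) auto
    also have "\<dots> = (\<integral>t. k t * \<zeta> t \<partial>\<nu>)"
      unfolding dk by (subst integral_density) (auto simp: k_def \<nu>_def)
    also have "\<dots> = (\<integral>x. k (T x) * \<zeta> (T x) \<partial>M)" unfolding \<nu>_def by (subst integral_distr) auto
    finally show "(\<integral>x. h x * \<zeta> (T x) \<partial>M) = (\<integral>x. k (T x) * \<zeta> (T x) \<partial>M)" .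
  qed
qed

lemma integrable_bounded_mult:
  fixes f g :: "'a \<Rightarrow> real"
  assumes f: "integrable M f" and g: "g \<in> borel_measurable M" and b: "\<And>x. x \<in> space M \<Longrightarrow> \<bar>g x\<bar> \<le> C"
  shows "integrable M (\<lambda>x. f x * g x)"
proof (rule Bochner_Integration.integrable_bound)
  show "integrable M (\<lambda>x. C * f x)" using f by simp
  show "AE x in M. norm (f x * g x) \<le> norm (C * f x)"
  proof (rule AE_I2)
    fix x assume "x \<in> space M"
    then have "\<bar>g x\<bar> \<le> \<bar>C\<bar>" using b[of x] by linarith
    then show "norm (f x * g x) \<le> norm (C * f x)"
      using mult_left_mono[of "\<bar>g x\<bar>" "\<bar>C\<bar>" "\<bar>f x\<bar>"] by (simp add: abs_mult mult.commute)
  qed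
qed (use f g in auto)

text \<open>The nonnegative case is applied to the positive and the negative part of h. Bounded
  \<zeta> keep all the products integrable, so that the two identities can be subtracted.\<close>

lemma conditional_factor:
  fixes h :: "'a \<Rightarrow> real"
  assumes M: "finite_measure M" and T[measurable]: "T \<in> borel_measurable M" and h: "integrable M h"
  obtains k :: "real \<Rightarrow> real" where "k \<in> borel_measurable borel" "integrable M (\<lambda>x. k (T x))"
    "\<And>\<zeta> C. \<zeta> \<in> borel_measurable borel \<Longrightarrow> (\<And>t. \<bar>\<zeta> t\<bar> \<le> C) \<Longrightarrow>
      (\<integral>x. h x * \<zeta> (T x) \<partial>M) = (\<integral>x. k (T x) * \<zeta> (T x) \<partial>M)"
proof -
  let ?p = "\<lambda>x. max 0 (h x)" and ?n = "\<lambda>x. max 0 (- h x)"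
  have pn: "integrable M ?p" "integrable M ?n" using h by auto
  obtain k1 :: "real \<Rightarrow> real" where k1: "k1 \<in> borel_measurable borel" "integrable M (\<lambda>x. k1 (T x))"
    "\<And>\<zeta> :: real \<Rightarrow> real. \<zeta> \<in> borel_measurable borel \<Longrightarrow>
      (\<integral>x. ?p x * \<zeta> (T x) \<partial>M) = (\<integral>x. k1 (T x) * \<zeta> (T x) \<partial>M)"
    by (rule nonneg_conditional_factor[OF M T pn(1)]) auto
  obtain k2 :: "real \<Rightarrow> real" where k2: "k2 \<in> borel_measurable borel" "integrable M (\<lambda>x. k2 (T x))"
    "\<And>\<zeta> :: real \<Rightarrow> real. \<zeta> \<in> borel_measurable borel \<Longrightarrow>
      (\<integral>x. ?n x * \<zeta> (T x) \<partial>M) = (\<integral>x. k2 (T x) * \<zeta> (T x) \<partial>M)"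
    by (rule nonneg_conditional_factor[OF M T pn(2)]) auto
  show thesis
  proof (rule that[of "\<lambda>t. k1 t - k2 t"])
    fix \<zeta> :: "real \<Rightarrow> real" and C assume z[measurable]: "\<zeta> \<in> borel_measurable borel" and b: "\<And>t. \<bar>\<zeta> t\<bar> \<le> C"
    have zT: "(\<lambda>x. \<zeta> (T x)) \<in> borel_measurable M" by measurable
    have i: "integrable M (\<lambda>x. f x * \<zeta> (T x))" if "integrable M f" for f
      using that zT b by (rule integrable_bounded_mult)
    have "h x * \<zeta> (T x) = ?p x * \<zeta> (T x) - ?n x * \<zeta> (T x)" for x
      by (simp add: left_diff_distrib[symmetric] max_def)
    then have "(\<integral>x. h x * \<zeta> (T x) \<partial>M) = (\<integral>x. ?p x * \<zeta> (T x) \<partial>M) - (\<integral>x. ?n x * \<zeta> (T x) \<partial>M)"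
      using i[OF pn(1)] i[OF pn(2)] by simp
    also have "\<dots> = (\<integral>x. k1 (T x) * \<zeta> (T x) \<partial>M) - (\<integral>x. k2 (T x) * \<zeta> (T x) \<partial>M)"
      by (simp only: k1(3)[OF z] k2(3)[OF z])
    also have "\<dots> = (\<integral>x. (k1 (T x) - k2 (T x)) * \<zeta> (T x) \<partial>M)"
      using i[OF k1(2)] i[OF k2(2)] by (simp add: left_diff_distrib)
    finally show "(\<integral>x. h x * \<zeta> (T x) \<partial>M) = (\<integral>x. (k1 (T x) - k2 (T x)) * \<zeta> (T x) \<partial>M)" .
  qed (use k1 k2 in auto)
qed

text \<open>A measurable function is an a.e. limit of continuous ones, but without a dominating
  function. Truncating both at height m supplies one; the error of truncating k is made small first,
  then n is chosen.\<close>

lemma L1_approx_continuous: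
  fixes k :: "real \<Rightarrow> real"
  assumes k: "set_integrable lborel {a..b} k" and e: "0 < e"
  obtains f where "continuous_on UNIV f" "(LINT t:{a..b}|lborel. \<bar>k t - f t\<bar>) < e"
proof -
  define h where "h t = indicator {a..b} t * k t" for t
  have h: "integrable lborel h" using k by (simp add: set_integrable_def h_def[abs_def])
  have hm[measurable]: "h \<in> borel_measurable borel" using h by auto
  have "h measurable_on UNIV"
    by (intro lebesgue_measurable_imp_measurable_on) (auto intro: measurable_completion)
  then obtain Z g where Z: "negligible Z" and g: "\<And>n. continuous_on UNIV (g n)"
    and lim: "\<And>t. t \<notin> Z \<Longrightarrow> (\<lambda>n. g n t) \<longlonglongrightarrow> h t"
    unfolding measurable_on_def by auto
  have "AE t in lebesgue. t \<notin> Z" using Z by (simp add: negligible_iff_null_sets AE_not_in)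
  then have aeZ: "AE t in lborel. t \<notin> Z" by (simp add: AE_completion_iff)
  \<comment> \<open>Truncation at height m is continuous, so it preserves continuity of the
    approximants as well as convergence.\<close>
  define clip where "clip m t = max (- real m) (min (real m) t)" for m t
  have clip_m[measurable]: "clip m \<in> borel_measurable borel" for m unfolding clip_def[abs_def] by measurable
  have clip_c: "continuous_on UNIV (clip m)" for m
    unfolding clip_def[abs_def] by (intro continuous_intros)
  have clip_b: "\<bar>clip m t\<bar> \<le> m" for m t by (auto simp: clip_def)
  have I: "integrable lborel (indicator {a..b} :: real \<Rightarrow> real)"
    by (rule integrable_real_indicator) (auto simp: emeasure_lborel_Icc_eq)
  have lim1: "(\<lambda>m. \<integral>t. indicator {a..b} t * \<bar>h t - clip m (h t)\<bar> \<partial>lborel) \<longlonglongrightarrow> (\<integral>t. 0 \<partial>(lborel :: real measure))"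
  proof (rule integral_dominated_convergence[where w = "\<lambda>t. norm (h t)"])
    show "AE t in lborel. (\<lambda>m. indicator {a..b} t * \<bar>h t - clip m (h t)\<bar>) \<longlonglongrightarrow> 0"
    proof (rule AE_I2)
      fix t
      have "\<forall>\<^sub>F m in sequentially. \<bar>h t\<bar> \<le> real m"
        using eventually_ge_at_top[of "nat \<lceil>\<bar>h t\<bar>\<rceil>"] by eventually_elim linarith
      then have "\<forall>\<^sub>F m in sequentially. indicator {a..b} t * \<bar>h t - clip m (h t)\<bar> = 0"
        by eventually_elim (auto simp: clip_def)
      then show "(\<lambda>m. indicator {a..b} t * \<bar>h t - clip m (h t)\<bar>) \<longlonglongrightarrow> 0" by (rule tendsto_eventually)
    qed
    show "AE t in lborel. norm (indicator {a..b} t * \<bar>h t - clip m (h t)\<bar>) \<le> norm (h t)" for m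
      by (rule AE_I2) (auto simp: clip_def indicator_def)
  qed (use h in auto)
  then obtain m where m: "(\<integral>t. indicator {a..b} t * \<bar>h t - clip m (h t)\<bar> \<partial>lborel) < e / 2"
    using order_tendstoD(2)[OF lim1, of "e / 2"] e by (auto simp: eventually_sequentially)
  have lim2: "(\<lambda>n. \<integral>t. indicator {a..b} t * \<bar>clip m (h t) - clip m (g n t)\<bar> \<partial>lborel) \<longlonglongrightarrow> (\<integral>t. 0 \<partial>(lborel :: real measure))"
  proof (rule integral_dominated_convergence[where w = "\<lambda>t. 2 * real m * indicator {a..b} t"])
    show "AE t in lborel. (\<lambda>n. indicator {a..b} t * \<bar>clip m (h t) - clip m (g n t)\<bar>) \<longlonglongrightarrow> 0"
      using aeZ
    proof eventually_elim
      fix t assume "t \<notin> Z"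
      have "(\<lambda>n. indicator {a..b} t * \<bar>clip m (h t) - clip m (g n t)\<bar>)
          \<longlonglongrightarrow> indicator {a..b} t * \<bar>clip m (h t) - clip m (h t)\<bar>"
        unfolding clip_def by (intro tendsto_intros lim \<open>t \<notin> Z\<close>)
      then show "(\<lambda>n. indicator {a..b} t * \<bar>clip m (h t) - clip m (g n t)\<bar>) \<longlonglongrightarrow> 0" by simp
    qed
    have gm: "g n \<in> borel_measurable borel" for n using g by (rule borel_measurable_continuous_onI)
    show "(\<lambda>t. indicator {a..b} t * \<bar>clip m (h t) - clip m (g n t)\<bar>) \<in> borel_measurable lborel" for n
      using gm[of n] by measurable
    show "AE t in lborel. norm (indicator {a..b} t * \<bar>clip m (h t) - clip m (g n t)\<bar>)
        \<le> 2 * real m * indicator {a..b} t" for n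
    proof (rule AE_I2)
      fix t
      have "\<bar>clip m (h t) - clip m (g n t)\<bar> \<le> 2 * real m"
        using clip_b[of m "h t"] clip_b[of m "g n t"] by linarith
      then show "norm (indicator {a..b} t * \<bar>clip m (h t) - clip m (g n t)\<bar>) \<le> 2 * real m * indicator {a..b} t"
        by (auto simp: indicator_def)
    qed
  qed (use I in auto)
  then obtain n where n: "(\<integral>t. indicator {a..b} t * \<bar>clip m (h t) - clip m (g n t)\<bar> \<partial>lborel) < e / 2"
    using order_tendstoD(2)[OF lim2, of "e / 2"] e by (auto simp: eventually_sequentially)
  define f where "f t = clip m (g n t)" for t
  have fc: "continuous_on UNIV f"
    unfolding f_def[abs_def] by (rule continuous_on_compose2[OF clip_c g]) auto
  then have [measurable]: "f \<in> borel_measurable borel" by (rule borel_measurable_continuous_onI)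
  have fb: "\<bar>f t\<bar> \<le> m" for t by (simp add: f_def clip_b)
  have i1: "integrable lborel (\<lambda>t. indicator {a..b} t * \<bar>h t - clip m (h t)\<bar>)"
    by (rule Bochner_Integration.integrable_bound[OF h]) (auto simp: clip_def indicator_def)
  have i2: "integrable lborel (\<lambda>t. indicator {a..b} t * \<bar>clip m (h t) - f t\<bar>)"
  proof (rule integrable_bounded_mult[OF I])
    show "\<bar>\<bar>clip m (h t) - f t\<bar>\<bar> \<le> 2 * real m" for t
      using clip_b[of m "h t"] fb[of t] by linarith
  qed measurable
  have "(LINT t:{a..b}|lborel. \<bar>k t - f t\<bar>) = (\<integral>t. indicator {a..b} t * \<bar>h t - f t\<bar> \<partial>lborel)"
    unfolding set_lebesgue_integral_def
    by (intro Bochner_Integration.integral_cong) (auto simp: h_def indicator_def)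
  also have "\<dots> \<le> (\<integral>t. indicator {a..b} t * \<bar>h t - clip m (h t)\<bar> + indicator {a..b} t * \<bar>clip m (h t) - f t\<bar> \<partial>lborel)"
  proof (rule integral_mono_AE')
    show "AE t in lborel. indicator {a..b} t * \<bar>h t - f t\<bar>
        \<le> indicator {a..b} t * \<bar>h t - clip m (h t)\<bar> + indicator {a..b} t * \<bar>clip m (h t) - f t\<bar>"
      by (rule AE_I2) (auto simp: indicator_def)
  qed (use i1 i2 in auto)
  also have "\<dots> < e" using m n i1 i2 by (simp add: f_def)
  finally show thesis using fc by (rule that[rotated])
qed

section \<open>Gradients in $W_0^{1,p}$\<close>

lemma finite_measure_ball: "finite_measure (lebesgue_on (ball (0::'a::euclidean_space) R))"
  using emeasure_lborel_ball_finite[of "0::'a" R]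
  by (intro finite_measureI) (auto simp: space_restrict_space emeasure_restrict_space)

lemma integrable_ball_continuous:
  fixes f :: "'a::euclidean_space \<Rightarrow> 'b::{banach, second_countable_topology}"
  assumes f: "continuous_on UNIV f"
  shows "integrable (lebesgue_on (ball 0 R)) f"
proof -
  interpret finite_measure "lebesgue_on (ball (0::'a) R)" by (rule finite_measure_ball)
  have "bounded (f ` cball 0 R)"
    by (intro compact_imp_bounded compact_continuous_image continuous_on_subset[OF f]) auto
  then obtain C where "\<forall>y\<in>f ` cball 0 R. norm y \<le> C" unfolding bounded_iff by blast
  then show ?thesis
    using f by (intro integrable_const_bound[where B = C])
      (auto simp: space_restrict_space intro!: measurable_restrict_space1 measurable_completion borel_measurable_continuous_onI)
qed

lemma continuous_bounded_on_ball:
  fixes f :: "'a::euclidean_space \<Rightarrow> real"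
  assumes "continuous_on UNIV f"
  shows "\<exists>C. \<forall>x\<in>space (lebesgue_on (ball 0 R)). \<bar>f x\<bar> \<le> C"
proof -
  have "bounded (f ` cball 0 R)"
    by (intro compact_imp_bounded compact_continuous_image continuous_on_subset[OF assms]) auto
  then show ?thesis unfolding bounded_iff by (force simp: space_restrict_space)
qed

lemma integrable_mult_continuous_ball:
  fixes f h :: "'a::euclidean_space \<Rightarrow> real"
  assumes "integrable (lebesgue_on (ball 0 R)) h" "continuous_on UNIV f"
  shows "integrable (lebesgue_on (ball 0 R)) (\<lambda>x. h x * f x)"
  using continuous_bounded_on_ball[OF assms(2)]
    integrable_bounded_mult[OF assms(1) borel_measurable_integrable[OF integrable_ball_continuous[OF assms(2)]]]
  by blast

text \<open>On a finite measure space t <= e + e^(1-p) t^p splits the L^1 distance into a small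
  constant part and a multiple of the L^p integral.\<close>

lemma Lp_tendsto_imp_L1:
  fixes f :: "nat \<Rightarrow> 'a::euclidean_space \<Rightarrow> 'b::euclidean_space"
  assumes p: "1 \<le> p" and lim: "Lp_tendsto p (ball 0 R) f g"
    and fm: "\<And>n. f n \<in> borel_measurable (lebesgue_on (ball 0 R))"
    and gm: "g \<in> borel_measurable (lebesgue_on (ball 0 R))"
  shows "(\<lambda>n. \<integral>\<^sup>+x. ennreal (norm (f n x - g x)) \<partial>lebesgue_on (ball 0 R)) \<longlonglongrightarrow> 0"
proof (rule order_tendstoI)
  let ?M = "lebesgue_on (ball (0::'a) R)"
  interpret finite_measure ?M by (rule finite_measure_ball)
  fix y :: ennreal assume "0 < y"
  then obtain z where z: "0 < z" "z < y" using dense by blast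
  then obtain c where c: "z = ennreal c" "0 < c" by (cases z) (auto simp: top.not_eq_extremum)
  define m where "m = measure ?M (space ?M)"
  have m: "0 \<le> m" "emeasure ?M (space ?M) = ennreal m"
    by (simp_all add: m_def emeasure_eq_measure)
  \<comment> \<open>Chosen so that the constant part contributes at most c/2; the 1 in the
    denominator guards against m = 0. The L^p part gives the other c/2.\<close>
  define e where "e = c / (2 * (m + 1))"
  have e: "0 < e" "e * m \<le> c / 2" using c m by (auto simp: e_def field_simps)
  have "0 < ennreal (c / 2 * e powr (p - 1))" using c e by simp
  from order_tendstoD(2)[OF lim[unfolded Lp_tendsto_def] this]
  show "\<forall>\<^sub>F n in sequentially. (\<integral>\<^sup>+x. ennreal (norm (f n x - g x)) \<partial>?M) < y"
  proof eventually_elim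
    fix n assume n: "(\<integral>\<^sup>+x. ennreal (norm (f n x - g x) powr p) \<partial>?M) < ennreal (c / 2 * e powr (p - 1))"
    have young: "t \<le> e + e powr (1 - p) * t powr p" if "0 \<le> t" for t
    proof (cases "t \<le> e")
      case False
      then have "t powr (1 - p) * t powr p \<le> e powr (1 - p) * t powr p"
        using e p by (intro mult_right_mono powr_mono2') auto
      moreover have "t powr (1 - p) * t powr p = t"
        using False e by (simp add: powr_add[symmetric])
      ultimately show ?thesis using e by simp
    qed (use e in \<open>auto intro: add_increasing2\<close>)
    have meas: "(\<lambda>x. norm (f n x - g x)) \<in> borel_measurable ?M" using fm[of n] gm by measurable
    have "(\<integral>\<^sup>+x. ennreal (norm (f n x - g x)) \<partial>?M)
      \<le> (\<integral>\<^sup>+x. ennreal e + ennreal (e powr (1 - p)) * ennreal (norm (f n x - g x) powr p) \<partial>?M)"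
      using e young by (intro nn_integral_mono) (simp add: ennreal_mult[symmetric] ennreal_plus[symmetric] del: ennreal_plus)
    also have "\<dots> = ennreal e * ennreal m + ennreal (e powr (1 - p)) * (\<integral>\<^sup>+x. ennreal (norm (f n x - g x) powr p) \<partial>?M)"
      using meas m by (subst nn_integral_add) (auto simp: nn_integral_cmult)
    also have "\<dots> \<le> ennreal (c / 2) + ennreal (e powr (1 - p)) * ennreal (c / 2 * e powr (p - 1))"
      using n e m by (intro add_mono mult_left_mono) (auto simp: ennreal_mult[symmetric] intro: ennreal_leI)
    also have "\<dots> = ennreal c"
    proof -
      have "e powr (1 - p) * (c / 2 * e powr (p - 1)) = c / 2 * (e powr (1 - p) * e powr (p - 1))"
        by (simp only: mult_ac)
      also have "\<dots> = c / 2" using e powr_add[of e "1 - p" "p - 1"] by simp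
      finally have "ennreal (e powr (1 - p)) * ennreal (c / 2 * e powr (p - 1)) = ennreal (c / 2)"
        using c by (subst ennreal_mult[symmetric]) (auto simp del: times_divide_eq_left)
      then show ?thesis using c by (simp add: ennreal_plus[symmetric] del: ennreal_plus)
    qed
    finally show "(\<integral>\<^sup>+x. ennreal (norm (f n x - g x)) \<partial>?M) < y" using z c by simp
  qed
qed simp

lemma integrable_of_L1_limit:
  fixes f :: "nat \<Rightarrow> 'a \<Rightarrow> 'b::euclidean_space"
  assumes lim: "(\<lambda>n. \<integral>\<^sup>+x. ennreal (norm (f n x - g x)) \<partial>M) \<longlonglongrightarrow> 0"
    and f: "\<And>n. integrable M (f n)" and g: "g \<in> borel_measurable M"
  shows "integrable M g"
proof -
  have "\<forall>\<^sub>F n in sequentially. (\<integral>\<^sup>+x. ennreal (norm (f n x - g x)) \<partial>M) < 1"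
    using order_tendstoD(2)[OF lim, of 1] by simp
  then obtain n where n: "(\<integral>\<^sup>+x. ennreal (norm (f n x - g x)) \<partial>M) < 1"
    by (meson eventually_sequentially order_refl)
  have "integrable M (\<lambda>x. f n x - g x)"
    using f[of n] g n by (intro integrableI_bounded) (auto intro: less_trans[OF _ ennreal_one_less_top])
  from Bochner_Integration.integrable_diff[OF f[of n] this] show ?thesis by simp
qed

lemma L1_tendsto_integral_mult:
  fixes f :: "nat \<Rightarrow> 'a \<Rightarrow> real"
  assumes lim: "(\<lambda>n. \<integral>\<^sup>+x. ennreal \<bar>f n x - g x\<bar> \<partial>M) \<longlonglongrightarrow> 0"
    and f: "\<And>n. integrable M (f n)" and g: "integrable M g"
    and \<psi>: "\<psi> \<in> borel_measurable M" "\<And>x. x \<in> space M \<Longrightarrow> \<bar>\<psi> x\<bar> \<le> C"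
  shows "(\<lambda>n. \<integral>x. f n x * \<psi> x \<partial>M) \<longlonglongrightarrow> (\<integral>x. g x * \<psi> x \<partial>M)"
proof -
  have int: "integrable M (\<lambda>x. h x * \<psi> x)" if "integrable M h" for h
    using that \<psi> by (rule integrable_bounded_mult)
  have d: "integrable M (\<lambda>x. \<bar>f n x - g x\<bar>)" for n using f g by auto
  have "(\<lambda>n. ennreal (\<integral>x. \<bar>f n x - g x\<bar> \<partial>M)) \<longlonglongrightarrow> ennreal 0"
    using lim nn_integral_eq_integral[OF d] by simp
  then have "(\<lambda>n. \<integral>x. \<bar>f n x - g x\<bar> \<partial>M) \<longlonglongrightarrow> 0"
    by (subst (asm) tendsto_ennreal_iff) auto
  then have lim0: "(\<lambda>n. \<bar>C\<bar> * (\<integral>x. \<bar>f n x - g x\<bar> \<partial>M)) \<longlonglongrightarrow> 0"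
    using tendsto_mult_right_zero by blast
  have "norm ((\<integral>x. f n x * \<psi> x \<partial>M) - (\<integral>x. g x * \<psi> x \<partial>M)) \<le> \<bar>C\<bar> * (\<integral>x. \<bar>f n x - g x\<bar> \<partial>M)" for n
  proof -
    have "(\<integral>x. f n x * \<psi> x \<partial>M) - (\<integral>x. g x * \<psi> x \<partial>M) = (\<integral>x. (f n x - g x) * \<psi> x \<partial>M)"
      using int[OF f] int[OF g] by (simp add: left_diff_distrib)
    also have "norm \<dots> \<le> (\<integral>x. norm ((f n x - g x) * \<psi> x) \<partial>M)" by (rule integral_norm_bound)
    also have "\<dots> \<le> (\<integral>x. \<bar>C\<bar> * \<bar>f n x - g x\<bar> \<partial>M)"
    proof (rule integral_mono)
      show "integrable M (\<lambda>x. norm ((f n x - g x) * \<psi> x))"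
        using int[of "\<lambda>x. f n x - g x"] f g by auto
      show "integrable M (\<lambda>x. \<bar>C\<bar> * \<bar>f n x - g x\<bar>)" using d by auto
      fix x assume "x \<in> space M"
      then have "\<bar>\<psi> x\<bar> \<le> \<bar>C\<bar>" using \<psi>(2)[of x] by linarith
      then show "norm ((f n x - g x) * \<psi> x) \<le> \<bar>C\<bar> * \<bar>f n x - g x\<bar>"
        using mult_left_mono[of "\<bar>\<psi> x\<bar>" "\<bar>C\<bar>" "\<bar>f n x - g x\<bar>"] by (simp add: abs_mult mult.commute)
    qed
    finally show ?thesis by simp
  qed
  then have "\<forall>\<^sub>F n in sequentially. norm ((\<integral>x. f n x * \<psi> x \<partial>M) - (\<integral>x. g x * \<psi> x \<partial>M))
      \<le> \<bar>C\<bar> * (\<integral>x. \<bar>f n x - g x\<bar> \<partial>M)"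
    by (intro always_eventually allI)
  from LIM_zero_cancel[OF Lim_null_comparison[OF this lim0]] show ?thesis .
qed

lemma grad_inner: "i \<in> Basis \<Longrightarrow> grad \<phi> x \<bullet> i = frechet_derivative \<phi> (at x) i"
  unfolding grad_def by (simp add: inner_sum_left inner_Basis if_distrib cong: if_cong)

lemma continuous_on_grad: "C_k (Suc 0) \<phi> \<Longrightarrow> continuous_on UNIV (grad \<phi>)"
proof -
  assume "C_k (Suc 0) \<phi>"
  then have "continuous_on UNIV (\<lambda>x. frechet_derivative \<phi> (at x) i)" if "i \<in> Basis" for i
    using that by simp
  then have "continuous_on UNIV (\<lambda>x. \<Sum>i\<in>Basis. frechet_derivative \<phi> (at x) i *\<^sub>R i)"
    by (rule continuous_on_sum[OF continuous_on_scaleR[OF _ continuous_on_const]])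
  then show ?thesis by (simp add: grad_def[abs_def])
qed

lemma test_function_eq_0: "test_function B \<phi> \<Longrightarrow> x \<notin> B \<Longrightarrow> \<phi> x = 0"
  using closure_subset[of "{x. \<phi> x \<noteq> 0}"] by (auto simp: test_function_def simp del: C_k.simps)

lemma test_function_deriv_eq_0:
  assumes "test_function B \<phi>" "x \<notin> B"
  shows "frechet_derivative \<phi> (at x) = (\<lambda>h. 0)"
proof -
  have "x \<notin> closure {x. \<phi> x \<noteq> 0}" using assms by (auto simp: test_function_def)
  then have "\<forall>\<^sub>F y in nhds x. y \<in> - closure {x. \<phi> x \<noteq> 0}"
    by (intro eventually_nhds_in_open) auto
  then have "\<forall>\<^sub>F y in nhds x. 0 = \<phi> y"
    by eventually_elim (use closure_subset[of "{x. \<phi> x \<noteq> 0}"] in auto)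
  then have "\<forall>\<^sub>F y in at x. 0 = \<phi> y" by (simp add: eventually_at_filter eventually_mono)
  moreover have "0 = \<phi> x" using test_function_eq_0[OF assms] by simp
  moreover have "((\<lambda>y. 0) has_derivative (\<lambda>h. 0)) (at x)" by simp
  ultimately have "(\<phi> has_derivative (\<lambda>h. 0)) (at x)"
    using has_derivative_transform_eventually[of "\<lambda>y. 0" "\<lambda>h. 0" x UNIV \<phi>] by simp
  from frechet_derivative_at[OF this] show ?thesis by simp
qed

lemma integral_ball_lborel:
  fixes F :: "'a::euclidean_space \<Rightarrow> real"
  assumes "continuous_on UNIV F" "\<And>x. x \<notin> ball 0 R \<Longrightarrow> F x = 0"
  shows "(\<integral>x. F x \<partial>lebesgue_on (ball 0 R)) = (\<integral>x. F x \<partial>lborel)"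
proof -
  have "(\<integral>x. F x \<partial>lebesgue_on (ball 0 R)) = (\<integral>x. indicator (ball 0 R) x *\<^sub>R F x \<partial>lebesgue)"
    by (subst integral_restrict_space) (auto simp: set_lebesgue_integral_def)
  also have "(\<lambda>x. indicator (ball 0 R) x *\<^sub>R F x) = F"
    using assms(2) by (auto simp: indicator_def fun_eq_iff)
  also have "(\<integral>x. F x \<partial>lebesgue) = (\<integral>x. F x \<partial>lborel)"
    using assms(1) by (intro integral_completion) (simp add: borel_measurable_continuous_onI)
  finally show ?thesis .
qed

text \<open>Fixes one approximating sequence for u and g together. Its L^1 convergence is all that
  linear identities against bounded functions need; the L^p statement for the gradients is kept for
  the energy.\<close>

lemma W0_gradient_integrable:
  fixes u :: "'a::euclidean_space \<Rightarrow> real"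
  assumes p: "1 \<le> p" and W: "W0_gradient p (ball 0 R) u g"
  obtains \<phi> where "\<forall>n. test_function (ball 0 R) (\<phi> n)"
    "integrable (lebesgue_on (ball 0 R)) u" "integrable (lebesgue_on (ball 0 R)) g"
    "(\<lambda>n. \<integral>\<^sup>+x. ennreal (norm (\<phi> n x - u x)) \<partial>lebesgue_on (ball 0 R)) \<longlonglongrightarrow> 0"
    "(\<lambda>n. \<integral>\<^sup>+x. ennreal (norm (grad (\<phi> n) x - g x)) \<partial>lebesgue_on (ball 0 R)) \<longlonglongrightarrow> 0"
    "Lp_tendsto p (ball 0 R) (\<lambda>n. grad (\<phi> n)) g"
proof -
  let ?M = "lebesgue_on (ball (0::'a) R)"
  obtain \<phi> where um: "u \<in> borel_measurable ?M" and gm: "g \<in> borel_measurable ?M"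
    and t: "\<And>n. test_function (ball 0 R) (\<phi> n)"
    and g: "Lp_tendsto p (ball 0 R) (\<lambda>n. grad (\<phi> n)) g" and u: "Lp_tendsto p (ball 0 R) \<phi> u"
    using W unfolding W0_gradient_def by blast
  have C: "C_k k (\<phi> n)" for k n using t[of n] by (simp add: test_function_def)
  have i: "integrable ?M (\<phi> n)" "integrable ?M (grad (\<phi> n))" for n
    using C[of 0 n] C[of "Suc 0" n] by (auto intro!: integrable_ball_continuous continuous_on_grad simp del: C_k.simps(2))
  have l: "(\<lambda>n. \<integral>\<^sup>+x. ennreal (norm (\<phi> n x - u x)) \<partial>?M) \<longlonglongrightarrow> 0"
    "(\<lambda>n. \<integral>\<^sup>+x. ennreal (norm (grad (\<phi> n) x - g x)) \<partial>?M) \<longlonglongrightarrow> 0"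
    using i by (intro Lp_tendsto_imp_L1[OF p] u g um gm borel_measurable_integrable; simp)+
  show thesis
    by (rule that[OF allI[OF t] integrable_of_L1_limit[OF l(1) i(1) um] integrable_of_L1_limit[OF l(2) i(2) gm] l g])
qed

lemma W0_gradient_integrableD:
  fixes u :: "'a::euclidean_space \<Rightarrow> real"
  assumes "1 \<le> p" "W0_gradient p (ball 0 R) u g"
  shows "integrable (lebesgue_on (ball 0 R)) u" "integrable (lebesgue_on (ball 0 R)) g"
  by (rule W0_gradient_integrable[OF assms], assumption)+

text \<open>The approximating test functions vanish outside the ball, so \<psi> may be arbitrary on
  the boundary. This is how membership in the space encodes the Dirichlet condition.\<close>

lemma W0_gradient_by_parts:
  fixes u :: "'a::euclidean_space \<Rightarrow> real"
  assumes p: "1 \<le> p" and W: "W0_gradient p (ball 0 R) u g"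
    and \<psi>: "C_k (Suc 0) \<psi>" and e: "e \<in> Basis"
  shows "(\<integral>x. u x * frechet_derivative \<psi> (at x) e \<partial>lebesgue_on (ball 0 R))
    = - (\<integral>x. (g x \<bullet> e) * \<psi> x \<partial>lebesgue_on (ball 0 R))"
proof -
  let ?M = "lebesgue_on (ball (0::'a) R)"
  obtain \<phi> where t0: "\<forall>n. test_function (ball 0 R) (\<phi> n)" and u: "integrable ?M u" and g: "integrable ?M g"
    and l: "(\<lambda>n. \<integral>\<^sup>+x. ennreal (norm (\<phi> n x - u x)) \<partial>?M) \<longlonglongrightarrow> 0"
      "(\<lambda>n. \<integral>\<^sup>+x. ennreal (norm (grad (\<phi> n) x - g x)) \<partial>?M) \<longlonglongrightarrow> 0"
    and "Lp_tendsto p (ball 0 R) (\<lambda>n. grad (\<phi> n)) g"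
    using W0_gradient_integrable[OF p W] .
  note t = t0[rule_format]
  have C: "C_k k (\<phi> n)" for k n using t[of n] by (simp add: test_function_def)
  have c\<psi>: "continuous_on UNIV \<psi>" "continuous_on UNIV (\<lambda>x. frechet_derivative \<psi> (at x) e)"
    using C_k_SucD[OF \<psi>] \<psi> e by auto
  have c\<phi>: "continuous_on UNIV (\<phi> n)" "continuous_on UNIV (\<lambda>x. frechet_derivative (\<phi> n) (at x) e)" for n
    using C[of 0 n] C[of "Suc 0" n] e by auto
  obtain B1 where B1: "\<And>x. x \<in> space ?M \<Longrightarrow> \<bar>\<psi> x\<bar> \<le> B1" using continuous_bounded_on_ball[OF c\<psi>(1)] by blast
  obtain B2 where B2: "\<And>x. x \<in> space ?M \<Longrightarrow> \<bar>frechet_derivative \<psi> (at x) e\<bar> \<le> B2"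
    using continuous_bounded_on_ball[OF c\<psi>(2)] by blast
  have meas: "f \<in> borel_measurable ?M" if "continuous_on UNIV f" for f :: "'a \<Rightarrow> real"
    using integrable_ball_continuous[OF that] by (rule borel_measurable_integrable)
  have lu: "(\<lambda>n. \<integral>x. \<phi> n x * frechet_derivative \<psi> (at x) e \<partial>?M) \<longlonglongrightarrow> (\<integral>x. u x * frechet_derivative \<psi> (at x) e \<partial>?M)"
    using l(1) by (intro L1_tendsto_integral_mult[OF _ integrable_ball_continuous[OF c\<phi>(1)] u meas[OF c\<psi>(2)] B2]) auto
  have lg: "(\<lambda>n. \<integral>x. (grad (\<phi> n) x \<bullet> e) * \<psi> x \<partial>?M) \<longlonglongrightarrow> (\<integral>x. (g x \<bullet> e) * \<psi> x \<partial>?M)"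
  proof (rule L1_tendsto_integral_mult[OF _ _ _ meas[OF c\<psi>(1)] B1])
    show "(\<lambda>n. \<integral>\<^sup>+x. ennreal \<bar>grad (\<phi> n) x \<bullet> e - g x \<bullet> e\<bar> \<partial>?M) \<longlonglongrightarrow> 0"
    proof (rule tendsto_sandwich[OF _ _ tendsto_const l(2)])
      show "\<forall>\<^sub>F n in sequentially. (\<integral>\<^sup>+x. ennreal \<bar>grad (\<phi> n) x \<bullet> e - g x \<bullet> e\<bar> \<partial>?M)
          \<le> (\<integral>\<^sup>+x. ennreal (norm (grad (\<phi> n) x - g x)) \<partial>?M)"
        using Basis_le_norm[OF e] by (intro always_eventually allI nn_integral_mono ennreal_leI)
          (simp add: inner_diff_left[symmetric])
    qed simp
    show "integrable ?M (\<lambda>x. grad (\<phi> n) x \<bullet> e)" for n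
      using integrable_ball_continuous[OF c\<phi>(2)] e by (simp add: grad_inner)
    show "integrable ?M (\<lambda>x. g x \<bullet> e)" using g by simp
  qed
  have "(\<integral>x. \<phi> n x * frechet_derivative \<psi> (at x) e \<partial>?M) = - (\<integral>x. (grad (\<phi> n) x \<bullet> e) * \<psi> x \<partial>?M)" for n
  proof -
    define D where "D x h = \<phi> n x * frechet_derivative \<psi> (at x) h + frechet_derivative (\<phi> n) (at x) h * \<psi> x" for x h
    have d: "((\<lambda>x. \<phi> n x * \<psi> x) has_derivative D x) (at x)" for x
      unfolding D_def[abs_def]
      by (intro has_derivative_mult C_k_Suc_has_derivative[OF C] C_k_Suc_has_derivative[OF \<psi>])
    have dc: "continuous_on UNIV (\<lambda>x. D x e)"
      unfolding D_def by (intro continuous_intros c\<phi> c\<psi>)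
    have "(\<integral>x. D x e \<partial>lborel) = 0"
    proof (rule has_integral_deriv_zero[OF d dc])
      fix x :: 'a assume "R \<le> norm x"
      then show "\<phi> n x * \<psi> x = 0" using test_function_eq_0[OF t[of n], of x] by simp
    qed
    then have "(\<integral>x. D x e \<partial>?M) = 0"
      using test_function_eq_0[OF t] test_function_deriv_eq_0[OF t]
      by (subst integral_ball_lborel[OF dc]) (auto simp: D_def)
    moreover have "integrable ?M (\<lambda>x. \<phi> n x * frechet_derivative \<psi> (at x) e)"
      "integrable ?M (\<lambda>x. frechet_derivative (\<phi> n) (at x) e * \<psi> x)"
      by (intro integrable_ball_continuous continuous_intros c\<phi> c\<psi>)+
    ultimately show ?thesis using e by (simp add: D_def grad_inner)
  qed
  then have "(\<lambda>n. - (\<integral>x. (grad (\<phi> n) x \<bullet> e) * \<psi> x \<partial>?M)) \<longlonglongrightarrow> (\<integral>x. u x * frechet_derivative \<psi> (at x) e \<partial>?M)"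
    using lu by simp
  from LIMSEQ_unique[OF this tendsto_minus[OF lg]] show ?thesis .
qed

text \<open>Some smooth gradient lies at finite L^p distance from g and has finite L^p norm itself;
  |b|^p <= 2^p (|a-b|^p + |a|^p) combines the two.\<close>

lemma W0_gradient_Lp:
  fixes u :: "'a::euclidean_space \<Rightarrow> real"
  assumes p: "1 \<le> p" and W: "W0_gradient p (ball 0 R) u g"
  shows "(\<integral>\<^sup>+x. ennreal (norm (g x) powr p) \<partial>lebesgue_on (ball 0 R)) < \<infinity>"
proof -
  let ?M = "lebesgue_on (ball (0::'a) R)"
  obtain \<phi> where t0: "\<forall>n. test_function (ball 0 R) (\<phi> n)" and "integrable ?M u" and g: "integrable ?M g"
    and "(\<lambda>n. \<integral>\<^sup>+x. ennreal (norm (\<phi> n x - u x)) \<partial>?M) \<longlonglongrightarrow> 0"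
    and "(\<lambda>n. \<integral>\<^sup>+x. ennreal (norm (grad (\<phi> n) x - g x)) \<partial>?M) \<longlonglongrightarrow> 0"
    and l: "Lp_tendsto p (ball 0 R) (\<lambda>n. grad (\<phi> n)) g"
    using W0_gradient_integrable[OF p W] .
  note t = t0[rule_format]
  have "\<forall>\<^sub>F n in sequentially. (\<integral>\<^sup>+x. ennreal (norm (grad (\<phi> n) x - g x) powr p) \<partial>?M) < 1"
    using order_tendstoD(2)[OF l[unfolded Lp_tendsto_def], of 1] by simp
  then obtain n where n: "(\<integral>\<^sup>+x. ennreal (norm (grad (\<phi> n) x - g x) powr p) \<partial>?M) < 1"
    by (meson eventually_sequentially order_refl)
  have "C_k (Suc 0) (\<phi> n)" using t[of n] by (simp add: test_function_def del: C_k.simps)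
  then have c: "continuous_on UNIV (grad (\<phi> n))" by (rule continuous_on_grad)
  have "continuous_on UNIV (\<lambda>x. norm (grad (\<phi> n) x) powr p)"
    using p by (intro continuous_on_powr' continuous_intros c) auto
  then have i: "integrable ?M (\<lambda>x. norm (grad (\<phi> n) x) powr p)" by (rule integrable_ball_continuous)
  have le: "norm b powr p \<le> 2 powr p * (norm (a - b) powr p + norm a powr p)" for a b :: 'a
  proof -
    have "norm b \<le> norm a + norm (a - b)" by (metis norm_triangle_sub norm_minus_commute add.commute)
    also have "\<dots> \<le> 2 * max (norm (a - b)) (norm a)" by simp
    finally have "norm b powr p \<le> (2 * max (norm (a - b)) (norm a)) powr p"
      using p by (intro powr_mono2) auto
    also have "\<dots> = 2 powr p * max (norm (a - b)) (norm a) powr p" by (simp add: powr_mult)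
    also have "\<dots> \<le> 2 powr p * (norm (a - b) powr p + norm a powr p)"
      by (intro mult_left_mono) (auto simp: max_def)
    finally show ?thesis .
  qed
  have gm: "g \<in> borel_measurable ?M" and pm: "grad (\<phi> n) \<in> borel_measurable ?M"
    using g integrable_ball_continuous[OF c] by auto
  have "(\<integral>\<^sup>+x. ennreal (norm (g x) powr p) \<partial>?M)
    \<le> (\<integral>\<^sup>+x. ennreal (2 powr p) * (ennreal (norm (grad (\<phi> n) x - g x) powr p) + ennreal (norm (grad (\<phi> n) x) powr p)) \<partial>?M)"
    using le by (intro nn_integral_mono)
      (simp add: ennreal_mult[symmetric] ennreal_plus[symmetric] del: ennreal_plus)
  also have "\<dots> = ennreal (2 powr p) * ((\<integral>\<^sup>+x. ennreal (norm (grad (\<phi> n) x - g x) powr p) \<partial>?M)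
      + (\<integral>\<^sup>+x. ennreal (norm (grad (\<phi> n) x) powr p) \<partial>?M))"
    using gm pm by (simp add: nn_integral_cmult nn_integral_add)
  also have "\<dots> < \<infinity>"
    using n i by (auto simp: ennreal_mult_less_top integrable_iff_bounded intro: less_trans[OF _ ennreal_one_less_top])
  finally show ?thesis .
qed

section \<open>Smooth radial functions and radial vector fields\<close>

lemma C_k_inner_self: "C_k k (\<lambda>x::'a::euclidean_space. x \<bullet> x)"
proof (cases k)
  case (Suc j)
  have "C_k (Suc j) (\<lambda>x::'a. x \<bullet> x)"
  proof (rule C_k_SucI)
    show "((\<lambda>x::'a. x \<bullet> x) has_derivative (\<lambda>h. 2 * (x \<bullet> h))) (at x)" for x
      by (auto intro!: derivative_eq_intros simp: inner_commute)
    show "C_k j (\<lambda>x::'a. 2 * (x \<bullet> i))" for i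
      by (intro C_k_bounded_linear bounded_linear_const_mult bounded_linear_inner_left)
  qed
  then show ?thesis using Suc by simp
qed (auto intro: continuous_intros)

lemma deriv_eq_0_on_open:
  fixes \<eta> :: "real \<Rightarrow> real"
  assumes "open S" "t \<in> S" "\<And>s. s \<in> S \<Longrightarrow> \<eta> s = 0"
  shows "deriv \<eta> t = 0"
proof -
  have "\<forall>\<^sub>F s in nhds t. 0 = \<eta> s"
    using eventually_nhds_in_open[OF assms(1,2)] assms(3) by (auto elim: eventually_mono)
  moreover have "((\<lambda>s. 0) has_real_derivative 0) (at t)" by simp
  ultimately have "(\<eta> has_real_derivative 0) (at t)"
    by (subst (asm) DERIV_cong_ev[OF refl _ refl]) auto
  then show ?thesis by (rule DERIV_imp_deriv)
qed

lemma deriv_eq_0_of_vanishing: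
  fixes \<eta> :: "real \<Rightarrow> real"
  assumes "\<And>t. t < a \<Longrightarrow> \<eta> t = 0" "t < a"
  shows "deriv \<eta> t = 0"
  using assms by (intro deriv_eq_0_on_open[of "{..<a}"]) auto

text \<open>The derivative consists of terms of the same shape, with \<eta> or its derivative and a
  shifted exponent. For t < a^2, including t <= 0, the function is locally 0, so the singularities
  of root and power are never met.\<close>

lemma has_derivative_sqrt_powr:
  fixes \<eta> :: "real \<Rightarrow> real"
  assumes d: "\<And>t. (\<eta> has_real_derivative deriv \<eta> t) (at t)" and a: "0 < a" "\<And>t. t < a \<Longrightarrow> \<eta> t = 0"
  shows "((\<lambda>t. \<eta> (sqrt t) * t powr s) has_real_derivative
    (1 / 2) * (deriv \<eta> (sqrt t) * t powr (s - 1 / 2)) + s * (\<eta> (sqrt t) * t powr (s - 1))) (at t)"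
proof (cases "t < a\<^sup>2")
  case True
  then have st: "sqrt x < a" if "x < a\<^sup>2" for x
    using that a(1) by (metis real_sqrt_less_iff real_sqrt_abs abs_of_pos)
  have "\<forall>\<^sub>F x in nhds t. 0 = \<eta> (sqrt x) * x powr s"
    using eventually_nhds_in_open[of "{..<a\<^sup>2}" t] True st a by (auto elim!: eventually_mono)
  moreover have "((\<lambda>x. 0) has_real_derivative
    (1 / 2) * (deriv \<eta> (sqrt t) * t powr (s - 1 / 2)) + s * (\<eta> (sqrt t) * t powr (s - 1))) (at t)"
    using st[OF True] a deriv_eq_0_of_vanishing[of a \<eta> "sqrt t"] by simp
  ultimately show ?thesis by (subst (asm) DERIV_cong_ev[OF refl _ refl]) auto
next
  case False
  then have t: "0 < t" using a(1) by (metis not_less order_less_le_trans zero_less_power)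
  have h: "t powr (s - 1 / 2) = t powr s / sqrt t"
    using t by (simp add: powr_diff powr_half_sqrt)
  have "((\<lambda>t. \<eta> (sqrt t)) has_real_derivative deriv \<eta> (sqrt t) * (inverse (sqrt t) / 2)) (at t)"
    using DERIV_chain2[OF d DERIV_real_sqrt[OF t]] .
  from DERIV_mult[OF this DERIV_fun_powr[OF DERIV_ident t, of s]]
  show ?thesis unfolding h by (simp add: field_simps)
qed

text \<open>Induction on k over all \<eta> and all exponents s at once, since the derivative stays
  in the same family.\<close>

lemma C_k_sqrt_powr:
  fixes \<eta> :: "real \<Rightarrow> real"
  assumes "\<And>j. C_k j \<eta>" "0 < a" "\<And>t. t < a \<Longrightarrow> \<eta> t = 0"
  shows "C_k k (\<lambda>t. \<eta> (sqrt t) * t powr s)"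
  using assms(1,3)
proof (induction k arbitrary: \<eta> s)
  case 0
  have "((\<lambda>t. \<eta> (sqrt t) * t powr s) has_real_derivative
    (1 / 2) * (deriv \<eta> (sqrt t) * t powr (s - 1 / 2)) + s * (\<eta> (sqrt t) * t powr (s - 1))) (at t)" for t
    by (rule has_derivative_sqrt_powr[OF C_k_real_deriv(1)[OF 0(1)] assms(2) 0(2)])
  then show ?case by (auto intro!: continuous_at_imp_continuous_on DERIV_isCont)
next
  case (Suc k)
  show ?case
  proof (rule C_k_real_SucI)
    show "((\<lambda>t. \<eta> (sqrt t) * t powr s) has_real_derivative
      (1 / 2) * (deriv \<eta> (sqrt t) * t powr (s - 1 / 2)) + s * (\<eta> (sqrt t) * t powr (s - 1))) (at t)" for t
      by (rule has_derivative_sqrt_powr[OF C_k_real_deriv(1)[OF Suc.prems(1)] assms(2) Suc.prems(2)])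
    show "C_k k (\<lambda>t. (1 / 2) * (deriv \<eta> (sqrt t) * t powr (s - 1 / 2)) + s * (\<eta> (sqrt t) * t powr (s - 1)))"
      using C_k_real_deriv(2)[OF Suc.prems(1)] deriv_eq_0_of_vanishing[of a \<eta>] Suc.prems
      by (intro C_k_add C_k_mult C_k_const Suc.IH) auto
  qed
qed

text \<open>The norm is not smooth at 0 but its square is, so the function is written as a smooth
  function of x \<bullet> x.\<close>

lemma C_k_radial:
  fixes \<eta> :: "real \<Rightarrow> real"
  assumes "\<And>j. C_k j \<eta>" "0 < a" "\<And>t. t < a \<Longrightarrow> \<eta> t = 0"
  shows "C_k k (\<lambda>x::'a::euclidean_space. \<eta> (norm x) * norm x powr s)"
proof -
  have "\<eta> (sqrt (x \<bullet> x)) * (x \<bullet> x) powr (s / 2) = \<eta> (norm x) * norm x powr s" for x :: 'a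
  proof (cases "x = 0")
    case False
    have "x \<bullet> x = norm x powr 2"
      by (simp add: power2_norm_eq_inner[symmetric] powr_numeral)
    then have "(x \<bullet> x) powr (s / 2) = norm x powr s" by (simp only: powr_powr) simp
    then show ?thesis by (simp add: norm_eq_sqrt_inner[symmetric])
  qed (use assms in simp)
  then have "(\<lambda>x::'a. \<eta> (sqrt (x \<bullet> x)) * (x \<bullet> x) powr (s / 2)) = (\<lambda>x. \<eta> (norm x) * norm x powr s)"
    by (rule ext)
  then show ?thesis
    using C_k_compose[OF C_k_sqrt_powr[OF assms, of k "s / 2"] C_k_inner_self[where 'a = 'a]]
    by (simp only:)
qed

lemma has_derivative_radial:
  fixes x :: "'a::euclidean_space"
  assumes "(\<eta> has_real_derivative d) (at (norm x))" "x \<noteq> 0"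
  shows "((\<lambda>x. \<eta> (norm x)) has_derivative (\<lambda>h. d * (x \<bullet> h) / norm x)) (at x)"
proof -
  have "((\<lambda>x. \<eta> (norm x)) has_derivative (\<lambda>h. d * (sgn x \<bullet> h))) (at x)"
    using has_derivative_compose[OF has_derivative_norm[OF assms(2)] assms(1)[unfolded has_field_derivative_def]]
    by (simp add: inner_commute)
  then show ?thesis by (simp add: sgn_div_norm divide_inverse mult_ac)
qed

text \<open>The field |x|^(-N) x is divergence free away from the origin, so only the derivative of
  \<eta> contributes.\<close>

lemma radial_field_divergence:
  fixes x :: "'a::euclidean_space"
  assumes d: "(\<eta> has_real_derivative d) (at (norm x))" and x: "x \<noteq> 0"
  shows "(\<Sum>e\<in>Basis. frechet_derivative (\<lambda>x. \<eta> (norm x) * norm x powr - real DIM('a) * (x \<bullet> e)) (at x) e)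
    = d * norm x powr (1 - real DIM('a))"
proof -
  define N where "N = real DIM('a)"
  have n: "0 < norm x" using x by simp
  have pw: "((\<lambda>r. r powr - N) has_real_derivative (- N * norm x powr (- N - 1))) (at (norm x))"
    using DERIV_fun_powr[OF DERIV_ident n, of "- N"] by simp
  define A where "A = d * norm x powr - N + \<eta> (norm x) * (- N * norm x powr (- N - 1))"
  have "((\<lambda>r. \<eta> r * r powr - N) has_real_derivative A) (at (norm x))"
    using DERIV_mult[OF d pw] by (simp add: A_def algebra_simps)
  from has_derivative_radial[OF this x]
  have "((\<lambda>x. \<eta> (norm x) * norm x powr - N) has_derivative (\<lambda>h. A * (x \<bullet> h) / norm x)) (at x)" .
  from has_derivative_mult[OF this, of "\<lambda>x. x \<bullet> e" "\<lambda>h. h \<bullet> e" for e]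
  have "((\<lambda>x. \<eta> (norm x) * norm x powr - N * (x \<bullet> e)) has_derivative
      (\<lambda>h. \<eta> (norm x) * norm x powr - N * (h \<bullet> e) + A * (x \<bullet> h) / norm x * (x \<bullet> e))) (at x)" for e
    by (simp add: has_derivative_inner_left)
  note D = frechet_derivative_at[OF this, symmetric]
  have "(\<Sum>e\<in>Basis. frechet_derivative (\<lambda>x. \<eta> (norm x) * norm x powr - N * (x \<bullet> e)) (at x) e)
    = (\<Sum>e\<in>Basis. \<eta> (norm x) * norm x powr - N + A / norm x * ((x \<bullet> e) * (x \<bullet> e)))"
    unfolding D by (intro sum.cong) auto
  also have "\<dots> = N * (\<eta> (norm x) * norm x powr - N) + A / norm x * (x \<bullet> x)"
  proof -
    have "(\<Sum>e\<in>Basis. (x \<bullet> e) * (x \<bullet> e)) = x \<bullet> x" by (rule euclidean_inner[symmetric])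
    then show ?thesis by (simp only: sum.distrib sum_distrib_left[symmetric] sum_constant N_def) simp
  qed
  also have "A / norm x * (x \<bullet> x) = A * norm x"
    using n by (simp add: power2_norm_eq_inner[symmetric] power2_eq_square)
  also have "A * norm x = d * norm x powr (1 - N) - N * (\<eta> (norm x) * norm x powr - N)"
    using n by (simp add: A_def powr_diff powr_minus divide_inverse algebra_simps)
  finally show ?thesis by (simp add: N_def)
qed

section \<open>Polar integration and the radial profile\<close>

lemma AE_ball_nonzero: "AE x in lebesgue_on (ball (0::'a::euclidean_space) R). x \<noteq> 0"
proof -
  have "AE x in lebesgue. x \<noteq> (0::'a)" by (intro AE_completion AE_lborel_singleton)
  then show ?thesis by (subst AE_restrict_space_iff) auto
qed

lemma norm_measurable_ball: "norm \<in> borel_measurable (lebesgue_on (ball (0::'a::euclidean_space) R))"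
  by (rule borel_measurable_integrable[OF integrable_ball_continuous]) (intro continuous_intros)

lemma sgn_measurable_ball: "sgn \<in> borel_measurable (lebesgue_on (ball (0::'a::euclidean_space) R))"
  unfolding sgn_div_norm[abs_def]
  using integrable_ball_continuous[OF continuous_on_id, of R] norm_measurable_ball[of R]
  by (intro borel_measurable_scaleR borel_measurable_inverse) (auto dest: borel_measurable_integrable)

lemma radial_integral:
  fixes F :: "real \<Rightarrow> real"
  assumes R: "0 < R" and F: "F \<in> borel_measurable borel"
  defines "c \<equiv> DIM('a::euclidean_space) * unit_ball_vol DIM('a)"
  defines "J \<equiv> \<lambda>r. indicator {0<..<R} r * (c * r powr (real DIM('a) - 1))"
  shows "(\<integral>x. F (norm x) \<partial>lebesgue_on (ball (0::'a) R)) = (\<integral>r. J r * F r \<partial>lborel)"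
    and "integrable (lebesgue_on (ball (0::'a) R)) (\<lambda>x. F (norm x)) \<longleftrightarrow> integrable lborel (\<lambda>r. J r * F r)"
    and "(\<And>r. 0 \<le> F r) \<Longrightarrow> (\<integral>\<^sup>+x. ennreal (F (norm x)) \<partial>lebesgue_on (ball (0::'a) R)) = (\<integral>\<^sup>+r. ennreal (J r * F r) \<partial>lborel)"
proof -
  have c: "0 < c" by (simp add: c_def)
  have J0: "0 \<le> J r" for r using c by (simp add: J_def)
  have Jm: "J \<in> borel_measurable lborel" unfolding J_def by measurable
  have "ennreal (c * r powr (real DIM('a) - 1)) * indicator {0<..<R} r = ennreal (J r)" for r
    by (simp add: J_def indicator_def)
  then have D: "distr (lebesgue_on (ball (0::'a) R)) borel norm = density lborel (\<lambda>r. ennreal (J r))"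
    unfolding distr_norm_ball[OF R] c_def by simp
  note nm = norm_measurable_ball[where 'a = 'a and R = R]
  show "(\<integral>x. F (norm x) \<partial>lebesgue_on (ball (0::'a) R)) = (\<integral>r. J r * F r \<partial>lborel)"
    using integral_distr[OF nm F] J0 Jm F unfolding D by (simp add: integral_density)
  show "integrable (lebesgue_on (ball (0::'a) R)) (\<lambda>x. F (norm x)) \<longleftrightarrow> integrable lborel (\<lambda>r. J r * F r)"
    using integrable_distr_eq[OF nm F] J0 Jm F unfolding D by (simp add: integrable_density)
  show "(\<integral>\<^sup>+x. ennreal (F (norm x)) \<partial>lebesgue_on (ball (0::'a) R)) = (\<integral>\<^sup>+r. ennreal (J r * F r) \<partial>lborel)"
    if "\<And>r. 0 \<le> F r"
    using nn_integral_distr[OF nm, of "\<lambda>r. ennreal (F r)"] J0 Jm F that unfolding D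
    by (simp add: nn_integral_density ennreal_mult)
qed

text \<open>
  Test with the vector field \<open>\<eta>(|x|) |x|^{-N} x\<close>, whose divergence is \<open>\<eta>'(|x|) |x|^{1-N}\<close>; the power
  of \<open>|x|\<close> cancels the density \<open>r^{N-1}\<close> of the radial measure.
\<close>

lemma radial_profile_weak:
  fixes u :: "'a::euclidean_space \<Rightarrow> real"
  assumes p: "1 \<le> p" and W: "W0_gradient p (ball 0 R) u g"
    and \<eta>: "\<And>j. C_k j \<eta>" and a: "0 < a" "\<And>t. t < a \<Longrightarrow> \<eta> t = 0"
  shows "(\<integral>x. u x * (deriv \<eta> (norm x) * norm x powr (1 - real DIM('a))) \<partial>lebesgue_on (ball 0 R))
    = - (\<integral>x. (g x \<bullet> sgn x) * (\<eta> (norm x) * norm x powr (1 - real DIM('a))) \<partial>lebesgue_on (ball 0 R))"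
proof -
  let ?M = "lebesgue_on (ball (0::'a) R)"
  note u = W0_gradient_integrableD(1)[OF p W] and g = W0_gradient_integrableD(2)[OF p W]
  \<comment> \<open>The components of the field; each is smooth on the whole space because \<eta>
    vanishes near 0, hence admissible in \<open>W0_gradient_by_parts\<close>.\<close>
  define \<psi> where "\<psi> e x = \<eta> (norm x) * norm x powr - real DIM('a) * (x \<bullet> e)" for e and x :: 'a
  have C\<psi>: "C_k k (\<psi> e)" for k e
    unfolding \<psi>_def
    by (intro C_k_mult C_k_radial[OF \<eta> a] C_k_bounded_linear bounded_linear_inner_left)
  have c\<psi>: "continuous_on UNIV (\<psi> e)" "e \<in> Basis \<Longrightarrow> continuous_on UNIV (\<lambda>x. frechet_derivative (\<psi> e) (at x) e)" for e
    using C\<psi>[of 0 e] C\<psi>[of "Suc 0" e] by auto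
  have iu: "integrable ?M (\<lambda>x. u x * frechet_derivative (\<psi> e) (at x) e)" if "e \<in> Basis" for e
    using integrable_mult_continuous_ball[OF u c\<psi>(2)[OF that]] .
  have ig: "integrable ?M (\<lambda>x. (g x \<bullet> e) * \<psi> e x)" for e
    by (rule integrable_mult_continuous_ball[OF _ c\<psi>(1)]) (use g in simp)
  have "(\<integral>x. u x * (deriv \<eta> (norm x) * norm x powr (1 - real DIM('a))) \<partial>?M)
    = (\<integral>x. (\<Sum>e\<in>Basis. u x * frechet_derivative (\<psi> e) (at x) e) \<partial>?M)"
  proof (rule integral_cong_AE)
    have "AE x in ?M. (\<Sum>e\<in>Basis. u x * frechet_derivative (\<psi> e) (at x) e)
        = u x * (deriv \<eta> (norm x) * norm x powr (1 - real DIM('a)))"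
      using AE_ball_nonzero
    proof eventually_elim
      fix x :: 'a assume "x \<noteq> 0"
      then show "(\<Sum>e\<in>Basis. u x * frechet_derivative (\<psi> e) (at x) e)
        = u x * (deriv \<eta> (norm x) * norm x powr (1 - real DIM('a)))"
        unfolding sum_distrib_left[symmetric] \<psi>_def
        by (subst radial_field_divergence[OF C_k_real_deriv(1)[OF \<eta>]]) auto
    qed
    then show "AE x in ?M. u x * (deriv \<eta> (norm x) * norm x powr (1 - real DIM('a)))
        = (\<Sum>e\<in>Basis. u x * frechet_derivative (\<psi> e) (at x) e)" by eventually_elim simp
    show "(\<lambda>x. \<Sum>e\<in>Basis. u x * frechet_derivative (\<psi> e) (at x) e) \<in> borel_measurable ?M"
      using iu by (intro borel_measurable_sum borel_measurable_integrable) auto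
    have "continuous_on UNIV (deriv \<eta>)" using C_k_real_deriv(2)[OF \<eta>, of 0] by simp
    then have "deriv \<eta> \<in> borel_measurable borel" by (rule borel_measurable_continuous_onI)
    then have "(\<lambda>r. deriv \<eta> r * r powr (1 - real DIM('a))) \<in> borel_measurable borel" by measurable
    from measurable_compose[OF norm_measurable_ball this]
    show "(\<lambda>x. u x * (deriv \<eta> (norm x) * norm x powr (1 - real DIM('a)))) \<in> borel_measurable ?M"
      by (rule borel_measurable_times[OF borel_measurable_integrable[OF u]])
  qed
  also have "\<dots> = (\<Sum>e\<in>Basis. \<integral>x. u x * frechet_derivative (\<psi> e) (at x) e \<partial>?M)"
    using iu by (intro Bochner_Integration.integral_sum) auto
  also have "\<dots> = (\<Sum>e\<in>Basis. - (\<integral>x. (g x \<bullet> e) * \<psi> e x \<partial>?M))"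
    using W0_gradient_by_parts[OF p W C\<psi>] by (intro sum.cong) auto
  also have "\<dots> = - (\<integral>x. (\<Sum>e\<in>Basis. (g x \<bullet> e) * \<psi> e x) \<partial>?M)"
    using ig by (subst Bochner_Integration.integral_sum) (auto simp: sum_negf)
  also have "(\<lambda>x. \<Sum>e\<in>Basis. (g x \<bullet> e) * \<psi> e x)
    = (\<lambda>x. (g x \<bullet> sgn x) * (\<eta> (norm x) * norm x powr (1 - real DIM('a))))"
  proof
    fix x
    show "(\<Sum>e\<in>Basis. (g x \<bullet> e) * \<psi> e x) = (g x \<bullet> sgn x) * (\<eta> (norm x) * norm x powr (1 - real DIM('a)))"
  proof (cases "x = 0")
    case False
    have "(\<Sum>e\<in>Basis. (g x \<bullet> e) * \<psi> e x) = \<eta> (norm x) * norm x powr - real DIM('a) * (\<Sum>e\<in>Basis. (g x \<bullet> e) * (x \<bullet> e))"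
      by (simp add: \<psi>_def sum_distrib_left mult_ac)
    also have "(\<Sum>e\<in>Basis. (g x \<bullet> e) * (x \<bullet> e)) = norm x * (g x \<bullet> sgn x)"
      using False by (simp add: euclidean_inner[symmetric] sgn_div_norm)
    also have "\<eta> (norm x) * norm x powr - real DIM('a) * (norm x * (g x \<bullet> sgn x)) =
        (g x \<bullet> sgn x) * (\<eta> (norm x) * norm x powr (1 - real DIM('a)))"
      using False by (simp add: powr_diff powr_minus divide_inverse)
    finally show ?thesis .
    qed (use a in \<open>simp add: \<psi>_def\<close>)
  qed
  finally show ?thesis .
qed

text \<open>
  The test functions \<open>\<eta>\<close> live on \<open>[a, 2R]\<close> and need not vanish at \<open>R\<close>; this encodes the boundary
  condition, in the form that the primitive of \<open>k\<close> vanishes at \<open>R\<close>.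
\<close>

lemma radial_profile:
  fixes u :: "'a::euclidean_space \<Rightarrow> real" and w :: "real \<Rightarrow> real"
  assumes p: "1 \<le> p" and R: "0 < R" and W: "W0_gradient p (ball 0 R) u g"
    and w: "continuous_on {0<..<R} w" "\<And>r. r \<notin> {0<..<R} \<Longrightarrow> w r = 0"
    and uw: "\<And>x. x \<in> ball 0 R - {0} \<Longrightarrow> u x = w (norm x)"
  obtains k :: "real \<Rightarrow> real" where "k \<in> borel_measurable borel"
    "\<forall>a\<in>{0<..<R}. set_integrable lborel {a..R} k"
    "\<forall>a\<in>{0<..<R}. \<exists>C. (\<forall>r\<in>{a..<R}. w r = C + (LINT s:{a..r}|lborel. k s))
        \<and> C + (LINT s:{a..R}|lborel. k s) = 0"
proof -
  let ?M = "lebesgue_on (ball (0::'a) R)"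
  interpret M: finite_measure ?M by (rule finite_measure_ball)
  define N where "N = real DIM('a)"
  define c where "c = real DIM('a) * unit_ball_vol DIM('a)"
  have c: "0 < c" by (simp add: c_def)
  note RI = radial_integral[OF R, where 'a = 'a, folded c_def N_def]
  note u = W0_gradient_integrableD(1)[OF p W] and g = W0_gradient_integrableD(2)[OF p W]
  have wm[measurable]: "w \<in> borel_measurable borel"
  proof -
    have "(\<lambda>r. indicator {0<..<R} r *\<^sub>R w r) \<in> borel_measurable borel"
      using w(1) by (intro borel_measurable_continuous_on_indicator) auto
    also have "(\<lambda>r. indicator {0<..<R} r *\<^sub>R w r) = w" using w(2) by (auto simp: indicator_def fun_eq_iff)
    finally show ?thesis .
  qed
  have uae: "AE x in ?M. u x = w (norm x)"
    using AE_ball_nonzero AE_space by eventually_elim (auto simp: space_restrict_space uw)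
  have iw: "integrable ?M (\<lambda>x. w (norm x))"
    using u uae measurable_compose[OF norm_measurable_ball wm]
    by (subst integrable_cong_AE[where g = u]) (auto elim!: eventually_mono)
  note sgm = sgn_measurable_ball[where 'a = 'a and R = R]
  have h: "integrable ?M (\<lambda>x. g x \<bullet> sgn x)"
  proof (rule Bochner_Integration.integrable_bound[OF g])
    show "AE x in ?M. norm (g x \<bullet> sgn x) \<le> norm (g x)"
    proof (rule AE_I2)
      fix x
      have "norm (g x \<bullet> sgn x) \<le> norm (g x) * norm (sgn x)"
        using Cauchy_Schwarz_ineq2 by simp
      also have "\<dots> \<le> norm (g x) * 1" by (intro mult_left_mono) (auto simp: norm_sgn)
      finally show "norm (g x \<bullet> sgn x) \<le> norm (g x)" by simp
    qed
  qed (use g sgm in \<open>auto intro: borel_measurable_inner\<close>)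
  obtain k where km[measurable]: "k \<in> borel_measurable borel" and ki: "integrable ?M (\<lambda>x. k (norm x))"
    and kz: "\<And>\<zeta> C. \<zeta> \<in> borel_measurable borel \<Longrightarrow> (\<And>t. \<bar>\<zeta> t\<bar> \<le> C) \<Longrightarrow>
      (\<integral>x. (g x \<bullet> sgn x) * \<zeta> (norm x) \<partial>?M) = (\<integral>x. k (norm x) * \<zeta> (norm x) \<partial>?M)"
    by (rule conditional_factor[OF finite_measure_ball norm_measurable_ball h]) blast
  \<comment> \<open>The radial derivative extended by 0 beyond R, so that its primitive is constant
    on [R, 2R], where w is 0.\<close>
  define K where "K r = indicator {0<..<R} r * k r" for r
  have Km[measurable]: "K \<in> borel_measurable borel" unfolding K_def[abs_def] by measurable
  have N1: "0 \<le> N - 1" using DIM_positive[where 'a = 'a] by (simp add: N_def)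
  \<comment> \<open>The weight r^(N-1) may degenerate at the origin, so integrability in the ball
    gives integrability in r only on intervals bounded away from 0.\<close>
  have loc: "set_integrable lborel {a..b} (\<lambda>r. indicator {0<..<R} r * F r)"
    if F: "F \<in> borel_measurable borel" "integrable ?M (\<lambda>x. F (norm x))" and a: "0 < a"
    for F :: "real \<Rightarrow> real" and a b
  proof -
    have "integrable lborel (\<lambda>r. (indicator {0<..<R} r * (c * r powr (N - 1)) * F r))"
      using RI(2)[OF F(1)] F(2) by simp
    then have "integrable lborel (\<lambda>r. (indicator {0<..<R} r * (c * r powr (N - 1)) * F r) * inverse (c * a powr (N - 1)))"
      by simp
    moreover have "(\<lambda>r. indicator {a..b} r *\<^sub>R (indicator {0<..<R} r * F r)) \<in> borel_measurable lborel"
      using F(1) by measurable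
    moreover have "norm (indicator {a..b} r *\<^sub>R (indicator {0<..<R} r * F r))
        \<le> norm ((indicator {0<..<R} r * (c * r powr (N - 1)) * F r) * inverse (c * a powr (N - 1)))" for r
    proof (cases "r \<in> {a..b} \<inter> {0<..<R}")
      case True
      then have "a powr (N - 1) \<le> r powr (N - 1)" using a N1 by (intro powr_mono2) auto
      then have "1 \<le> c * r powr (N - 1) * inverse (c * a powr (N - 1))"
        using c a by (simp add: field_simps)
      then have "\<bar>F r\<bar> * 1 \<le> \<bar>F r\<bar> * (c * r powr (N - 1) * inverse (c * a powr (N - 1)))"
        by (rule mult_left_mono) simp
      then show ?thesis using True c a by (simp add: abs_mult mult_ac)
    qed (auto simp: indicator_def)
    ultimately show ?thesis
      unfolding set_integrable_def by (rule Bochner_Integration.integrable_bound[OF _ _ AE_I2])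
  qed
  have ind_w: "indicator {0<..<R} r * w r = w r" for r using w(2) by (auto simp: indicator_def)
  have Ki: "set_integrable lborel {a..b} K" and wi: "set_integrable lborel {a..b} w" if "0 < a" for a b
    using loc[OF km ki that] loc[OF wm iw that] by (simp_all add: K_def[abs_def] ind_w)
  have weak: "(LINT t:{a..2 * R}|lborel. w t * deriv \<eta> t) = - (LINT t:{a..2 * R}|lborel. K t * \<eta> t)"
    if a: "0 < a" and \<eta>: "\<And>j. C_k j \<eta>" and supp: "\<And>t. t \<notin> {a..2 * R} \<Longrightarrow> \<eta> t = 0" for a \<eta>
  proof -
    have c\<eta>: "continuous_on UNIV \<eta>" using \<eta>[of 0] by simp
    have cd: "continuous_on UNIV (deriv \<eta>)" using C_k_real_deriv(2)[OF \<eta>, of 0] by simp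
    have m[measurable]: "\<eta> \<in> borel_measurable borel" "deriv \<eta> \<in> borel_measurable borel"
      using c\<eta> cd by (auto intro: borel_measurable_continuous_onI)
    have low: "\<eta> t = 0" if "t < a" for t using that supp by auto
    have low': "deriv \<eta> t = 0" if "t < a" for t by (rule deriv_eq_0_of_vanishing[OF low that])
    define \<zeta> where "\<zeta> r = \<eta> r * r powr (1 - N)" for r
    have \<zeta>m: "\<zeta> \<in> borel_measurable borel" unfolding \<zeta>_def[abs_def] by measurable
    have "continuous_on {a..2 * R} \<zeta>"
      unfolding \<zeta>_def using a by (intro continuous_intros continuous_on_subset[OF c\<eta>]) auto
    then have "bounded (\<zeta> ` {a..2 * R})"
      by (intro compact_imp_bounded compact_continuous_image) auto
    then obtain B where B: "\<forall>t\<in>{a..2 * R}. \<bar>\<zeta> t\<bar> \<le> B" unfolding bounded_iff by auto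
    have \<zeta>b: "\<bar>\<zeta> t\<bar> \<le> \<bar>B\<bar>" for t
      using B supp[of t] by (cases "t \<in> {a..2 * R}") (auto simp: \<zeta>_def intro: order_trans[OF _ abs_ge_self])
    have cancel: "indicator {0<..<R} r * (c * r powr (N - 1)) * (F r * (f r * r powr (1 - N)))
        = c * (indicator {a..2 * R} r *\<^sub>R ((indicator {0<..<R} r * F r) * f r))"
      if "\<And>r. r < a \<Longrightarrow> f r = 0" for F f :: "real \<Rightarrow> real" and r
    proof (cases "r \<in> {a..<R}")
      case True
      then have "r powr (N - 1) * r powr (1 - N) = 1"
        using a powr_add[of r "N - 1" "1 - N"] by simp
      then show ?thesis using True a R by (simp add: mult_ac)
    qed (use that in \<open>auto simp: indicator_def\<close>)
    have cancel': "(\<integral>r. indicator {0<..<R} r * (c * r powr (N - 1)) * (F r * (f r * r powr (1 - N))) \<partial>lborel)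
        = c * (LINT t:{a..2 * R}|lborel. (indicator {0<..<R} t * F t) * f t)"
      if "\<And>r. r < a \<Longrightarrow> f r = 0" for F f :: "real \<Rightarrow> real"
    proof -
      have "(\<lambda>r. indicator {0<..<R} r * (c * r powr (N - 1)) * (F r * (f r * r powr (1 - N))))
        = (\<lambda>r. c * (indicator {a..2 * R} r *\<^sub>R ((indicator {0<..<R} r * F r) * f r)))"
        by (rule ext) (rule cancel[OF that])
      then show ?thesis by (simp only: set_lebesgue_integral_def integral_mult_right_zero)
    qed
    have "c * (LINT t:{a..2 * R}|lborel. w t * deriv \<eta> t)
      = (\<integral>r. indicator {0<..<R} r * (c * r powr (N - 1)) * (w r * (deriv \<eta> r * r powr (1 - N))) \<partial>lborel)"
      using cancel'[where F = w and f = "deriv \<eta>", OF low'] by (simp only: ind_w)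
    also have "\<dots> = (\<integral>x. w (norm x) * (deriv \<eta> (norm x) * norm x powr (1 - N)) \<partial>?M)"
      by (rule RI(1)[symmetric]) measurable
    also have "\<dots> = (\<integral>x. u x * (deriv \<eta> (norm x) * norm x powr (1 - N)) \<partial>?M)"
    proof (rule integral_cong_AE)
      have fm: "(\<lambda>r. deriv \<eta> r * r powr (1 - N)) \<in> borel_measurable borel"
        "(\<lambda>r. w r * (deriv \<eta> r * r powr (1 - N))) \<in> borel_measurable borel" by measurable
      show "(\<lambda>x. w (norm x) * (deriv \<eta> (norm x) * norm x powr (1 - N))) \<in> borel_measurable ?M"
        by (rule measurable_compose[OF norm_measurable_ball fm(2)])
      show "(\<lambda>x. u x * (deriv \<eta> (norm x) * norm x powr (1 - N))) \<in> borel_measurable ?M"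
        by (rule borel_measurable_times[OF borel_measurable_integrable[OF u] measurable_compose[OF norm_measurable_ball fm(1)]])
      show "AE x in ?M. w (norm x) * (deriv \<eta> (norm x) * norm x powr (1 - N)) = u x * (deriv \<eta> (norm x) * norm x powr (1 - N))"
        using uae by eventually_elim simp
    qed
    also have "\<dots> = - (\<integral>x. (g x \<bullet> sgn x) * \<zeta> (norm x) \<partial>?M)"
      using radial_profile_weak[OF p W \<eta> a low] by (simp add: \<zeta>_def N_def)
    also have "(\<integral>x. (g x \<bullet> sgn x) * \<zeta> (norm x) \<partial>?M) = (\<integral>x. k (norm x) * \<zeta> (norm x) \<partial>?M)"
      by (rule kz[OF \<zeta>m \<zeta>b])
    also have "\<dots> = (\<integral>r. indicator {0<..<R} r * (c * r powr (N - 1)) * (k r * \<zeta> r) \<partial>lborel)"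
      using \<zeta>m by (intro RI(1)[of "\<lambda>r. k r * \<zeta> r"]) measurable
    also have "\<dots> = c * (LINT t:{a..2 * R}|lborel. K t * \<eta> t)"
      using cancel'[where F = k and f = \<eta>, OF low] by (simp only: \<zeta>_def K_def)
    finally have "c * (LINT t:{a..2 * R}|lborel. w t * deriv \<eta> t)
      = c * (- (LINT t:{a..2 * R}|lborel. K t * \<eta> t))" by simp
    then show ?thesis using c by (subst (asm) mult_left_cancel) auto
  qed
  show thesis
  proof (rule that[OF Km], safe)
    fix a assume "a \<in> {0<..<R}"
    then show "set_integrable lborel {a..R} K" by (intro Ki) simp
  next
    fix a assume "a \<in> {0<..<R}"
    then have a: "0 < a" "a < R" by auto
    then have "a < 2 * R" by simp
    obtain C where C: "AE t in lborel. t \<in> {a..2 * R} \<longrightarrow> w t = C + (LINT s:{a..t}|lborel. K s)"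
      using weak_derivative_imp_primitive[OF \<open>a < 2 * R\<close> wi[OF a(1)] Ki[OF a(1)] weak[OF a(1)]] by blast
    have Kc: "continuous_on {a..R} (\<lambda>t. LINT s:{a..t}|lborel. K s)"
      by (rule continuous_on_indefinite_set_integral[OF Ki[OF a(1)]])
    have "C + (LINT s:{a..R}|lborel. K s) = 0"
    proof -
      have "\<not> (AE t in lborel. t \<notin> {R<..<2 * R})"
      proof
        assume "AE t in lborel. t \<notin> {R<..<2 * R}"
        then have "emeasure lborel {R<..<2 * R} = 0"
          by (subst (asm) AE_iff_measurable[of "{R<..<2 * R}"]) auto
        then show False using R by simp
      qed
      then obtain t where t: "t \<in> {R<..<2 * R}" "w t = C + (LINT s:{a..t}|lborel. K s)"
      proof -
        have "\<exists>t. t \<in> {R<..<2 * R} \<and> w t = C + (LINT s:{a..t}|lborel. K s)"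
        proof (rule ccontr)
          assume "\<not> ?thesis"
          then have "AE t in lborel. t \<notin> {R<..<2 * R}"
            using C a by (auto elim!: eventually_mono)
          then show False using \<open>\<not> (AE t in lborel. t \<notin> {R<..<2 * R})\<close> by simp
        qed
        then show ?thesis using that by blast
      qed
      \<comment> \<open>At a point t between R and 2R the function w is 0 and the primitive has the
        same value as at R; this yields the boundary condition.\<close>
      have "(LINT s:{a..t}|lborel. K s) = (LINT s:{a..R}|lborel. K s)"
        unfolding set_lebesgue_integral_def using t(1)
        by (intro Bochner_Integration.integral_cong) (auto simp: K_def indicator_def)
      then show ?thesis using t w(2)[of t] by simp
    qed
    moreover have "w r = C + (LINT s:{a..r}|lborel. K s)" if r: "r \<in> {a..<R}" for r
    proof -
      \<comment> \<open>The identity is known only a.e.; by continuity of D a nonzero value would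
        persist on an interval of positive length.\<close>
      define D where "D t = w t - (C + (LINT s:{a..t}|lborel. K s))" for t
      have Dc: "continuous_on {a..<R} D"
        unfolding D_def using a
        by (intro continuous_intros continuous_on_subset[OF w(1)] continuous_on_subset[OF Kc]) auto
      have "D r = 0"
      proof (rule ccontr)
        assume "D r \<noteq> 0"
        have "(D \<longlongrightarrow> D r) (at r within {a..<R})" using Dc r by (simp add: continuous_on)
        then have "(D \<longlongrightarrow> D r) (at r within {r..(r + R) / 2})" by (rule tendsto_within_subset) (use r in auto)
        then have "(D \<longlongrightarrow> D r) (at_right r)"
          using r by (simp add: at_within_Icc_at_right)
        then have "\<forall>\<^sub>F t in at_right r. D t \<noteq> 0" using \<open>D r \<noteq> 0\<close> by (rule tendsto_imp_eventually_ne)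
        then obtain b where b: "r < b" "\<And>t. r < t \<Longrightarrow> t < b \<Longrightarrow> D t \<noteq> 0"
          by (auto simp: eventually_at_right_field)
        define b' where "b' = min b R"
        have b': "r < b'" "b' \<le> R" "b' \<le> b" using b r by (auto simp: b'_def)
        have "AE t in lborel. t \<notin> {r<..<b'}"
          using C
        proof eventually_elim
          fix t assume "t \<in> {a..2 * R} \<longrightarrow> w t = C + (LINT s:{a..t}|lborel. K s)"
          then show "t \<notin> {r<..<b'}" using b(2)[of t] b' r R by (auto simp: D_def)
        qed
        then have "emeasure lborel {r<..<b'} = 0"
          by (subst (asm) AE_iff_measurable[of "{r<..<b'}"]) auto
        then show False using b' by simp
      qed
      then show ?thesis by (simp add: D_def)
    qed
    ultimately show "\<exists>C. (\<forall>r\<in>{a..<R}. w r = C + (LINT s:{a..r}|lborel. K s)) \<and> C + (LINT s:{a..R}|lborel. K s) = 0"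
      by blast
  qed
qed

section \<open>The gradient of a radial function is radial\<close>

lemma C_k_radial_0:
  fixes \<eta> :: "real \<Rightarrow> real"
  assumes "\<And>j. C_k j \<eta>" "0 < a" "\<And>t. t < a \<Longrightarrow> \<eta> t = 0"
  shows "C_k k (\<lambda>x::'a::euclidean_space. \<eta> (norm x))"
proof -
  have "(\<lambda>x::'a. \<eta> (norm x) * norm x powr 0) = (\<lambda>x. \<eta> (norm x))"
    using assms(2,3) by (auto simp: fun_eq_iff)
  then show ?thesis using C_k_radial[OF assms, of k 0, where 'a = 'a] by simp
qed

text \<open>Bumps in the norm times products of bumps in the coordinates tend boundedly to the
  indicator of shell and box, which reduces the claim to integrals over boxes.\<close>

lemma AE_eq_0_on_shell:
  fixes F :: "'a::euclidean_space \<Rightarrow> real"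
  assumes ab: "0 < a" "a < b" "b < R" and F: "integrable (lebesgue_on (ball 0 R)) F"
    and zero: "\<And>\<psi>. (\<And>k. C_k k \<psi>) \<Longrightarrow> (\<And>x. norm x \<notin> {a<..<b} \<Longrightarrow> \<psi> x = 0) \<Longrightarrow>
      (\<integral>x. F x * \<psi> x \<partial>lebesgue_on (ball 0 R)) = 0"
  shows "AE x in lebesgue_on (ball 0 R). norm x \<in> {a<..<b} \<longrightarrow> F x = 0"
proof -
  let ?M = "lebesgue_on (ball (0::'a) R)"
  \<comment> \<open>F cut off to the shell and extended by 0. It is only Lebesgue measurable, so a
    Borel version H' is passed to the criterion on boxes.\<close>
  define H where "H x = indicator (ball 0 R) x *\<^sub>R (indicator {a<..<b} (norm x) * F x)" for x
  have nm: "(\<lambda>x::'a. indicator {a<..<b} (norm x) :: real) \<in> borel_measurable ?M"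
    by (rule measurable_compose[OF norm_measurable_ball]) simp
  have Fi: "integrable ?M (\<lambda>x. indicator {a<..<b} (norm x) * F x)"
    using integrable_bounded_mult[OF F nm, of 1] by (simp add: mult.commute indicator_def)
  have H: "integrable lebesgue H"
    using Fi unfolding H_def by (subst (asm) integrable_restrict_space) (auto simp: set_integrable_def)
  then obtain H' where H': "H' \<in> borel_measurable lborel" "AE x in lborel. H x = H' x"
    using completion_ex_borel_measurable_real[of H lborel] by auto
  have HH': "AE x in lebesgue. H x = H' x" using H'(2) by (rule AE_completion)
  have H'i: "integrable lborel H'"
  proof -
    have "integrable lebesgue H'"
      using H HH' H'(1) by (subst integrable_cong_AE[where g = H]) (auto intro: measurable_completion elim: eventually_mono)
    then show ?thesis using H'(1) by (simp add: integrable_completion)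
  qed
  have "AE x in lborel. H' x = 0"
  proof (rule AE_eq_0_of_integral_box[OF H'i])
    fix c d :: 'a
    define \<psi> where "\<psi> n x = plateau a b n (norm x) * (\<Prod>i\<in>Basis. plateau (c \<bullet> i) (d \<bullet> i) n (x \<bullet> i))" for n and x :: 'a
    have C\<psi>: "C_k k (\<psi> n)" for k n
      unfolding \<psi>_def using plateau_eq_0[of _ a b n] ab
      by (intro C_k_mult C_k_radial_0[of _ a] C_k_prod C_k_compose[OF C_k_plateau] C_k_plateau
          C_k_bounded_linear bounded_linear_inner_left) auto
    have m\<psi>: "\<psi> n \<in> borel_measurable ?M" for n
      using C\<psi>[of 0 n] by (intro borel_measurable_integrable integrable_ball_continuous) simp
    have b\<psi>: "\<bar>\<psi> n x\<bar> \<le> 1" for n x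
      unfolding \<psi>_def abs_mult abs_prod using plateau_bounds
      by (intro mult_le_one prod_le_1 prod_nonneg) auto
    have lim: "(\<lambda>n. \<psi> n x) \<longlonglongrightarrow> indicator {a<..<b} (norm x) * indicator (box c d) x" for x
    proof -
      have "(\<lambda>n. \<psi> n x) \<longlonglongrightarrow> indicator {a<..<b} (norm x) * (\<Prod>i\<in>Basis. indicator {c \<bullet> i<..<d \<bullet> i} (x \<bullet> i))"
        unfolding \<psi>_def by (intro tendsto_mult tendsto_prod plateau_tendsto)
      also have "(\<Prod>i\<in>Basis. indicator {c \<bullet> i<..<d \<bullet> i} (x \<bullet> i)) = (indicator (box c d) x :: real)"
      proof (cases "x \<in> box c d")
        case True
        then show ?thesis by (simp add: mem_box)
      next
        case False
        then obtain i where "i \<in> Basis" "x \<bullet> i \<notin> {c \<bullet> i<..<d \<bullet> i}" by (auto simp: mem_box)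
        then have "\<exists>i\<in>Basis. indicator {c \<bullet> i<..<d \<bullet> i} (x \<bullet> i) = (0::real)"
            by (intro bexI[of _ i]) auto
        then show ?thesis using False by (simp add: prod_zero)
      qed
      finally show ?thesis .
    qed
    have "(\<lambda>n. \<integral>x. F x * \<psi> n x \<partial>?M) \<longlonglongrightarrow> (\<integral>x. F x * (indicator {a<..<b} (norm x) * indicator (box c d) x) \<partial>?M)"
    proof (rule integral_dominated_convergence[where w = "\<lambda>x. norm (F x)"])
      have "(\<lambda>x. indicator (box c d) x :: real) \<in> borel_measurable ?M"
        by (intro measurable_restrict_space1 measurable_completion) simp
      then show "(\<lambda>x. F x * (indicator {a<..<b} (norm x) * indicator (box c d) x)) \<in> borel_measurable ?M"
        using nm F by (intro borel_measurable_times) auto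
      show "(\<lambda>x. F x * \<psi> n x) \<in> borel_measurable ?M" for n
        using F m\<psi> by auto
      show "AE x in ?M. (\<lambda>n. F x * \<psi> n x) \<longlonglongrightarrow> F x * (indicator {a<..<b} (norm x) * indicator (box c d) x)"
        by (intro AE_I2 tendsto_mult tendsto_const lim)
      show "AE x in ?M. norm (F x * \<psi> n x) \<le> norm (F x)" for n
        using b\<psi> by (intro AE_I2) (simp add: abs_mult mult_left_le)
    qed (use F in auto)
    moreover have "(\<integral>x. F x * \<psi> n x \<partial>?M) = 0" for n
      using plateau_eq_0[of _ a b n] by (intro zero C\<psi>) (simp add: \<psi>_def)
    ultimately have "(\<integral>x. F x * (indicator {a<..<b} (norm x) * indicator (box c d) x) \<partial>?M) = 0"
      using LIMSEQ_unique[OF _ tendsto_const] by fastforce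
    also have "(\<integral>x. F x * (indicator {a<..<b} (norm x) * indicator (box c d) x) \<partial>?M)
        = (\<integral>x. indicator (box c d) x * H x \<partial>lebesgue)"
      by (subst integral_restrict_space) (auto simp: set_lebesgue_integral_def H_def mult_ac)
    also have "\<dots> = (\<integral>x. indicator (box c d) x * H' x \<partial>lebesgue)"
    proof (rule integral_cong_AE)
      have mb: "(\<lambda>x. indicator (box c d) x :: real) \<in> borel_measurable lebesgue"
        by (intro measurable_completion) simp
      show "(\<lambda>x. indicator (box c d) x * H x) \<in> borel_measurable lebesgue"
        by (rule borel_measurable_times[OF mb borel_measurable_integrable[OF H]])
      show "(\<lambda>x. indicator (box c d) x * H' x) \<in> borel_measurable lebesgue"
        by (rule borel_measurable_times[OF mb measurable_completion[OF H'(1)]])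
      show "AE x in lebesgue. indicator (box c d) x * H x = indicator (box c d) x * H' x"
        using HH' by eventually_elim simp
    qed
    also have "\<dots> = (\<integral>x. indicator (box c d) x * H' x \<partial>lborel)"
      using H'(1) by (intro integral_completion) auto
    finally show "(\<integral>x. indicator (box c d) x * H' x \<partial>lborel) = 0" .
  qed
  then have "AE x in lebesgue. H x = 0"
    using HH' AE_completion[of "\<lambda>x. H' x = 0" lborel] by auto
  then have "AE x in lebesgue. x \<in> ball 0 R \<longrightarrow> norm x \<in> {a<..<b} \<longrightarrow> F x = 0"
    by eventually_elim (auto simp: H_def)
  then show ?thesis by (subst AE_restrict_space_iff) auto
qed

text \<open>Countably many shells cover the punctured ball, so a.e. statements on shells combine;
  the summand 3 keeps every shell nonempty, since then a n <= R/3.\<close>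

lemma shells_exhaust:
  fixes R :: real
  assumes R: "0 < R"
  defines "a \<equiv> \<lambda>n. R / (real n + 3)"
  shows "0 < a n" "a n < R - a n" "R - a n < R"
    and "0 < t \<Longrightarrow> t < R \<Longrightarrow> \<exists>n. t \<in> {a n<..<R - a n}"
proof -
  have "a n \<le> R / 3" unfolding a_def using R by (intro divide_left_mono) auto
  moreover show "0 < a n" using R by (simp add: a_def)
  ultimately show "a n < R - a n" "R - a n < R" using R by auto
  assume t: "0 < t" "t < R"
  define m where "m = min t (R - t)"
  have m: "0 < m" using t by (auto simp: m_def)
  obtain n where "R / m < real n" using reals_Archimedean2 by blast
  then have "R < real n * m" using m by (simp add: field_simps)
  also have "\<dots> < (real n + 3) * m" using m by (simp add: algebra_simps)
  finally have "a n < m" by (simp add: a_def field_simps)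
  then show "\<exists>n. t \<in> {a n<..<R - a n}" by (intro exI[of _ n]) (auto simp: m_def)
qed

text \<open>
  Approximating \<open>k\<close> in \<open>L^1\<close> by continuous functions makes \<open>u\<close> a limit of functions
  \<open>v(|x|)\<close> with \<open>v\<close> of class \<open>C^1\<close>, for which the gradient is classical.
\<close>

lemma radial_gradient:
  fixes u :: "'a::euclidean_space \<Rightarrow> real" and w k :: "real \<Rightarrow> real"
  assumes p: "1 \<le> p" and R: "0 < R" and W: "W0_gradient p (ball 0 R) u g"
    and uw: "\<And>x. x \<in> ball 0 R - {0} \<Longrightarrow> u x = w (norm x)"
    and km[measurable]: "k \<in> borel_measurable borel"
    and ki: "\<And>a. 0 < a \<Longrightarrow> a < R \<Longrightarrow> set_integrable lborel {a..R} k"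
    and prim: "\<And>a. 0 < a \<Longrightarrow> a < R \<Longrightarrow> \<exists>C. \<forall>r\<in>{a..<R}. w r = C + (LINT s:{a..r}|lborel. k s)"
  shows "AE x in lebesgue_on (ball 0 R). g x = k (norm x) *\<^sub>R sgn x"
proof -
  let ?M = "lebesgue_on (ball (0::'a) R)"
  interpret M: finite_measure ?M by (rule finite_measure_ball)
  note u = W0_gradient_integrableD(1)[OF p W] and g = W0_gradient_integrableD(2)[OF p W]
  define N where "N = real DIM('a)"
  define c where "c = real DIM('a) * unit_ball_vol DIM('a)"
  have c: "0 < c" by (simp add: c_def)
  have N1: "0 \<le> N - 1" using DIM_positive[where 'a = 'a] by (simp add: N_def)
  note RI = radial_integral[OF R, where 'a = 'a, folded c_def N_def]
  have uae: "AE x in ?M. u x = w (norm x)"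
    using AE_ball_nonzero AE_space by eventually_elim (auto simp: space_restrict_space uw)
  note sgm = sgn_measurable_ball[where 'a = 'a and R = R]
  have sg1: "\<bar>sgn x \<bullet> e\<bar> \<le> 1" if "e \<in> Basis" for x e :: 'a
    using Basis_le_norm[OF that, of "sgn x"] by (auto simp: norm_sgn split: if_splits)
  have shell: "AE x in ?M. norm x \<in> {a<..<b} \<longrightarrow> g x \<bullet> e = k (norm x) * (sgn x \<bullet> e)"
    if ab: "0 < a" "a < b" "b < R" and e: "e \<in> Basis" for a b e
  proof -
    define K where "K r = indicator {a..b} r * k r" for r
    have Km[measurable]: "K \<in> borel_measurable borel" unfolding K_def[abs_def] by measurable
    have kab: "set_integrable lborel {a..b} k"
      by (rule set_integrable_subset[OF ki[of a]]) (use ab in auto)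
    have radial_int: "integrable ?M (\<lambda>x. indicator {a..b} (norm x) * h (norm x))"
        "(\<integral>x. indicator {a..b} (norm x) * \<bar>h (norm x)\<bar> \<partial>?M) \<le> c * R powr (N - 1) * (LINT t:{a..b}|lborel. \<bar>h t\<bar>)"
      if hm[measurable]: "h \<in> borel_measurable borel" and h: "set_integrable lborel {a..b} h" for h :: "real \<Rightarrow> real"
    proof -
      let ?J = "\<lambda>r. indicator {0<..<R} r * (c * r powr (N - 1))"
      have J: "0 \<le> ?J r" "?J r \<le> c * R powr (N - 1)" for r
        using c N1 by (auto simp: indicator_def intro!: powr_mono2)
      have h': "integrable lborel (\<lambda>r. indicator {a..b} r * h r)" using h by (simp add: set_integrable_def)
      have i: "integrable lborel (\<lambda>r. (indicator {a..b} r * h r) * ?J r)"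
        using J by (intro integrable_bounded_mult[OF h', of _ "c * R powr (N - 1)"]) auto
      then show "integrable ?M (\<lambda>x. indicator {a..b} (norm x) * h (norm x))"
        by (subst RI(2)[of "\<lambda>r. indicator {a..b} r * h r"]) (auto simp: mult_ac)
      have "(\<integral>x. indicator {a..b} (norm x) * \<bar>h (norm x)\<bar> \<partial>?M) = (\<integral>r. ?J r * (indicator {a..b} r * \<bar>h r\<bar>) \<partial>lborel)"
        by (rule RI(1)[of "\<lambda>r. indicator {a..b} r * \<bar>h r\<bar>"]) measurable
      also have "\<dots> \<le> (\<integral>r. c * R powr (N - 1) * (indicator {a..b} r * \<bar>h r\<bar>) \<partial>lborel)"
      proof (rule integral_mono)
        show "integrable lborel (\<lambda>r. ?J r * (indicator {a..b} r * \<bar>h r\<bar>))"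
          using integrable_abs[OF i] J by (simp add: abs_mult mult_ac)
        show "integrable lborel (\<lambda>r. c * R powr (N - 1) * (indicator {a..b} r * \<bar>h r\<bar>))"
          using integrable_abs[OF h'] by (simp add: abs_mult)
        show "?J r * (indicator {a..b} r * \<bar>h r\<bar>) \<le> c * R powr (N - 1) * (indicator {a..b} r * \<bar>h r\<bar>)" for r
          using J(2) by (intro mult_right_mono) auto
      qed
      finally show "(\<integral>x. indicator {a..b} (norm x) * \<bar>h (norm x)\<bar> \<partial>?M) \<le> c * R powr (N - 1) * (LINT t:{a..b}|lborel. \<bar>h t\<bar>)"
        by (simp add: set_lebesgue_integral_def)
    qed
    have Ki: "integrable ?M (\<lambda>x. K (norm x) * (sgn x \<bullet> e))"
    proof -
      have "(\<lambda>x. sgn x \<bullet> e) \<in> borel_measurable ?M" using sgm by (intro borel_measurable_inner) auto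
      from integrable_bounded_mult[OF radial_int(1)[OF km kab] this sg1[OF e]]
      show ?thesis by (simp add: K_def)
    qed
    define F where "F x = g x \<bullet> e - K (norm x) * (sgn x \<bullet> e)" for x
    have Fi: "integrable ?M F" unfolding F_def[abs_def] using g Ki by simp
    have "AE x in ?M. norm x \<in> {a<..<b} \<longrightarrow> F x = 0"
    proof (rule AE_eq_0_on_shell[OF ab Fi])
      fix \<psi> :: "'a \<Rightarrow> real"
      assume C\<psi>: "\<And>k. C_k k \<psi>" and supp: "\<And>x. norm x \<notin> {a<..<b} \<Longrightarrow> \<psi> x = 0"
      define d\<psi> where "d\<psi> x = frechet_derivative \<psi> (at x)" for x
      have D\<psi>: "(\<psi> has_derivative d\<psi> x) (at x)" for x
        unfolding d\<psi>_def by (rule C_k_Suc_has_derivative[OF C\<psi>])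
      have c\<psi>: "continuous_on UNIV \<psi>" "continuous_on UNIV (\<lambda>x. d\<psi> x e)"
        using C\<psi>[of 0] C\<psi>[of "Suc 0"] e by (auto simp: d\<psi>_def)
      have dsupp: "d\<psi> x = (\<lambda>h. 0)" if "norm x \<notin> {a..b}" for x
      proof -
        have "open (norm -` (- {a..b}) :: 'a set)"
          by (intro open_vimage continuous_intros)
        then have "\<forall>\<^sub>F y in nhds x. y \<in> norm -` (- {a..b})"
          using that by (intro eventually_nhds_in_open) auto
        then have "\<forall>\<^sub>F y in nhds x. 0 = \<psi> y" by eventually_elim (use supp in auto)
        then have "\<forall>\<^sub>F y in at x. 0 = \<psi> y" by (simp add: eventually_at_filter eventually_mono)
        then have "(\<psi> has_derivative (\<lambda>h. 0)) (at x)"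
          using has_derivative_transform_eventually[of "\<lambda>y. 0" "\<lambda>h. 0" x UNIV \<psi>] supp[of x] that by auto
        from frechet_derivative_at[OF this] show ?thesis by (simp add: d\<psi>_def)
      qed
      obtain B1 where B1: "\<And>x. x \<in> space ?M \<Longrightarrow> \<bar>\<psi> x\<bar> \<le> B1" using continuous_bounded_on_ball[OF c\<psi>(1)] by blast
      obtain B2 where B2: "\<And>x. x \<in> space ?M \<Longrightarrow> \<bar>d\<psi> x e\<bar> \<le> B2" using continuous_bounded_on_ball[OF c\<psi>(2)] by blast
      obtain C where C: "\<And>r. r \<in> {a..<R} \<Longrightarrow> w r = C + (LINT s:{a..r}|lborel. k s)" using prim[of a] ab by auto
      \<comment> \<open>Collects the constants that do not depend on the approximation, so that the
        error below is \<epsilon> times a fixed number.\<close>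
      define L where "L = \<bar>B2\<bar> * measure ?M (space ?M) + \<bar>B1\<bar> * (c * R powr (N - 1))"
      have L: "0 \<le> L" using c by (simp add: L_def)
      have bound: "\<bar>\<integral>x. F x * \<psi> x \<partial>?M\<bar> \<le> \<epsilon> * L" if \<epsilon>: "0 < \<epsilon>" for \<epsilon>
      proof -
        obtain f where fc: "continuous_on UNIV f" and f\<epsilon>: "(LINT t:{a..b}|lborel. \<bar>k t - f t\<bar>) < \<epsilon>"
          using L1_approx_continuous[OF kab \<epsilon>] .
        have fi: "set_integrable lborel {x..y} f" for x y
          by (rule borel_integrable_atLeastAtMost'[OF continuous_on_subset[OF fc]]) simp
        have fm[measurable]: "f \<in> borel_measurable borel" using fc by (rule borel_measurable_continuous_onI)
        \<comment> \<open>A C^1 primitive of f with v a = C = w a. The integral starts at a/2, so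
          that v is differentiable at the inner boundary a of the shell as well.\<close>
        define v where "v t = C - integral {a / 2..a} f + integral {a / 2..t} f" for t
        have dv: "(v has_real_derivative f t) (at t)" if "a / 2 < t" for t
        proof -
          have "((\<lambda>t. integral {a / 2..t} f) has_real_derivative f t) (at t)"
            using integral_has_real_derivative[OF continuous_on_subset[OF fc], of "a / 2" "t + 1" t] that
            by (simp add: at_within_Icc_at)
          then show ?thesis unfolding v_def[abs_def] by (auto intro!: derivative_eq_intros)
        qed
        have v_eq: "v t = C + (LINT s:{a..t}|lborel. f s)" if "a \<le> t" for t
        proof -
          have "integral {a / 2..a} f + integral {a..t} f = integral {a / 2..t} f"
            using ab that by (intro Henstock_Kurzweil_Integration.integral_combine integrable_continuous_interval continuous_on_subset[OF fc]) auto
          then show ?thesis using set_borel_integral_eq_integral(2)[OF fi] by (simp add: v_def)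
        qed
        have vw: "\<bar>w t - v t\<bar> \<le> \<epsilon>" if t: "t \<in> {a..b}" for t
        proof -
          have sub: "set_integrable lborel {a..t} k" by (rule set_integrable_subset[OF kab]) (use t in auto)
          have "w t - v t = (LINT s:{a..t}|lborel. k s - f s)"
            using C[of t] v_eq[of t] t ab sub fi by (simp add: set_integral_diff)
          also have "\<bar>\<dots>\<bar> \<le> (LINT s:{a..t}|lborel. \<bar>k s - f s\<bar>)"
            using integral_norm_bound[of lborel "\<lambda>s. indicator {a..t} s *\<^sub>R (k s - f s)"]
            by (simp add: set_lebesgue_integral_def abs_mult)
          also have "\<dots> \<le> (LINT s:{a..b}|lborel. \<bar>k s - f s\<bar>)"
          proof -
            have "set_integrable lborel {a..b} (\<lambda>s. \<bar>k s - f s\<bar>)"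
              by (intro set_integrable_abs set_integral_diff kab fi)
            moreover from this have "set_integrable lborel {a..t} (\<lambda>s. \<bar>k s - f s\<bar>)"
              by (rule set_integrable_subset) (use t in auto)
            ultimately show ?thesis
              unfolding set_lebesgue_integral_def set_integrable_def
              by (intro integral_mono) (use t in \<open>auto simp: indicator_def\<close>)
          qed
          finally show ?thesis using f\<epsilon> by simp
        qed
        \<comment> \<open>The classical derivative of v(|x|) \<psi>; the support of \<psi> in the
          shell removes the singularity of the norm at 0.\<close>
        define D where "D x h = v (norm x) * d\<psi> x h + f (norm x) * (x \<bullet> h) / norm x * \<psi> x" for x h
        have D0: "D x = (\<lambda>h. 0)" if "norm x \<notin> {a..b}" for x
          using dsupp[OF that] supp[of x] that by (auto simp: D_def)
        have near0: "\<forall>\<^sub>F y in nhds x. norm y < a" if "norm x < a" for x :: 'a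
          using eventually_nhds_in_open[of "ball 0 a" x] that by (auto elim: eventually_mono)
        have dD: "((\<lambda>x. v (norm x) * \<psi> x) has_derivative D x) (at x)" for x
        proof (cases "norm x < a")
          case True
          have "\<forall>\<^sub>F y in at x. 0 = v (norm y) * \<psi> y"
            using near0[OF True] unfolding eventually_at_filter
            by eventually_elim (use supp in auto)
          moreover have "0 = v (norm x) * \<psi> x" using supp[of x] True by simp
          moreover have "D x = (\<lambda>h. 0)" using True by (intro D0) auto
          ultimately show ?thesis
            using has_derivative_transform_eventually[of "\<lambda>y. 0" "\<lambda>h. 0" x UNIV "\<lambda>y. v (norm y) * \<psi> y"] by simp
        next
          case False
          then have x: "a / 2 < norm x" "x \<noteq> 0" using ab by auto
          show ?thesis
            unfolding D_def by (intro has_derivative_mult has_derivative_radial dv x D\<psi>)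
        qed
        have cD: "continuous_on UNIV (\<lambda>x. D x e)"
        proof (intro continuous_at_imp_continuous_on ballI)
          fix x :: 'a
          show "isCont (\<lambda>x. D x e) x"
          proof (cases "norm x < a")
            case True
            have "\<forall>\<^sub>F y in nhds x. D y e = 0" using near0[OF True]
              by eventually_elim (use D0 in auto)
            moreover have "isCont (\<lambda>y. 0::real) x" by simp
            ultimately show ?thesis using isCont_cong[of "\<lambda>x. D x e" "\<lambda>y. 0" x] by simp
          next
            case False
            then have x: "a / 2 < norm x" "x \<noteq> 0" using ab by auto
            have "isCont (\<lambda>x. v (norm x)) x"
              using DERIV_isCont[OF dv[OF x(1)]]
              by (intro isCont_o2[where f = norm and g = v]) (auto intro: continuous_intros)
            moreover have "isCont (\<lambda>x. f (norm x)) x"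
              using fc continuous_on_eq_continuous_at[of UNIV f]
              by (intro isCont_o2[where f = norm and g = f]) (auto intro: continuous_intros)
            moreover have "isCont \<psi> x" "isCont (\<lambda>x. d\<psi> x e) x"
              using c\<psi> by (auto simp: continuous_on_eq_continuous_at)
            ultimately show ?thesis unfolding D_def using x(2) by (intro continuous_intros) auto
          qed
        qed
        \<comment> \<open>Classical integration by parts for v(|x|) \<psi>. Subtracting it from the
          weak identity for u leaves only w - v and k - f, both controlled by \<epsilon>.\<close>
        have intD: "(\<integral>x. D x e \<partial>?M) = 0"
        proof -
          have "(\<integral>x. D x e \<partial>lborel) = 0"
            by (rule has_integral_deriv_zero[OF dD cD, of R]) (use supp ab in auto)
          then show ?thesis
            using D0 ab by (subst integral_ball_lborel[OF cD]) auto
        qed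
        have iD: "integrable ?M (\<lambda>x. D x e)" by (rule integrable_ball_continuous[OF cD])
        have i1: "integrable ?M (\<lambda>x. (g x \<bullet> e) * \<psi> x)" by (rule integrable_mult_continuous_ball[OF _ c\<psi>(1)]) (use g in simp)
        have i2: "integrable ?M (\<lambda>x. K (norm x) * (sgn x \<bullet> e) * \<psi> x)" by (rule integrable_mult_continuous_ball[OF Ki c\<psi>(1)])
        have i3: "integrable ?M (\<lambda>x. u x * d\<psi> x e)" by (rule integrable_mult_continuous_ball[OF u c\<psi>(2)])
        have "(\<integral>x. F x * \<psi> x \<partial>?M) = (\<integral>x. (g x \<bullet> e) * \<psi> x \<partial>?M) - (\<integral>x. K (norm x) * (sgn x \<bullet> e) * \<psi> x \<partial>?M)"
          unfolding F_def left_diff_distrib using i1 i2 by simp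
        also have "(\<integral>x. (g x \<bullet> e) * \<psi> x \<partial>?M) = - (\<integral>x. u x * d\<psi> x e \<partial>?M)"
          using W0_gradient_by_parts[OF p W C\<psi> e] by (simp add: d\<psi>_def)
        finally have "(\<integral>x. F x * \<psi> x \<partial>?M) =
            - (\<integral>x. u x * d\<psi> x e + K (norm x) * (sgn x \<bullet> e) * \<psi> x - D x e \<partial>?M)"
          using i2 i3 iD intD by simp
        then have "\<bar>\<integral>x. F x * \<psi> x \<partial>?M\<bar> \<le> (\<integral>x. \<bar>u x * d\<psi> x e + K (norm x) * (sgn x \<bullet> e) * \<psi> x - D x e\<bar> \<partial>?M)"
          using integral_norm_bound[of ?M "\<lambda>x. u x * d\<psi> x e + K (norm x) * (sgn x \<bullet> e) * \<psi> x - D x e"] by simp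
        also have "\<dots> \<le> (\<integral>x. \<epsilon> * \<bar>B2\<bar> + \<bar>B1\<bar> * (indicator {a..b} (norm x) * \<bar>k (norm x) - f (norm x)\<bar>) \<partial>?M)"
        proof (rule integral_mono_AE)
          show "integrable ?M (\<lambda>x. \<bar>u x * d\<psi> x e + K (norm x) * (sgn x \<bullet> e) * \<psi> x - D x e\<bar>)"
            using i2 i3 iD by simp
          have "integrable ?M (\<lambda>x. indicator {a..b} (norm x) * \<bar>k (norm x) - f (norm x)\<bar>)"
            by (rule radial_int(1)[of "\<lambda>t. \<bar>k t - f t\<bar>"]) (auto intro!: set_integrable_abs set_integral_diff kab fi)
          then show "integrable ?M (\<lambda>x. \<epsilon> * \<bar>B2\<bar> + \<bar>B1\<bar> * (indicator {a..b} (norm x) * \<bar>k (norm x) - f (norm x)\<bar>))"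
            by simp
          show "AE x in ?M. \<bar>u x * d\<psi> x e + K (norm x) * (sgn x \<bullet> e) * \<psi> x - D x e\<bar>
            \<le> \<epsilon> * \<bar>B2\<bar> + \<bar>B1\<bar> * (indicator {a..b} (norm x) * \<bar>k (norm x) - f (norm x)\<bar>)"
            using uae AE_space
          proof eventually_elim
            fix x assume ux: "u x = w (norm x)" and x: "x \<in> space ?M"
            show "\<bar>u x * d\<psi> x e + K (norm x) * (sgn x \<bullet> e) * \<psi> x - D x e\<bar>
              \<le> \<epsilon> * \<bar>B2\<bar> + \<bar>B1\<bar> * (indicator {a..b} (norm x) * \<bar>k (norm x) - f (norm x)\<bar>)"
            proof (cases "norm x \<in> {a..b}")
              case True
              have "u x * d\<psi> x e + K (norm x) * (sgn x \<bullet> e) * \<psi> x - D x e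
                = (w (norm x) - v (norm x)) * d\<psi> x e + \<psi> x * (sgn x \<bullet> e) * (k (norm x) - f (norm x))"
                using True by (simp add: ux K_def D_def sgn_div_norm divide_inverse algebra_simps)
              also have "\<bar>\<dots>\<bar> \<le> \<bar>w (norm x) - v (norm x)\<bar> * \<bar>d\<psi> x e\<bar> + \<bar>\<psi> x\<bar> * \<bar>sgn x \<bullet> e\<bar> * \<bar>k (norm x) - f (norm x)\<bar>"
                by (simp only: abs_mult[symmetric] abs_triangle_ineq)
              also have "\<dots> \<le> \<epsilon> * \<bar>B2\<bar> + \<bar>B1\<bar> * 1 * \<bar>k (norm x) - f (norm x)\<bar>"
                using vw[OF True] B1[OF x] B2[OF x] sg1[OF e] \<epsilon>
                by (intro add_mono mult_mono mult_right_mono) (auto intro: order_trans[OF _ abs_ge_self])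
              finally show ?thesis using True by simp
            next
              case False
              then have "\<psi> x = 0" "d\<psi> x e = 0" "D x e = 0" using supp[of x] dsupp[of x] D0[of x] by auto
              then show ?thesis using \<epsilon> by simp
            qed
          qed
        qed
        also have "\<dots> = \<epsilon> * \<bar>B2\<bar> * measure ?M (space ?M)
            + \<bar>B1\<bar> * (\<integral>x. indicator {a..b} (norm x) * \<bar>k (norm x) - f (norm x)\<bar> \<partial>?M)"
        proof -
          have "integrable ?M (\<lambda>x. indicator {a..b} (norm x) * \<bar>k (norm x) - f (norm x)\<bar>)"
            by (rule radial_int(1)[of "\<lambda>t. \<bar>k t - f t\<bar>"]) (auto intro!: set_integrable_abs set_integral_diff kab fi)
          then show ?thesis by simp
        qed
        also have "\<dots> \<le> \<epsilon> * \<bar>B2\<bar> * measure ?M (space ?M) + \<bar>B1\<bar> * (c * R powr (N - 1) * \<epsilon>)"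
        proof -
          have "(\<integral>x. indicator {a..b} (norm x) * \<bar>k (norm x) - f (norm x)\<bar> \<partial>?M)
              \<le> c * R powr (N - 1) * (LINT t:{a..b}|lborel. \<bar>k t - f t\<bar>)"
            by (rule radial_int(2)[of "\<lambda>t. k t - f t"]) (auto intro!: set_integral_diff kab fi)
          also have "\<dots> \<le> c * R powr (N - 1) * \<epsilon>" using f\<epsilon> c by (intro mult_left_mono) auto
          finally show ?thesis by (intro add_left_mono mult_left_mono) auto
        qed
        finally show ?thesis by (simp add: L_def algebra_simps)
      qed
      have "\<bar>\<integral>x. F x * \<psi> x \<partial>?M\<bar> \<le> 0"
      proof (rule field_le_epsilon)
        fix y :: real assume y: "0 < y"
        have "\<bar>\<integral>x. F x * \<psi> x \<partial>?M\<bar> \<le> (y / (L + 1)) * L" using y L by (intro bound) simp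
        also have "\<dots> \<le> y" using y L by (simp add: field_simps)
        finally show "\<bar>\<integral>x. F x * \<psi> x \<partial>?M\<bar> \<le> 0 + y" by simp
      qed
      then show "(\<integral>x. F x * \<psi> x \<partial>?M) = 0" by simp
    qed
    then show ?thesis by eventually_elim (auto simp: F_def K_def)
  qed
  \<comment> \<open>The identity holds a.e. on each shell and for each coordinate; countably many
    shells and finitely many coordinates give it a.e. in the ball.\<close>
  define a where "a n = R / (real n + 3)" for n
  note a = shells_exhaust(1-3)[OF R, folded a_def]
  have "AE x in ?M. \<forall>n. \<forall>e\<in>Basis. norm x \<in> {a n<..<R - a n} \<longrightarrow> g x \<bullet> e = k (norm x) * (sgn x \<bullet> e)"
    unfolding AE_all_countable by (intro allI AE_finite_allI finite_Basis shell[OF a])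
  then show ?thesis
    using AE_ball_nonzero AE_space
  proof eventually_elim
    fix x assume *: "\<forall>n. \<forall>e\<in>Basis. norm x \<in> {a n<..<R - a n} \<longrightarrow> g x \<bullet> e = k (norm x) * (sgn x \<bullet> e)"
      and x: "x \<noteq> 0" "x \<in> space ?M"
    have "0 < norm x" "norm x < R" using x by (auto simp: space_restrict_space)
    from shells_exhaust(4)[OF R this] obtain n where "norm x \<in> {a n<..<R - a n}" by (auto simp: a_def)
    then have "g x \<bullet> e = (k (norm x) *\<^sub>R sgn x) \<bullet> e" if "e \<in> Basis" for e using * that by auto
    then show "g x = k (norm x) *\<^sub>R sgn x" by (rule euclidean_eqI)
  qed
qed

section \<open>From the weak equation to the radial equation\<close>

text \<open>Inverts the one-dimensional p-Laplacian flux |x|^(p-2) x, so that the derivative can be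
  recovered from the flux including its sign.\<close>

lemma signed_powr_inverse:
  fixes x :: real
  assumes "1 < p" "y = sgn x * \<bar>x\<bar> powr (p - 1)"
  shows "x = sgn y * \<bar>y\<bar> powr (1 / (p - 1))"
proof (cases "x = 0")
  case False
  then have "sgn y = sgn x" "\<bar>y\<bar> = \<bar>x\<bar> powr (p - 1)"
    using assms by (auto simp: sgn_mult abs_mult abs_sgn_eq)
  then show ?thesis using assms by (simp add: powr_powr sgn_mult_abs)
qed (use assms in simp)

lemma signed_powr_eq: "\<bar>x\<bar> powr (p - 2) * x = sgn x * \<bar>x\<bar> powr (p - 1)" for x :: real
proof (cases "x = 0")
  case False
  then have "\<bar>x\<bar> powr (p - 1) = \<bar>x\<bar> powr (p - 2) * \<bar>x\<bar>"
    using powr_add[of "\<bar>x\<bar>" "p - 2" 1] by simp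
  then show ?thesis by (simp add: sgn_mult_abs[of x] abs_mult_sgn mult.left_commute[of "sgn x"] mult.commute)
qed simp

text \<open>The sign function is discontinuous, so the signed power is written as a difference of
  powers of the positive and the negative part.\<close>

lemma continuous_on_signed_powr:
  assumes "0 < s" "continuous_on S f"
  shows "continuous_on S (\<lambda>t. sgn (f t) * \<bar>f t\<bar> powr s :: real)"
proof -
  have "sgn y * \<bar>y\<bar> powr s = max 0 y powr s - max 0 (- y) powr s" for y :: real
    using assms(1) by (cases y "0::real" rule: linorder_cases) auto
  moreover have "continuous_on S (\<lambda>t. max 0 (h t) powr s)" if "continuous_on S h" for h :: "'a \<Rightarrow> real"
    using assms(1) that by (intro continuous_on_powr'[OF continuous_on_max]) (auto intro: continuous_intros)
  ultimately show ?thesis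
    using assms(2) by (simp add: continuous_on_diff continuous_on_minus)
qed

lemma deriv_eq_0_outside:
  fixes \<eta> :: "real \<Rightarrow> real"
  assumes "\<And>t. t \<notin> {a..b} \<Longrightarrow> \<eta> t = 0" "t \<notin> {a..b}"
  shows "deriv \<eta> t = 0"
  using assms by (intro deriv_eq_0_on_open[of "- {a..b}"]) auto

lemma radial_test_function:
  fixes \<eta> :: "real \<Rightarrow> real"
  assumes C: "\<And>j. C_k j \<eta>" and ab: "0 < a" "b < R" and supp: "\<And>t. t \<notin> {a..b} \<Longrightarrow> \<eta> t = 0"
  shows "test_function (ball (0::'a::euclidean_space) R) (\<lambda>x. \<eta> (norm x))"
    and "x \<noteq> 0 \<Longrightarrow> grad (\<lambda>x::'a. \<eta> (norm x)) x = deriv \<eta> (norm x) *\<^sub>R sgn x"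
proof -
  have sub: "closure {x::'a. \<eta> (norm x) \<noteq> 0} \<subseteq> cball 0 b"
    using supp by (intro closure_minimal) (auto intro: ccontr)
  show "test_function (ball (0::'a) R) (\<lambda>x. \<eta> (norm x))"
    unfolding test_function_def
  proof (intro conjI allI)
    show "C_k k (\<lambda>x::'a. \<eta> (norm x))" for k
      using supp by (intro C_k_radial_0[OF C ab(1)]) auto
    show "compact (closure {x::'a. \<eta> (norm x) \<noteq> 0})"
      using bounded_subset[OF bounded_cball sub] by (simp add: compact_eq_bounded_closed)
    show "closure {x::'a. \<eta> (norm x) \<noteq> 0} \<subseteq> ball 0 R"
      using sub ab by auto
  qed
  assume x: "x \<noteq> 0"
  have "frechet_derivative (\<lambda>x::'a. \<eta> (norm x)) (at x) = (\<lambda>h. deriv \<eta> (norm x) * (x \<bullet> h) / norm x)"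
    using frechet_derivative_at[OF has_derivative_radial[OF C_k_real_deriv(1)[OF C] x]] by simp
  then have "grad (\<lambda>x::'a. \<eta> (norm x)) x = (\<Sum>i\<in>Basis. (deriv \<eta> (norm x) / norm x) *\<^sub>R ((x \<bullet> i) *\<^sub>R i))"
    by (simp add: grad_def)
  also have "\<dots> = (deriv \<eta> (norm x) / norm x) *\<^sub>R (\<Sum>i\<in>Basis. (x \<bullet> i) *\<^sub>R i)"
    by (rule scaleR_sum_right[symmetric])
  also have "\<dots> = deriv \<eta> (norm x) *\<^sub>R sgn x"
    by (simp add: euclidean_representation sgn_div_norm divide_inverse)
  finally show "grad (\<lambda>x::'a. \<eta> (norm x)) x = deriv \<eta> (norm x) *\<^sub>R sgn x" .
qed

context radial_ode
begin

text \<open>Testing the equation with \<eta>(|x|) and integrating in polar form shows that the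
  signed flux r^(N-1) |k|^(p-2) k has weak derivative -r^(N-1) \<open>force\<close>. The conclusion
  has the shape required by \<open>weak_derivative_imp_primitive\<close>.\<close>

lemma radial_weak_form:
  fixes u :: "'a::euclidean_space \<Rightarrow> real"
  assumes N: "N = real DIM('a)" and R: "0 < R"
    and weak: "\<And>\<phi>. test_function (ball 0 R) \<phi> \<Longrightarrow>
          (\<integral>x. (norm (g x) powr (p - 2) * (g x \<bullet> grad \<phi> x)
                 - \<mu> / norm x powr p * \<bar>u x\<bar> powr (p - 2) * u x * \<phi> x
                 - lam * \<bar>u x\<bar> powr (p - 2) * u x * \<phi> x) \<partial>lebesgue_on (ball 0 R))
          = (\<integral>x. \<bar>u x\<bar> powr (ps - 2) * u x * \<phi> x \<partial>lebesgue_on (ball 0 R))"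
    and um: "u \<in> borel_measurable (lebesgue_on (ball 0 R))"
    and gm: "g \<in> borel_measurable (lebesgue_on (ball 0 R))"
    and wm[measurable]: "w \<in> borel_measurable borel" and km[measurable]: "k \<in> borel_measurable borel"
    and w: "\<And>r. 0 < r \<Longrightarrow> r < R \<Longrightarrow> 0 < w r" "continuous_on {0<..<R} w"
    and uw: "\<And>x. x \<in> ball 0 R - {0} \<Longrightarrow> u x = w (norm x)"
    and gk: "AE x in lebesgue_on (ball 0 R). g x = k (norm x) *\<^sub>R sgn x"
    and ab: "0 < a" "a < b" "b < R"
    and P: "set_integrable lborel {a..b} (\<lambda>t. t powr (N - 1) * (sgn (k t) * \<bar>k t\<bar> powr (p - 1)))"
    and \<eta>: "\<And>j. C_k j \<eta>" "\<And>t. t \<notin> {a..b} \<Longrightarrow> \<eta> t = 0"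
  shows "(LINT t:{a..b}|lborel. t powr (N - 1) * (sgn (k t) * \<bar>k t\<bar> powr (p - 1)) * deriv \<eta> t)
    = - (LINT t:{a..b}|lborel. - (t powr (N - 1) * force t (w t)) * \<eta> t)"
proof -
  let ?M = "lebesgue_on (ball (0::'a) R)"
  define c where "c = real DIM('a) * unit_ball_vol DIM('a)"
  have c: "0 < c" by (simp add: c_def)
  note RI = radial_integral[OF R, where 'a = 'a, folded c_def N]
  define \<phi> where "\<phi> x = \<eta> (norm x)" for x :: 'a
  note T = radial_test_function[OF \<eta>(1) ab(1) ab(3) \<eta>(2), where 'a = 'a, folded \<phi>_def]
  have c\<eta>: "continuous_on UNIV \<eta>" and cd: "continuous_on UNIV (deriv \<eta>)"
    using \<eta>(1)[of 0] C_k_real_deriv(2)[OF \<eta>(1), of 0] by auto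
  have m[measurable]: "\<eta> \<in> borel_measurable borel" "deriv \<eta> \<in> borel_measurable borel"
    using c\<eta> cd by (auto intro: borel_measurable_continuous_onI)
  have d0: "deriv \<eta> t = 0" if "t \<notin> {a..b}" for t by (rule deriv_eq_0_outside[OF \<eta>(2) that])
  \<comment> \<open>F1 and F2 are the two sides of the weak equation as functions of the radius;
    positivity of u turns its signed powers into plain ones.\<close>
  define F1 where "F1 r = sgn (k r) * \<bar>k r\<bar> powr (p - 1) * deriv \<eta> r
      - (\<mu> * r powr (- p) + lam) * w r powr (p - 1) * \<eta> r" for r
  define F2 where "F2 r = w r powr (ps - 1) * \<eta> r" for r
  have Fm[measurable]: "F1 \<in> borel_measurable borel" "F2 \<in> borel_measurable borel"
    unfolding F1_def[abs_def] F2_def[abs_def] by measurable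
  have pos: "\<bar>u x\<bar> powr (s - 2) * u x = w (norm x) powr (s - 1)" if "x \<in> ball 0 R - {0}" for x s
    using w(1)[of "norm x"] that powr_add[of "w (norm x)" "s - 2" 1] by (simp add: uw)
  have ae: "AE x in ?M. x \<in> ball 0 R - {0}"
    using AE_ball_nonzero AE_space by eventually_elim (auto simp: space_restrict_space)
  have cgrad: "grad \<phi> \<in> borel_measurable ?M" and c\<phi>: "\<phi> \<in> borel_measurable ?M"
    using T(1) by (auto intro!: borel_measurable_integrable integrable_ball_continuous continuous_on_grad
        simp: test_function_def simp del: C_k.simps dest: spec[of _ "Suc 0"])
      (metis C_k.simps(1))
  have "(\<integral>x. F1 (norm x) \<partial>?M) = (\<integral>x. (norm (g x) powr (p - 2) * (g x \<bullet> grad \<phi> x)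
                 - \<mu> / norm x powr p * \<bar>u x\<bar> powr (p - 2) * u x * \<phi> x
                 - lam * \<bar>u x\<bar> powr (p - 2) * u x * \<phi> x) \<partial>?M)"
  proof (rule integral_cong_AE)
    show "(\<lambda>x. F1 (norm x)) \<in> borel_measurable ?M"
      by (rule measurable_compose[OF norm_measurable_ball Fm(1)])
    show "(\<lambda>x. norm (g x) powr (p - 2) * (g x \<bullet> grad \<phi> x)
                 - \<mu> / norm x powr p * \<bar>u x\<bar> powr (p - 2) * u x * \<phi> x
                 - lam * \<bar>u x\<bar> powr (p - 2) * u x * \<phi> x) \<in> borel_measurable ?M"
      using um gm cgrad c\<phi> norm_measurable_ball[where 'a = 'a and R = R] by measurable
    show "AE x in ?M. F1 (norm x) = norm (g x) powr (p - 2) * (g x \<bullet> grad \<phi> x)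
                 - \<mu> / norm x powr p * \<bar>u x\<bar> powr (p - 2) * u x * \<phi> x
                 - lam * \<bar>u x\<bar> powr (p - 2) * u x * \<phi> x"
      using gk ae
    proof eventually_elim
      fix x assume gx: "g x = k (norm x) *\<^sub>R sgn x" and x: "x \<in> ball 0 R - {0}"
      have "norm (g x) powr (p - 2) * (g x \<bullet> grad \<phi> x) = \<bar>k (norm x)\<bar> powr (p - 2) * k (norm x) * deriv \<eta> (norm x)"
        using x T(2)[of x] by (simp add: gx norm_sgn dot_square_norm)
      then have 1: "norm (g x) powr (p - 2) * (g x \<bullet> grad \<phi> x) = sgn (k (norm x)) * \<bar>k (norm x)\<bar> powr (p - 1) * deriv \<eta> (norm x)"
        by (simp only: signed_powr_eq)
      have 2: "y * \<bar>u x\<bar> powr (p - 2) * u x * \<phi> x = y * w (norm x) powr (p - 1) * \<eta> (norm x)" for y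
        using pos[OF x, of p] by (simp add: \<phi>_def mult.assoc)
      show "F1 (norm x) = norm (g x) powr (p - 2) * (g x \<bullet> grad \<phi> x)
                 - \<mu> / norm x powr p * \<bar>u x\<bar> powr (p - 2) * u x * \<phi> x
                 - lam * \<bar>u x\<bar> powr (p - 2) * u x * \<phi> x"
        unfolding 1 2 F1_def by (simp add: powr_minus divide_inverse algebra_simps)
    qed
  qed
  also have "\<dots> = (\<integral>x. \<bar>u x\<bar> powr (ps - 2) * u x * \<phi> x \<partial>?M)" by (rule weak[OF T(1)])
  also have "\<dots> = (\<integral>x. F2 (norm x) \<partial>?M)"
  proof (rule integral_cong_AE)
    show "(\<lambda>x. F2 (norm x)) \<in> borel_measurable ?M"
      by (rule measurable_compose[OF norm_measurable_ball Fm(2)])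
    show "(\<lambda>x. \<bar>u x\<bar> powr (ps - 2) * u x * \<phi> x) \<in> borel_measurable ?M"
      using um c\<phi> by measurable
    show "AE x in ?M. \<bar>u x\<bar> powr (ps - 2) * u x * \<phi> x = F2 (norm x)"
      using ae by eventually_elim (simp add: pos F2_def \<phi>_def)
  qed
  finally have eq: "(\<integral>r. indicator {0<..<R} r * (c * r powr (N - 1)) * F1 r \<partial>lborel)
      = (\<integral>r. indicator {0<..<R} r * (c * r powr (N - 1)) * F2 r \<partial>lborel)"
    using RI(1)[OF Fm(1)] RI(1)[OF Fm(2)] by simp
  have ind: "indicator {0<..<R} r * (c * r powr (N - 1)) * F r = c * (indicator {a..b} r *\<^sub>R (r powr (N - 1) * F r))"
    if "\<And>t. t \<notin> {a..b} \<Longrightarrow> F t = 0" for F :: "real \<Rightarrow> real" and r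
    using that[of r] ab by (cases "r \<in> {a..b}") auto
  have F0: "F1 t = 0" "F2 t = 0" if "t \<notin> {a..b}" for t
    using that d0[OF that] \<eta>(2)[OF that] by (simp_all add: F1_def F2_def)
  have "c * (LINT t:{a..b}|lborel. t powr (N - 1) * F1 t) = c * (LINT t:{a..b}|lborel. t powr (N - 1) * F2 t)"
  proof -
    have "(\<lambda>r. indicator {0<..<R} r * (c * r powr (N - 1)) * F1 r) = (\<lambda>r. c * (indicator {a..b} r *\<^sub>R (r powr (N - 1) * F1 r)))"
      "(\<lambda>r. indicator {0<..<R} r * (c * r powr (N - 1)) * F2 r) = (\<lambda>r. c * (indicator {a..b} r *\<^sub>R (r powr (N - 1) * F2 r)))"
      using ind[of F1] ind[of F2] F0 by (auto simp: fun_eq_iff)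
    with eq show ?thesis by (simp only: set_lebesgue_integral_def integral_mult_right_zero)
  qed
  then have eq': "(LINT t:{a..b}|lborel. t powr (N - 1) * F1 t) = (LINT t:{a..b}|lborel. t powr (N - 1) * F2 t)"
    using c by simp
  have wc: "continuous_on {a..b} w" using w(2) by (rule continuous_on_subset) (use ab in auto)
  have wpos: "0 < w t" if "t \<in> {a..b}" for t using w(1) that ab by auto
  have iP: "set_integrable lborel {a..b} (\<lambda>t. t powr (N - 1) * (sgn (k t) * \<bar>k t\<bar> powr (p - 1)) * deriv \<eta> t)"
  proof -
    have "bounded (deriv \<eta> ` {a..b})"
      by (intro compact_imp_bounded compact_continuous_image continuous_on_subset[OF cd]) auto
    then obtain B where "\<forall>t\<in>{a..b}. \<bar>deriv \<eta> t\<bar> \<le> B" unfolding bounded_iff by auto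
    then have "\<bar>deriv \<eta> t\<bar> \<le> \<bar>B\<bar>" for t
      using d0[of t] by (cases "t \<in> {a..b}") (auto intro: order_trans[OF _ abs_ge_self])
    then show ?thesis
      using integrable_bounded_mult[OF P[unfolded set_integrable_def], of "deriv \<eta>" "\<bar>B\<bar>"]
      by (simp add: set_integrable_def mult_ac)
  qed
  have i1: "set_integrable lborel {a..b} (\<lambda>t. t powr (N - 1) * ((\<mu> * t powr (- p) + lam) * w t powr (p - 1) * \<eta> t))"
    using ab wpos by (intro borel_integrable_atLeastAtMost' continuous_intros wc continuous_on_subset[OF c\<eta>]) force+
  have i2: "set_integrable lborel {a..b} (\<lambda>t. t powr (N - 1) * (w t powr (ps - 1) * \<eta> t))"
    using ab wpos by (intro borel_integrable_atLeastAtMost' continuous_intros wc continuous_on_subset[OF c\<eta>]) force+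
  have "(LINT t:{a..b}|lborel. t powr (N - 1) * (sgn (k t) * \<bar>k t\<bar> powr (p - 1)) * deriv \<eta> t)
    - (LINT t:{a..b}|lborel. t powr (N - 1) * ((\<mu> * t powr (- p) + lam) * w t powr (p - 1) * \<eta> t))
    = (LINT t:{a..b}|lborel. t powr (N - 1) * (w t powr (ps - 1) * \<eta> t))"
    using eq' set_integral_diff(2)[OF iP i1]
    by (simp add: F1_def F2_def right_diff_distrib mult.assoc)
  moreover have "- (LINT t:{a..b}|lborel. - (t powr (N - 1) * force t (w t)) * \<eta> t)
    = (LINT t:{a..b}|lborel. t powr (N - 1) * ((\<mu> * t powr (- p) + lam) * w t powr (p - 1) * \<eta> t))
      + (LINT t:{a..b}|lborel. t powr (N - 1) * (w t powr (ps - 1) * \<eta> t))"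
  proof -
    have "- (LINT t:{a..b}|lborel. - (t powr (N - 1) * force t (w t)) * \<eta> t)
      = (LINT t:{a..b}|lborel. t powr (N - 1) * ((\<mu> * t powr (- p) + lam) * w t powr (p - 1) * \<eta> t)
        + t powr (N - 1) * (w t powr (ps - 1) * \<eta> t))"
      by (simp add: set_lebesgue_integral_def force_def algebra_simps flip: Bochner_Integration.integral_minus)
    then show ?thesis using set_integral_add(2)[OF i1 i2] by simp
  qed
  ultimately show ?thesis by simp
qed

end

section \<open>Regularity of the profile and conclusion\<close>

lemma has_derivative_set_integral:
  fixes f :: "real \<Rightarrow> real"
  assumes f: "continuous_on {a..b} f" and t: "a < t" "t < b"
  shows "((\<lambda>t. LINT s:{a..t}|lborel. f s) has_real_derivative f t) (at t)"
proof -
  have "((\<lambda>t. integral {a..t} f) has_real_derivative f t) (at t)"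
    using integral_has_real_derivative[OF f, of t] t by (simp add: at_within_Icc_at)
  moreover have "\<forall>\<^sub>F s in nhds t. integral {a..s} f = (LINT r:{a..s}|lborel. f r)"
    using eventually_nhds_in_open[of "{a<..<b}" t] t
    by (auto elim!: eventually_mono intro!: set_borel_integral_eq_integral(2)[symmetric]
        borel_integrable_atLeastAtMost' continuous_on_subset[OF f])
  ultimately show ?thesis by (subst (asm) DERIV_cong_ev[OF refl _ refl]) auto
qed

text \<open>A bootstrap: the flux has a continuous weak derivative, so it agrees a.e. with a C^1
  function; inverting the signed power makes k agree a.e. with a continuous function, hence w is
  C^1. This is done on compact subintervals of (0, R) and glued by taking the derivative of w
  itself.\<close>

lemma (in radial_ode) positive_radial_solution_imp_flux_solution:
  fixes u :: "'a::euclidean_space \<Rightarrow> real"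
  assumes N: "N = real DIM('a)" and sol: "positive_radial_solution p \<mu> lam (ball 0 R) u"
  obtains w q where "flux_solution w q" "\<forall>x\<in>ball 0 R - {0}. u x = w (norm x)"
proof -
  let ?M = "lebesgue_on (ball (0::'a) R)"
  have p: "1 \<le> p" using p1 by simp
  have ps: "critical_exponent DIM('a) p = ps" by (simp add: critical_exponent_def ps_def N)
  obtain g where W: "W0_gradient p (ball 0 R) u g"
    and weak: "\<And>\<phi>. test_function (ball 0 R) \<phi> \<Longrightarrow>
          (\<integral>x. (norm (g x) powr (p - 2) * (g x \<bullet> grad \<phi> x)
                 - \<mu> / norm x powr p * \<bar>u x\<bar> powr (p - 2) * u x * \<phi> x
                 - lam * \<bar>u x\<bar> powr (p - 2) * u x * \<phi> x) \<partial>?M)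
          = (\<integral>x. \<bar>u x\<bar> powr (ps - 2) * u x * \<phi> x \<partial>?M)"
    using sol unfolding positive_radial_solution_def weak_solution_def ps by blast
  obtain w0 where uc: "continuous_on (ball 0 R - {0}) u" and uw0: "\<And>x. x \<in> ball 0 R - {0} \<Longrightarrow> u x = w0 (norm x)"
    using sol unfolding positive_radial_solution_def radial_on_def by blast
  have upos: "\<And>x. x \<in> ball 0 R - {0} \<Longrightarrow> 0 < u x"
    using sol unfolding positive_radial_solution_def by blast
  have um: "u \<in> borel_measurable ?M" and gm: "g \<in> borel_measurable ?M"
    using W unfolding W0_gradient_def by blast+
  obtain e :: 'a where e: "norm e = 1" using nonempty_Basis norm_Basis by blast
  \<comment> \<open>The profile is read off along one ray; the value 0 outside (0, R) is the
    extension by zero that \<open>radial_profile\<close> expects.\<close>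
  define w where "w r = (if r \<in> {0<..<R} then u (r *\<^sub>R e) else 0)" for r
  have re: "r *\<^sub>R e \<in> ball 0 R - {0}" if "r \<in> {0<..<R}" for r using that e by auto
  have uw: "u x = w (norm x)" if "x \<in> ball 0 R - {0}" for x
  proof -
    have "norm x \<in> {0<..<R}" using that by auto
    then show ?thesis using uw0[OF that] uw0[OF re[of "norm x"]] e by (simp add: w_def)
  qed
  have wpos: "0 < w r" if "0 < r" "r < R" for r using upos[OF re[of r]] that by (simp add: w_def)
  have w_out: "w r = 0" if "r \<notin> {0<..<R}" for r using that by (auto simp: w_def)
  have wc: "continuous_on {0<..<R} w"
  proof -
    have "continuous_on {0<..<R} (\<lambda>r. u (r *\<^sub>R e))"
      by (rule continuous_on_compose2[OF uc]) (use re in \<open>auto intro: continuous_intros\<close>)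
    then show ?thesis by (rule continuous_on_eq) (simp add: w_def)
  qed
  have borel_interval: "f \<in> borel_measurable borel"
    if "continuous_on {0<..<R} f" "\<And>r. r \<notin> {0<..<R} \<Longrightarrow> f r = 0" for f :: "real \<Rightarrow> real"
  proof -
    have "(\<lambda>r. indicator {0<..<R} r *\<^sub>R f r) \<in> borel_measurable borel"
      using that(1) by (intro borel_measurable_continuous_on_indicator) auto
    also have "(\<lambda>r. indicator {0<..<R} r *\<^sub>R f r) = f" using that(2) by (auto simp: indicator_def fun_eq_iff)
    finally show ?thesis .
  qed
  have wm[measurable]: "w \<in> borel_measurable borel" by (rule borel_interval[OF wc w_out])
  obtain k :: "real \<Rightarrow> real" where km[measurable]: "k \<in> borel_measurable borel"
    and ki': "\<forall>a\<in>{0<..<R}. set_integrable lborel {a..R} k"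
    and prim: "\<forall>a\<in>{0<..<R}. \<exists>C. (\<forall>r\<in>{a..<R}. w r = C + (LINT s:{a..r}|lborel. k s))
        \<and> C + (LINT s:{a..R}|lborel. k s) = 0"
    using radial_profile[OF p R0 W wc w_out uw] .
  have ki: "set_integrable lborel {a..R} k" if "0 < a" "a < R" for a using ki' that by simp
  have prim': "\<exists>C. \<forall>r\<in>{a..<R}. w r = C + (LINT s:{a..r}|lborel. k s)" if "0 < a" "a < R" for a
    using prim that by (meson greaterThanLessThan_iff)
  have gk: "AE x in ?M. g x = k (norm x) *\<^sub>R sgn x"
    by (rule radial_gradient[OF p R0 W uw km ki prim'])
  define c where "c = real DIM('a) * unit_ball_vol DIM('a)"
  have c: "0 < c" by (simp add: c_def)
  \<comment> \<open>The L^p bound on g in polar form: the only information about the origin that is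
    carried over to \<open>flux_solutionI\<close>.\<close>
  have fin: "(\<integral>\<^sup>+r\<in>{0<..<R}. ennreal (r powr (N - 1) * \<bar>k r\<bar> powr p) \<partial>lborel) < \<infinity>"
  proof -
    have "(\<integral>\<^sup>+x. ennreal (\<bar>k (norm x)\<bar> powr p) \<partial>?M) = (\<integral>\<^sup>+x. ennreal (norm (g x) powr p) \<partial>?M)"
    proof (rule nn_integral_cong_AE)
      show "AE x in ?M. ennreal (\<bar>k (norm x)\<bar> powr p) = ennreal (norm (g x) powr p)"
        using gk AE_ball_nonzero by eventually_elim (simp add: norm_sgn)
    qed
    then have "(\<integral>\<^sup>+r. ennreal (indicator {0<..<R} r * (c * r powr (N - 1)) * \<bar>k r\<bar> powr p) \<partial>lborel) < \<infinity>"
      using radial_integral(3)[OF R0, of "\<lambda>r. \<bar>k r\<bar> powr p", where 'a = 'a] W0_gradient_Lp[OF p W]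
      by (simp add: c_def N)
    also have "(\<lambda>r. ennreal (indicator {0<..<R} r * (c * r powr (N - 1)) * \<bar>k r\<bar> powr p))
        = (\<lambda>r. ennreal c * (ennreal (r powr (N - 1) * \<bar>k r\<bar> powr p) * indicator {0<..<R} r))"
      using c by (auto simp: fun_eq_iff indicator_def ennreal_mult[symmetric] mult.assoc)
    finally have "ennreal c * (\<integral>\<^sup>+r\<in>{0<..<R}. ennreal (r powr (N - 1) * \<bar>k r\<bar> powr p) \<partial>lborel) < \<infinity>"
      by (subst (asm) nn_integral_cmult) measurable
    then show ?thesis using c by (auto simp: ennreal_mult_less_top)
  qed
  have P: "set_integrable lborel {a..b} (\<lambda>t. t powr (N - 1) * (sgn (k t) * \<bar>k t\<bar> powr (p - 1)))"
    if ab: "0 < a" "b < R" for a b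
  proof -
    have "integrable lborel (\<lambda>r. indicator {0<..<R} r * (r powr (N - 1) * \<bar>k r\<bar> powr p))"
    proof (rule integrableI_nonneg)
      have "ennreal (indicator {0<..<R} r * (r powr (N - 1) * \<bar>k r\<bar> powr p))
          = ennreal (r powr (N - 1) * \<bar>k r\<bar> powr p) * indicator {0<..<R} r" for r
        by (auto simp: indicator_def)
      then show "(\<integral>\<^sup>+r. ennreal (indicator {0<..<R} r * (r powr (N - 1) * \<bar>k r\<bar> powr p)) \<partial>lborel) < \<infinity>"
        using fin by simp
    qed auto
    moreover have "integrable lborel (\<lambda>r. R powr (N - 1) * indicator {a..b} r)"
      by (intro integrable_mult_right integrable_real_indicator) (auto simp: emeasure_lborel_Icc_eq)
    ultimately have I: "integrable lborel (\<lambda>r. indicator {0<..<R} r * (r powr (N - 1) * \<bar>k r\<bar> powr p)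
        + R powr (N - 1) * indicator {a..b} r)" by (rule Bochner_Integration.integrable_add)
    show ?thesis
      unfolding set_integrable_def
    proof (rule Bochner_Integration.integrable_bound[OF I])
      show "AE t in lborel. norm (indicator {a..b} t *\<^sub>R (t powr (N - 1) * (sgn (k t) * \<bar>k t\<bar> powr (p - 1))))
        \<le> norm (indicator {0<..<R} t * (t powr (N - 1) * \<bar>k t\<bar> powr p) + R powr (N - 1) * indicator {a..b} t)"
      proof (rule AE_I2)
        fix t
        show "norm (indicator {a..b} t *\<^sub>R (t powr (N - 1) * (sgn (k t) * \<bar>k t\<bar> powr (p - 1))))
        \<le> norm (indicator {0<..<R} t * (t powr (N - 1) * \<bar>k t\<bar> powr p) + R powr (N - 1) * indicator {a..b} t)"
        proof (cases "t \<in> {a..b}")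
          case True
          then have t: "t \<in> {0<..<R}" using ab by auto
          \<comment> \<open>Only the p-th power of k is known to be integrable; the lower power is
            dominated by it plus 1.\<close>
          have le: "\<bar>k t\<bar> powr (p - 1) \<le> \<bar>k t\<bar> powr p + 1"
          proof (cases "\<bar>k t\<bar> \<le> 1")
            case True
            then have "\<bar>k t\<bar> powr (p - 1) \<le> 1" using p1 by (intro powr_le1) auto
            then show ?thesis by (simp add: add_increasing)
          next
            case False
            then have "\<bar>k t\<bar> powr (p - 1) \<le> \<bar>k t\<bar> powr p" by (intro powr_mono) auto
            then show ?thesis by simp
          qed
          have tR: "t powr (N - 1) \<le> R powr (N - 1)" using t p1 pN by (intro powr_mono2) auto
          have "\<bar>t powr (N - 1) * (sgn (k t) * \<bar>k t\<bar> powr (p - 1))\<bar> \<le> t powr (N - 1) * \<bar>k t\<bar> powr (p - 1)"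
            by (simp add: abs_mult abs_sgn_eq)
          also have "\<dots> \<le> t powr (N - 1) * (\<bar>k t\<bar> powr p + 1)" using le by (rule mult_left_mono) simp
          also have "\<dots> \<le> t powr (N - 1) * \<bar>k t\<bar> powr p + R powr (N - 1)" using tR by (simp add: distrib_left)
          finally show ?thesis using True t by simp
        qed simp
      qed
    qed measurable
  qed
  have local: "\<exists>\<kappa>. (\<forall>t\<in>{a<..<b}. (w has_real_derivative \<kappa> t) (at t) \<and>
      ((\<lambda>t. t powr (N - 1) * (sgn (\<kappa> t) * \<bar>\<kappa> t\<bar> powr (p - 1))) has_real_derivative - (t powr (N - 1) * force t (w t))) (at t))
      \<and> continuous_on {a..b} \<kappa> \<and> (AE t in lborel. t \<in> {a..b} \<longrightarrow> k t = \<kappa> t)"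
    if ab: "0 < a" "a < b" "b < R" for a b
  proof -
    have wab: "continuous_on {a..b} w" using wc by (rule continuous_on_subset) (use ab in auto)
    have fc: "continuous_on {a..b} (\<lambda>t. - (t powr (N - 1) * force t (w t)))"
    proof -
      have "\<forall>t\<in>{a..b}. w t \<noteq> 0" using wpos ab by (metis atLeastAtMost_iff less_irrefl order_less_le_trans order_le_less_trans)
      then show ?thesis unfolding force_def using ab by (intro continuous_intros wab) auto
    qed
    obtain C where C: "AE t in lborel. t \<in> {a..b} \<longrightarrow> t powr (N - 1) * (sgn (k t) * \<bar>k t\<bar> powr (p - 1))
        = C + (LINT s:{a..t}|lborel. - (s powr (N - 1) * force s (w s)))"
      using weak_derivative_imp_primitive[OF ab(2) P[OF ab(1,3)] borel_integrable_atLeastAtMost'[OF fc]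
          radial_weak_form[OF N R0 weak um gm wm km wpos wc uw gk ab P[OF ab(1,3)]]]
      by blast
    \<comment> \<open>The C^1 representative of the signed flux on [a, b].\<close>
    define \<Phi> where "\<Phi> t = C + (LINT s:{a..t}|lborel. - (s powr (N - 1) * force s (w s)))" for t
    have d\<Phi>: "(\<Phi> has_real_derivative - (t powr (N - 1) * force t (w t))) (at t)" if "t \<in> {a<..<b}" for t
      unfolding \<Phi>_def[abs_def] using has_derivative_set_integral[OF fc, of t] that
      by (auto intro!: derivative_eq_intros)
    have c\<Phi>: "continuous_on {a..b} \<Phi>"
      unfolding \<Phi>_def[abs_def]
      by (intro continuous_intros continuous_on_indefinite_set_integral borel_integrable_atLeastAtMost' fc)
    define \<kappa> where "\<kappa> t = sgn (\<Phi> t / t powr (N - 1)) * \<bar>\<Phi> t / t powr (N - 1)\<bar> powr (1 / (p - 1))" for t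
    have c\<kappa>: "continuous_on {a..b} \<kappa>"
      unfolding \<kappa>_def[abs_def] using p1 ab
      by (intro continuous_on_signed_powr continuous_intros c\<Phi>) auto
    have \<kappa>\<Phi>: "t powr (N - 1) * (sgn (\<kappa> t) * \<bar>\<kappa> t\<bar> powr (p - 1)) = \<Phi> t" if "0 < t" for t
    proof -
      \<comment> \<open>The inversion lemma is used for the conjugate exponent p/(p-1) = 1/(p-1) +
        1, whose inverse power is again p-1.\<close>
      have "\<Phi> t / t powr (N - 1) = sgn (\<kappa> t) * \<bar>\<kappa> t\<bar> powr (1 / (1 / (p - 1) + 1 - 1))"
        using p1 by (intro signed_powr_inverse[of "1 / (p - 1) + 1"]) (auto simp: \<kappa>_def)
      then show ?thesis using that by (simp add: field_simps)
    qed
    have k\<kappa>: "AE t in lborel. t \<in> {a..b} \<longrightarrow> k t = \<kappa> t"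
      using C
    proof eventually_elim
      fix t assume *: "t \<in> {a..b} \<longrightarrow> t powr (N - 1) * (sgn (k t) * \<bar>k t\<bar> powr (p - 1))
        = C + (LINT s:{a..t}|lborel. - (s powr (N - 1) * force s (w s)))"
      show "t \<in> {a..b} \<longrightarrow> k t = \<kappa> t"
      proof
        assume t: "t \<in> {a..b}"
        then have "\<Phi> t / t powr (N - 1) = sgn (k t) * \<bar>k t\<bar> powr (p - 1)"
          using * ab by (simp add: \<Phi>_def[symmetric]) (auto simp: field_simps)
        from signed_powr_inverse[OF p1 this] show "k t = \<kappa> t" by (simp add: \<kappa>_def)
      qed
    qed
    obtain C' where C': "\<And>r. r \<in> {a..<R} \<Longrightarrow> w r = C' + (LINT s:{a..r}|lborel. k s)"
      using prim'[of a] ab by auto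
    have w\<kappa>: "w r = C' + (LINT s:{a..r}|lborel. \<kappa> s)" if r: "r \<in> {a..b}" for r
    proof -
      have "(LINT s:{a..r}|lborel. k s) = (LINT s:{a..r}|lborel. \<kappa> s)"
        unfolding set_lebesgue_integral_def
      proof (rule integral_cong_AE)
        have "set_integrable lborel {a..r} \<kappa>"
          by (intro borel_integrable_atLeastAtMost' continuous_on_subset[OF c\<kappa>]) (use r in auto)
        then show "(\<lambda>s. indicator {a..r} s *\<^sub>R \<kappa> s) \<in> borel_measurable lborel"
          by (auto simp: set_integrable_def)
        show "AE s in lborel. indicator {a..r} s *\<^sub>R k s = indicator {a..r} s *\<^sub>R \<kappa> s"
          using k\<kappa> by eventually_elim (use r in \<open>auto simp: indicator_def\<close>)
      qed measurable
      then show ?thesis using C'[of r] r ab by simp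
    qed
    have "(w has_real_derivative \<kappa> t) (at t)" if t: "t \<in> {a<..<b}" for t
    proof -
      have "((\<lambda>r. C' + (LINT s:{a..r}|lborel. \<kappa> s)) has_real_derivative \<kappa> t) (at t)"
        using has_derivative_set_integral[OF c\<kappa>, of t] t by (auto intro!: derivative_eq_intros)
      moreover have "\<forall>\<^sub>F r in nhds t. C' + (LINT s:{a..r}|lborel. \<kappa> s) = w r"
        using eventually_nhds_in_open[of "{a<..<b}" t] t by (auto elim!: eventually_mono simp: w\<kappa>)
      ultimately show ?thesis by (subst (asm) DERIV_cong_ev[OF refl _ refl]) auto
    qed
    moreover have "((\<lambda>t. t powr (N - 1) * (sgn (\<kappa> t) * \<bar>\<kappa> t\<bar> powr (p - 1))) has_real_derivative
        - (t powr (N - 1) * force t (w t))) (at t)" if t: "t \<in> {a<..<b}" for t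
    proof -
      have "\<forall>\<^sub>F r in nhds t. \<Phi> r = r powr (N - 1) * (sgn (\<kappa> r) * \<bar>\<kappa> r\<bar> powr (p - 1))"
        using eventually_nhds_in_open[of "{a<..<b}" t] t ab by (auto elim!: eventually_mono simp: \<kappa>\<Phi>)
      with d\<Phi>[OF t] show ?thesis by (subst (asm) DERIV_cong_ev[OF refl _ refl]) auto
    qed
    ultimately show ?thesis using c\<kappa> k\<kappa> by (intro exI[of _ \<kappa>]) blast
  qed
  \<comment> \<open>Each local \<kappa> is the derivative of w in the interior of its interval, so
    the local representatives need no matching: \<open>deriv w\<close> is their common
    extension.\<close>
  define K where "K r = (if r \<in> {0<..<R} then deriv w r else 0)" for r
  have K_eq: "K t = \<kappa> t" if "\<forall>t\<in>{a<..<b}. (w has_real_derivative \<kappa> t) (at t)" "0 < a" "b < R" "t \<in> {a<..<b}" for a b t \<kappa>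
    using that DERIV_imp_deriv[of w "\<kappa> t" t] by (auto simp: K_def)
  define q where "q r = - (r powr (N - 1) * (sgn (K r) * \<bar>K r\<bar> powr (p - 1)))" for r
  have dK: "(w has_real_derivative K r) (at r)" "isCont K r"
    "(q has_real_derivative r powr (N - 1) * force r (w r)) (at r)" if r: "0 < r" "r < R" for r
  proof -
    define a b where "a = r / 2" and "b = (r + R) / 2"
    have ab: "0 < a" "a < b" "b < R" and rab: "r \<in> {a<..<b}" using r by (auto simp: a_def b_def)
    obtain \<kappa> where \<kappa>: "\<forall>t\<in>{a<..<b}. (w has_real_derivative \<kappa> t) (at t)" "continuous_on {a..b} \<kappa>"
      and d: "((\<lambda>t. t powr (N - 1) * (sgn (\<kappa> t) * \<bar>\<kappa> t\<bar> powr (p - 1))) has_real_derivative - (r powr (N - 1) * force r (w r))) (at r)"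
      using local[OF ab] rab by blast
    show "(w has_real_derivative K r) (at r)" using \<kappa>(1) K_eq[OF \<kappa>(1) ab(1,3) rab] rab by simp
    have ev: "\<forall>\<^sub>F t in nhds r. K t = \<kappa> t"
      using eventually_nhds_in_open[of "{a<..<b}" r] rab
      by (auto elim!: eventually_mono simp: K_eq[OF \<kappa>(1) ab(1,3)])
    have "isCont \<kappa> r"
      using continuous_on_interior[OF \<kappa>(2), of r] rab by simp
    then show "isCont K r" using isCont_cong[OF ev] by simp
    have "((\<lambda>t. - (t powr (N - 1) * (sgn (\<kappa> t) * \<bar>\<kappa> t\<bar> powr (p - 1)))) has_real_derivative r powr (N - 1) * force r (w r)) (at r)"
      using DERIV_minus[OF d] by simp
    moreover have "\<forall>\<^sub>F t in nhds r. - (t powr (N - 1) * (sgn (\<kappa> t) * \<bar>\<kappa> t\<bar> powr (p - 1))) = q t"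
      using ev by eventually_elim (simp add: q_def)
    ultimately show "(q has_real_derivative r powr (N - 1) * force r (w r)) (at r)"
      by (subst (asm) DERIV_cong_ev[OF refl _ refl]) auto
  qed
  have Km: "K \<in> borel_measurable borel"
    by (rule borel_interval[OF continuous_at_imp_continuous_on]) (use dK(2) in \<open>auto simp: K_def\<close>)
  \<comment> \<open>The energy bound is known for k, so a.e. equality is needed to transfer it to
    K.\<close>
  have Kk: "AE t in lborel. t \<in> {0<..<R} \<longrightarrow> k t = K t"
  proof -
    define a where "a n = R / (real n + 3)" for n
    note a = shells_exhaust(1-3)[OF R0, folded a_def]
    have "AE t in lborel. t \<in> {a n<..<R - a n} \<longrightarrow> k t = K t" for n
    proof -
      obtain \<kappa> where \<kappa>: "\<forall>t\<in>{a n<..<R - a n}. (w has_real_derivative \<kappa> t) (at t)"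
        "AE t in lborel. t \<in> {a n..R - a n} \<longrightarrow> k t = \<kappa> t" using local[OF a] by blast
      show ?thesis
        using \<kappa>(2) by eventually_elim (use K_eq[OF \<kappa>(1) a(1,3)] in auto)
    qed
    then have "AE t in lborel. \<forall>n. t \<in> {a n<..<R - a n} \<longrightarrow> k t = K t"
      unfolding AE_all_countable by (rule allI)
    then show ?thesis
    proof eventually_elim
      fix t assume *: "\<forall>n. t \<in> {a n<..<R - a n} \<longrightarrow> k t = K t"
      show "t \<in> {0<..<R} \<longrightarrow> k t = K t"
      proof
        assume t: "t \<in> {0<..<R}"
        then obtain n where "t \<in> {a n<..<R - a n}" using shells_exhaust(4)[OF R0, of t] by (auto simp: a_def)
        then show "k t = K t" using * by blast
      qed
    qed
  qed
  have "flux_solution w q"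
  proof (rule flux_solutionI[OF wpos dK(1) dK(3) q_def _ Km])
    define a where "a = R / 2"
    have a: "0 < a" "a < R" using R0 by (auto simp: a_def)
    obtain C where C: "\<And>r. r \<in> {a..<R} \<Longrightarrow> w r = C + (LINT s:{a..r}|lborel. k s)"
      and C0: "C + (LINT s:{a..R}|lborel. k s) = 0" using prim a by (meson greaterThanLessThan_iff)
    \<comment> \<open>The primitive of k is continuous up to R and vanishes there, which gives the
      limit of w at the boundary.\<close>
    have "continuous_on {a..R} (\<lambda>r. C + (LINT s:{a..r}|lborel. k s))"
      by (intro continuous_intros continuous_on_indefinite_set_integral ki a)
    then have "((\<lambda>r. C + (LINT s:{a..r}|lborel. k s)) \<longlongrightarrow> C + (LINT s:{a..R}|lborel. k s)) (at R within {a..R})"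
      using a by (simp add: continuous_on)
    then have "((\<lambda>r. C + (LINT s:{a..r}|lborel. k s)) \<longlongrightarrow> 0) (at_left R)"
      using a C0 by (simp add: at_within_Icc_at_left)
    moreover have "\<forall>\<^sub>F r in at_left R. C + (LINT s:{a..r}|lborel. k s) = w r"
      using eventually_at_left_real[OF a(2)] by eventually_elim (simp add: C)
    ultimately show "(w \<longlongrightarrow> 0) (at_left R)" by (simp add: tendsto_cong)
    have "(\<integral>\<^sup>+r\<in>{0<..<R}. ennreal (r powr (N - 1) * \<bar>K r\<bar> powr p) \<partial>lborel)
      = (\<integral>\<^sup>+r\<in>{0<..<R}. ennreal (r powr (N - 1) * \<bar>k r\<bar> powr p) \<partial>lborel)"
    proof (rule nn_integral_cong_AE)
      show "AE r in lborel. ennreal (r powr (N - 1) * \<bar>K r\<bar> powr p) * indicator {0<..<R} r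
          = ennreal (r powr (N - 1) * \<bar>k r\<bar> powr p) * indicator {0<..<R} r"
        using Kk by eventually_elim (auto simp: indicator_def)
    qed
    then show "(\<integral>\<^sup>+r\<in>{0<..<R}. ennreal (r powr (N - 1) * \<bar>K r\<bar> powr p) \<partial>lborel) < \<infinity>"
      using fin by simp
  qed
  then show thesis using uw by (intro that ballI)
qed

text \<open>Equality is claimed away from the origin because \<open>radial_on\<close> leaves the
  value at the origin arbitrary.\<close>

theorem theorem1p1:
  fixes p \<mu> lam R :: real and u v :: "'a::euclidean_space \<Rightarrow> real"
  defines "N \<equiv> DIM('a)"
  defines "B \<equiv> ball (0 :: 'a) R"
  assumes "N \<ge> 2"
    and "p > 1" and "1 < p\<^sup>2" and "p\<^sup>2 < real N"
    and "0 < \<mu>" and "\<mu> \<le> real N powr (p - 1) * (real N - p\<^sup>2) / p powr p"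
    and "0 < R"
    and "0 < lam" and "ereal lam < lambda1 p \<mu> B"
    and "positive_radial_solution p \<mu> lam B u"
    and "positive_radial_solution p \<mu> lam B v"
  shows "\<forall>x\<in>B - {0}. u x = v x"
proof -
  \<comment> \<open>Since p > 1, p < p^2 < N; thus the critical exponent has a positive denominator,
    as the locale requires.\<close>
  have "p * 1 < p * p" using assms(4) by (intro mult_strict_left_mono) auto
  then have "p < real DIM('a)" using assms(6) by (simp add: N_def power2_eq_square)
  then interpret radial_ode p "real DIM('a)" \<mu> lam R "real DIM('a) * p / (real DIM('a) - p)"
    using assms by unfold_locales auto
  obtain w q where w: "flux_solution w q" "\<forall>x\<in>ball 0 R - {0}. u x = w (norm x)"
    using positive_radial_solution_imp_flux_solution[OF refl assms(12)[unfolded B_def]] .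
  obtain w' q' where w': "flux_solution w' q'" "\<forall>x\<in>ball 0 R - {0}. v x = w' (norm x)"
    using positive_radial_solution_imp_flux_solution[OF refl assms(13)[unfolded B_def]] .
  show ?thesis
  proof
    fix x assume x: "x \<in> B - {0}"
    then have "w (norm x) = w' (norm x)"
      by (intro flux_solution_unique[OF w(1) w'(1)]) (auto simp: B_def)
    then show "u x = v x" using x w(2) w'(2) by (simp add: B_def)
  qed
qed

end
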